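(* Fix $k\in\mathbb N$ and nonzero real numbers $a_1,\dots,a_k$. Set $a:=\max_i a_i$, $m:=\#\{i:a_i=a\}$, $a_\ast:=\max_i|a_i|$, $m_+:=\#\{i:a_i=a_\ast\}$, $m_-:=\#\{i:a_i=-a_\ast\}$, and $$c_m(a_1,\dots,a_k):=\log\Big(\Gamma\big(\tfrac m2\big)\sqrt{\textstyle\prod_{j:\,a_j\ne a}\big(1-\tfrac{a_j}{a}\big)}\Big),$$ $$c^\ast_{m_+,m_-}(a_1,\dots,a_k):=\begin{cases}\log\Big(\Gamma(\frac{m_+}{2})\sqrt{\prod_{j:\,a_j\neq a_\ast}(1-\frac{a_j}{a_\ast})}\Big)&m_+>m_-,\\ \log\Big(\Gamma(\frac{m_-}{2})\sqrt{\prod_{j:\,a_j\neq -a_\ast}(1+\frac{a_j}{a_\ast})}\Big)&m_+<m_-,\\ \log\Big(\Gamma(\frac{m_+}{2})\Big[\Big(\sqrt{\prod_{j:\,a_j\ne a_\ast}(1-\frac{a_j}{a_\ast})}\Big)^{-1}+\Big(\sqrt{\prod_{j:\,a_j\ne -a_\ast}(1+\frac{a_j}{a_\ast})}\Big)^{-1}\Big]^{-1}\Big)&m_+=m_-,\end{cases}$$ with empty products equal to $1$. For each $N\ge k$ let $A_N$ be a deterministic real symmetric $N\times N$ matrix whose spectrum (with multiplicity) is $\{a_1,\dots,a_k,0,\dots,0\}$, and let $\mathbf{u}_1,\dots,\mathbf{u}_N$ be the $\ell^2$-normalized eigenvectors of an $N\times N$ GOE matrix. Let $\Lambda$ be Gumbel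 distributed, $\mathbb P(\Lambda\le x)=\exp(-e^{-x})$, and $\Psi_{k/2}$ be $\frac k2$-Weibull distributed, $\mathbb P(\Psi_{k/2}\le x)=\min(\exp(-(-x)^{k/2}),1)$ (i.e. $\exp(-(-x)^{k/2})$ for $x<0$ and $1$ for $x\ge0$). \begin{enumerate} \item If $a>0$, then as $N\to\infty$, in distribution, $$\frac{N}{2a}\max_{i}\langle\mathbf{u}_i,A_N\mathbf{u}_i\rangle-\log N+\Big(1-\frac m2\Big)\log\log N+c_m(a_1,\dots,a_k)\to\Lambda,$$ $$\frac{N}{2a_\ast}\max_{i}|\langle\mathbf{u}_i,A_N\mathbf{u}_i\rangle|-\log N+\Big(1-\frac{\max(m_+,m_-)}{2}\Big)\log\log N+c^\ast_{m_+,m_-}(a_1,\dots,a_k)\to\Lambda.$$ \item If $a<0$, then with $\gamma_k=\frac12\big(\frac{2}{k\Gamma(k/2)}\big)^{2/k}$, $$\frac{\gamma_kN^{1+\frac2k}}{\big(\prod_{j=1}^k|a_j|\big)^{1/k}}\max_{i}\langle\mathbf{u}_i,A_N\mathbf{u}_i\rangle\to\Psi_{k/2}\quad\text{in distribution.}$$ \end{enumerate}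
   Context: The $N\times N$ GOE consists of real symmetric random matrices whose entries are centered Gaussians, independent up to symmetry, with $\mathbb{E}[H_{ij}^2]=\frac1N(1+\delta_{ij})$. All maxima are over $i=1,\dots,N$. *)

theory Defs
  imports "HOL-Probability.Probability" "Jordan_Normal_Form.Char_Poly"
begin

definition goe_index :: "nat \<Rightarrow> (nat \<times> nat) set" where
  "goe_index N = {(i,j). i \<le> j \<and> j < N}"

definition GOE :: "nat \<Rightarrow> ((nat \<times> nat) \<Rightarrow> real) measure" where
  "GOE N = PiM (goe_index N)
     (\<lambda>(i,j). density lborel
        (normal_density 0 (sqrt ((1 + (if i = j then 1 else 0)) / real N))))"

definition goe_mat :: "nat \<Rightarrow> ((nat \<times> nat) \<Rightarrow> real) \<Rightarrow> real mat" where
  "goe_mat N g = mat N N (\<lambda>(i,j). g (min i j, max i j))"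

definition orthonormal_eigenbasis :: "nat \<Rightarrow> real mat \<Rightarrow> (nat \<Rightarrow> real vec) \<Rightarrow> bool" where
  "orthonormal_eigenbasis N H U \<longleftrightarrow>
     (\<forall>i<N. U i \<in> carrier_vec N \<and> (\<exists>\<mu>. H *\<^sub>v U i = \<mu> \<cdot>\<^sub>v U i)) \<and>
     (\<forall>i<N. \<forall>j<N. scalar_prod (U i) (U j) = (if i = j then 1 else 0))"

definition max_quad :: "nat \<Rightarrow> real mat \<Rightarrow> (nat \<Rightarrow> real vec) \<Rightarrow> real" where
  "max_quad N A U = Max {scalar_prod (U i) (A *\<^sub>v U i) | i. i < N}"

definition max_abs_quad :: "nat \<Rightarrow> real mat \<Rightarrow> (nat \<Rightarrow> real vec) \<Rightarrow> real" where
  "max_abs_quad N A U = Max {\<bar>scalar_prod (U i) (A *\<^sub>v U i)\<bar> | i. i < N}"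

definition amax :: "nat \<Rightarrow> (nat \<Rightarrow> real) \<Rightarrow> real" where
  "amax k a = Max (a ` {1..k})"

definition mult_max :: "nat \<Rightarrow> (nat \<Rightarrow> real) \<Rightarrow> nat" where
  "mult_max k a = card {i \<in> {1..k}. a i = amax k a}"

definition astar :: "nat \<Rightarrow> (nat \<Rightarrow> real) \<Rightarrow> real" where
  "astar k a = Max ((\<lambda>i. \<bar>a i\<bar>) ` {1..k})"

definition mult_plus :: "nat \<Rightarrow> (nat \<Rightarrow> real) \<Rightarrow> nat" where
  "mult_plus k a = card {i \<in> {1..k}. a i = astar k a}"

definition mult_minus :: "nat \<Rightarrow> (nat \<Rightarrow> real) \<Rightarrow> nat" where
  "mult_minus k a = card {i \<in> {1..k}. a i = - astar k a}"

definition c_m :: "nat \<Rightarrow> (nat \<Rightarrow> real) \<Rightarrow> real" where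
  "c_m k a = ln (Gamma (real (mult_max k a) / 2) *
      sqrt (\<Prod>j\<in>{j\<in>{1..k}. a j \<noteq> amax k a}. 1 - a j / amax k a))"

definition P_plus :: "nat \<Rightarrow> (nat \<Rightarrow> real) \<Rightarrow> real" where
  "P_plus k a = (\<Prod>j\<in>{j\<in>{1..k}. a j \<noteq> astar k a}. 1 - a j / astar k a)"

definition P_minus :: "nat \<Rightarrow> (nat \<Rightarrow> real) \<Rightarrow> real" where
  "P_minus k a = (\<Prod>j\<in>{j\<in>{1..k}. a j \<noteq> - astar k a}. 1 + a j / astar k a)"

definition c_star :: "nat \<Rightarrow> (nat \<Rightarrow> real) \<Rightarrow> real" where
  "c_star k a =
     (if mult_plus k a > mult_minus k a then
        ln (Gamma (real (mult_plus k a) / 2) * sqrt (P_plus k a))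
      else if mult_plus k a < mult_minus k a then
        ln (Gamma (real (mult_minus k a) / 2) * sqrt (P_minus k a))
      else
        ln (Gamma (real (mult_plus k a) / 2) *
            inverse (inverse (sqrt (P_plus k a)) + inverse (sqrt (P_minus k a)))))"

definition gamma_k :: "nat \<Rightarrow> real" where
  "gamma_k k = 1/2 * (2 / (real k * Gamma (real k / 2))) powr (2 / real k)"

definition gumbel_cdf :: "real \<Rightarrow> real" where
  "gumbel_cdf x = exp (- exp (- x))"

definition weibull_cdf :: "real \<Rightarrow> real \<Rightarrow> real" where
  "weibull_cdf \<alpha> x = (if x < 0 then exp (- ((- x) powr \<alpha>)) else 1)"

end

theory Submission
  imports Defs "HOL-Combinatorics.List_Permutation" "HOL-Real_Asymp.Real_Asymp"
begin

text \<open>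
  The ensemble is invariant under conjugation by orthogonal matrices and almost surely has a simple
  spectrum, so the law of \<open>max\<^sub>i \<langle>u\<^sub>i, A u\<^sub>i\<rangle>\<close> depends only on the spectrum of \<open>A\<close>.  Replace the
  eigenvectors of \<open>A\<close> by the Gram--Schmidt orthonormalisation of \<open>k\<close> independent Gaussian vectors
  and use Fubini: in the basis \<open>u\<^sub>1, \<dots>, u\<^sub>N\<close> these vectors are again Gaussian, so the quantities
  \<open>N \<langle>u\<^sub>i, A u\<^sub>i\<rangle>\<close> are jointly distributed as the rows of an orthonormalised \<open>N \<times> k\<close> Gaussian matrix.
  The Gram matrix of its columns is within \<open>N powr (-1/4)\<close> of the identity with high probability, so
  the maximum differs negligibly from that of \<open>N\<close> independent copies of \<open>\<Sum>\<^sub>j a\<^sub>j g\<^sub>j\<^sup>2\<close>.  It remains to know the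
  upper tail of this weighted chi-square variable (conditioning on the non-maximal weights and
  dominated convergence), respectively its mass near \<open>0\<close> (volume of an ellipsoid).
\<close>

section \<open>Gaussian measures and quadratic-form preserving maps\<close>

text \<open>The eigenbasis is an arbitrary measurable selection, so signs and order of the
  eigenvectors are free and their joint law is not determined. Only events "all \<open>N\<close>
  values lie in \<open>S\<close>" are therefore compared; they are blind to sign and order once the
  spectrum is simple, and for them orthonormalised Gaussian columns obey an exact product identity
  that stands in for Haar measure. The obstacle is that dropping the orthonormalisation must cost
  little in all \<open>N\<close> rows at once. The Gram--Schmidt coefficients are common to all
  rows, so the error in a row is at most a constant times \<open>eps N\<close> times the squared
  norm of that same row. At the Gumbel level the largest squared norm is of order
  \<open>ln N\<close>, and the error is \<open>O(eps N * ln N)\<close>. In the Weibull case the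
  level itself tends to 0, so an additive bound is too weak; with negative weights the form controls
  the norm of the row, and the error becomes a factor \<open>1 + o(1)\<close>. In the Gumbel
  constants, the power of \<open>ln N\<close> comes from the polynomial factor of the chi-square
  tail and the product from an exponential moment of the non-maximal part.\<close>

abbreviation leb :: "'i set \<Rightarrow> ('i \<Rightarrow> real) measure" where
  "leb I \<equiv> PiM I (\<lambda>_. lborel)"

definition gauss :: "'i set \<Rightarrow> ('i \<Rightarrow> real) \<Rightarrow> ('i \<Rightarrow> real) measure" where
  "gauss I \<sigma> = PiM I (\<lambda>i. density lborel (normal_density 0 (\<sigma> i)))"

lemma sets_gauss [measurable_cong, simp]: "sets (gauss I \<sigma>) = sets (leb I)"
  unfolding gauss_def by (intro sets_PiM_cong) auto

lemma space_gauss [simp]: "space (gauss I \<sigma>) = (\<Pi>\<^sub>E i\<in>I. UNIV)"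
  unfolding gauss_def by (simp add: space_PiM)

lemma prob_space_gauss: "(\<And>i. i \<in> I \<Longrightarrow> \<sigma> i > 0) \<Longrightarrow> prob_space (gauss I \<sigma>)"
  unfolding gauss_def by (intro prob_space_PiM prob_space_normal_density) auto

text \<open>Both signs of \<open>s\<close> occur later: translations use \<open>s = 1\<close>, and
  the substitution \<open>y\<close> to \<open>f x - y\<close> in the invariance argument uses
  \<open>s = -1\<close>.\<close>

lemma lborel_distr_isometry:
  assumes "\<bar>s\<bar> = 1"
  shows "distr lborel lborel (\<lambda>x. c + s * x :: real) = lborel"
proof -
  have "lborel = density (distr lborel borel (\<lambda>x. c + s * x)) (\<lambda>_. ennreal \<bar>s\<bar>)"
    using assms by (intro lborel_real_affine) auto
  also have "\<dots> = distr lborel borel (\<lambda>x. c + s * x)"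
    using assms by (simp add: density_1)
  also have "\<dots> = distr lborel lborel (\<lambda>x. c + s * x)"
    by (rule distr_cong) auto
  finally show ?thesis by simp
qed

lemma leb_distr_isometry:
  assumes "finite I" "\<bar>s\<bar> = 1"
  shows "distr (leb I) (leb I) (\<lambda>x. \<lambda>i\<in>I. c i + s * x i) = leb I"
proof -
  interpret product_sigma_finite "\<lambda>_. lborel :: real measure" by standard
  have [measurable]: "(\<lambda>x. \<lambda>i\<in>I. c i + s * x i) \<in> measurable (leb I) (leb I)"
    by (intro measurable_restrict) measurable
  show ?thesis
  proof (rule PiM_eqI)
    show "finite I" by fact
    fix A :: "'a \<Rightarrow> real set" assume A: "\<And>i. i \<in> I \<Longrightarrow> A i \<in> sets lborel"
    have "emeasure (distr (leb I) (leb I) (\<lambda>x. \<lambda>i\<in>I. c i + s * x i)) (Pi\<^sub>E I A)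
       = emeasure (leb I) ((\<lambda>x. \<lambda>i\<in>I. c i + s * x i) -` (Pi\<^sub>E I A) \<inter> space (leb I))"
      using A assms by (intro emeasure_distr) auto
    also have "(\<lambda>x. \<lambda>i\<in>I. c i + s * x i) -` (Pi\<^sub>E I A) \<inter> space (leb I)
         = (\<Pi>\<^sub>E i\<in>I. (\<lambda>x. c i + s * x) -` A i \<inter> space lborel)"
      by (auto simp: space_PiM PiE_iff)
    also have "emeasure (leb I) \<dots> = (\<Prod>i\<in>I. emeasure lborel ((\<lambda>x. c i + s * x) -` A i \<inter> space lborel))"
      using A assms by (intro emeasure_PiM measurable_sets[of _ lborel lborel]) auto
    also have "\<dots> = (\<Prod>i\<in>I. emeasure (distr lborel lborel (\<lambda>x. c i + s * x)) (A i))"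
      using A by (intro prod.cong refl) (subst emeasure_distr, auto)
    also have "\<dots> = (\<Prod>i\<in>I. emeasure lborel (A i))"
      using assms by (simp add: lborel_distr_isometry)
    finally show "emeasure (distr (leb I) (leb I) (\<lambda>x. \<lambda>i\<in>I. c i + s * x i)) (Pi\<^sub>E I A) = \<dots>" .
  qed simp
qed

lemma nn_integral_leb_isometry:
  assumes "finite I" "\<bar>s\<bar> = 1" "f \<in> borel_measurable (leb I)"
  shows "(\<integral>\<^sup>+x. f (\<lambda>i\<in>I. c i + s * x i) \<partial>leb I) = (\<integral>\<^sup>+x. f x \<partial>leb I)"
proof -
  have [measurable]: "(\<lambda>x. \<lambda>i\<in>I. c i + s * x i) \<in> measurable (leb I) (leb I)"
    by (intro measurable_restrict) measurable
  have "(\<integral>\<^sup>+x. f x \<partial>leb I) = (\<integral>\<^sup>+x. f x \<partial>distr (leb I) (leb I) (\<lambda>x. \<lambda>i\<in>I. c i + s * x i))"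
    using assms by (simp add: leb_distr_isometry)
  also have "\<dots> = (\<integral>\<^sup>+x. f (\<lambda>i\<in>I. c i + s * x i) \<partial>leb I)"
    using assms by (intro nn_integral_distr) auto
  finally show ?thesis by simp
qed

lemma gauss_eq_density:
  assumes "finite I" "\<And>i. i \<in> I \<Longrightarrow> \<sigma> i > 0"
  shows "gauss I \<sigma> = density (leb I) (\<lambda>x. \<Prod>i\<in>I. ennreal (normal_density 0 (\<sigma> i) (x i)))"
proof -
  \<comment> \<open>The locale of product probability spaces quantifies over every index, so
    \<open>\<sigma>\<close> is extended by the harmless value 1 outside \<open>I\<close>.\<close>
  define \<sigma>' where "\<sigma>' i = (if i \<in> I then \<sigma> i else 1)" for i
  have pos: "\<sigma>' i > 0" for i using assms by (auto simp: \<sigma>'_def)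
  interpret L: product_sigma_finite "\<lambda>_. lborel :: real measure" by standard
  interpret N: product_prob_space "\<lambda>i. density lborel (\<lambda>x. ennreal (normal_density 0 (\<sigma>' i) x))"
    by (rule product_prob_spaceI) (auto intro!: prob_space_normal_density pos)
  define D where "D = density (leb I) (\<lambda>x. \<Prod>i\<in>I. ennreal (normal_density 0 (\<sigma>' i) (x i)))"
  have "D = PiM I (\<lambda>i. density lborel (\<lambda>x. ennreal (normal_density 0 (\<sigma>' i) x)))"
  proof (rule N.PiM_eqI)
    show "finite I" by fact
    show "sets D = sets (PiM I (\<lambda>i. density lborel (\<lambda>x. ennreal (normal_density 0 (\<sigma>' i) x))))"
      unfolding D_def by (auto intro!: sets_PiM_cong)
    fix A assume A: "\<And>i. i \<in> I \<Longrightarrow> A i \<in> sets (density lborel (\<lambda>x. ennreal (normal_density 0 (\<sigma>' i) x)))"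
    then have A': "\<And>i. i \<in> I \<Longrightarrow> A i \<in> sets borel" by simp
    have "emeasure D (Pi\<^sub>E I A) = (\<integral>\<^sup>+x. (\<Prod>i\<in>I. ennreal (normal_density 0 (\<sigma>' i) (x i))) * indicator (Pi\<^sub>E I A) x \<partial>leb I)"
      unfolding D_def using A' assms(1) by (intro emeasure_density) auto
    also have "\<dots> = (\<integral>\<^sup>+x. (\<Prod>i\<in>I. ennreal (normal_density 0 (\<sigma>' i) (x i)) * indicator (A i) (x i)) \<partial>leb I)"
    proof (rule nn_integral_cong)
      fix x assume "x \<in> space (leb I)"
      then have "indicator (Pi\<^sub>E I A) x = (\<Prod>i\<in>I. indicator (A i) (x i) :: ennreal)"
        using assms(1) by (auto simp: indicator_def space_PiM PiE_iff prod_zero_iff split: if_splits)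
      then show "(\<Prod>i\<in>I. ennreal (normal_density 0 (\<sigma>' i) (x i))) * indicator (Pi\<^sub>E I A) x
         = (\<Prod>i\<in>I. ennreal (normal_density 0 (\<sigma>' i) (x i)) * indicator (A i) (x i))"
        by (simp add: prod.distrib)
    qed
    also have "\<dots> = (\<Prod>i\<in>I. \<integral>\<^sup>+x. ennreal (normal_density 0 (\<sigma>' i) x) * indicator (A i) x \<partial>lborel)"
      using A' assms(1) by (intro L.product_nn_integral_prod) auto
    also have "\<dots> = (\<Prod>i\<in>I. emeasure (density lborel (\<lambda>x. ennreal (normal_density 0 (\<sigma>' i) x))) (A i))"
      using A' by (intro prod.cong refl) (subst emeasure_density, auto)
    finally show "emeasure D (Pi\<^sub>E I A) = \<dots>" .
  qed
  moreover have "gauss I \<sigma> = PiM I (\<lambda>i. density lborel (\<lambda>x. ennreal (normal_density 0 (\<sigma>' i) x)))"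
    unfolding gauss_def \<sigma>'_def by (intro PiM_cong) auto
  moreover have "D = density (leb I) (\<lambda>x. \<Prod>i\<in>I. ennreal (normal_density 0 (\<sigma> i) (x i)))"
    unfolding D_def \<sigma>'_def by (auto intro!: density_cong prod.cong)
  ultimately show ?thesis by simp
qed

text \<open>The density depends on \<open>x\<close> through the quadratic form alone, so a map that
  preserves the form preserves the density.\<close>

lemma prod_normal_density:
  assumes "finite I"
  shows "(\<Prod>i\<in>I. ennreal (normal_density 0 (\<sigma> i) (x i)))
     = ennreal ((\<Prod>i\<in>I. 1 / sqrt (2 * pi * (\<sigma> i)\<^sup>2)) * exp (- (\<Sum>i\<in>I. (x i)\<^sup>2 / (\<sigma> i)\<^sup>2) / 2))"
proof -
  have "(\<Prod>i\<in>I. ennreal (normal_density 0 (\<sigma> i) (x i))) = ennreal (\<Prod>i\<in>I. normal_density 0 (\<sigma> i) (x i))"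
    by (rule prod_ennreal) simp
  also have "(\<Prod>i\<in>I. normal_density 0 (\<sigma> i) (x i))
      = (\<Prod>i\<in>I. 1 / sqrt (2 * pi * (\<sigma> i)\<^sup>2)) * (\<Prod>i\<in>I. exp (- ((x i)\<^sup>2 / (\<sigma> i)\<^sup>2) / 2))"
    unfolding normal_density_def by (subst prod.distrib [symmetric]) (simp add: field_simps)
  also have "(\<Prod>i\<in>I. exp (- ((x i)\<^sup>2 / (\<sigma> i)\<^sup>2) / 2)) = exp (- (\<Sum>i\<in>I. (x i)\<^sup>2 / (\<sigma> i)\<^sup>2) / 2)"
    using assms by (simp add: exp_sum [symmetric] sum_divide_distrib sum_negf)
  finally show ?thesis .
qed

text \<open>
  A linear map of full rank scales Lebesgue measure by a constant; comparing the two on the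
  weight \<open>b\<close> (a Gaussian density left invariant by \<open>f\<close>) shows that the constant is \<open>1\<close>.
  Fubini and translation invariance do both steps at once.
\<close>

lemma leb_distr_quadratic_invariant:
  fixes f :: "('i \<Rightarrow> real) \<Rightarrow> 'i \<Rightarrow> real"
  assumes I: "finite I" and \<sigma>: "\<And>i. i \<in> I \<Longrightarrow> \<sigma> i > 0"
    and f [measurable]: "f \<in> measurable (leb I) (leb I)"
    and diff: "\<And>x y i. x \<in> space (leb I) \<Longrightarrow> y \<in> space (leb I) \<Longrightarrow> i \<in> I \<Longrightarrow>
                  f (\<lambda>i\<in>I. x i - y i) i = f x i - f y i"
    and surj: "\<And>y. y \<in> space (leb I) \<Longrightarrow> \<exists>x\<in>space (leb I). f x = y"
    and Q: "\<And>x. x \<in> space (leb I) \<Longrightarrow>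
               (\<Sum>i\<in>I. (f x i)\<^sup>2 / (\<sigma> i)\<^sup>2) = (\<Sum>i\<in>I. (x i)\<^sup>2 / (\<sigma> i)\<^sup>2)"
  shows "distr (leb I) (leb I) f = leb I"
proof (rule measure_eqI)
  define b where "b = (\<lambda>x. \<Prod>i\<in>I. ennreal (normal_density 0 (\<sigma> i) (x i)))"
  interpret product_sigma_finite "\<lambda>_. lborel :: real measure" by standard
  interpret L: sigma_finite_measure "leb I" using I by (rule sigma_finite)
  interpret LL: pair_sigma_finite "leb I" "leb I" by standard
  interpret G: prob_space "gauss I \<sigma>" by (intro prob_space_gauss \<sigma>)
  have [measurable]: "b \<in> borel_measurable (leb I)" unfolding b_def using I by measurable
  have fsp: "f x \<in> space (leb I)" if "x \<in> space (leb I)" for x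
    using measurable_space[OF f that] .
  have b1: "(\<integral>\<^sup>+x. b x \<partial>leb I) = 1"
  proof -
    have "gauss I \<sigma> = density (leb I) b"
      using gauss_eq_density[of I \<sigma>] I \<sigma> by (simp add: b_def)
    then have "emeasure (density (leb I) b) (space (leb I)) = 1"
      using G.emeasure_space_1 by simp
    also have "emeasure (density (leb I) b) (space (leb I)) = (\<integral>\<^sup>+x. b x \<partial>leb I)"
      by (subst emeasure_density) (auto intro!: nn_integral_cong)
    finally show ?thesis .
  qed
  have bf: "b (f x) = b x" if "x \<in> space (leb I)" for x
    unfolding b_def prod_normal_density[OF I] Q[OF that] ..
  have minus: "(\<lambda>i\<in>I. x i - y i) \<in> space (leb I)" for x y :: "'i \<Rightarrow> real"
    by (simp add: space_PiM)
  fix A assume A: "A \<in> sets (distr (leb I) (leb I) f)"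
  then have [measurable]: "A \<in> sets (leb I)" by simp
  have ext: "(\<lambda>i\<in>I. x i) = x" if "x \<in> space (leb I)" for x :: "'i \<Rightarrow> real"
    using that by (auto simp: space_PiM PiE_def extensional_restrict)
  have fm: "(\<lambda>x. f x i) \<in> borel_measurable (leb I)" if "i \<in> I" for i
    using measurable_compose[OF f measurable_component_singleton[OF that]] by (simp add: measurable_lborel2)
  have pm: "(\<lambda>x. x i) \<in> borel_measurable (leb I)" if "i \<in> I" for i
    using measurable_component_singleton[OF that, of "\<lambda>_. lborel"] by (simp add: measurable_lborel2)
  note fst_m = measurable_compose[OF measurable_fst] and snd_m = measurable_compose[OF measurable_snd]
  have [measurable]: "(\<lambda>p. \<lambda>i\<in>I. f (fst p) i - snd p i) \<in> measurable (leb I \<Otimes>\<^sub>M leb I) (leb I)"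
    by (intro measurable_restrict, subst measurable_lborel1, intro borel_measurable_diff fst_m[OF fm] snd_m[OF pm])
  have [measurable]: "(\<lambda>p. \<lambda>i\<in>I. f (snd p) i - fst p i) \<in> measurable (leb I \<Otimes>\<^sub>M leb I) (leb I)"
    by (intro measurable_restrict, subst measurable_lborel1, intro borel_measurable_diff snd_m[OF fm] fst_m[OF pm])
  have [measurable]: "(\<lambda>p. \<lambda>i\<in>I. snd p i + f (fst p) i) \<in> measurable (leb I \<Otimes>\<^sub>M leb I) (leb I)"
    by (intro measurable_restrict, subst measurable_lborel1, intro borel_measurable_add fst_m[OF fm] snd_m[OF pm])
  have [measurable]: "(\<lambda>p. \<lambda>i\<in>I. fst p i + f (snd p) i) \<in> measurable (leb I \<Otimes>\<^sub>M leb I) (leb I)"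
    by (intro measurable_restrict, subst measurable_lborel1, intro borel_measurable_add snd_m[OF fm] fst_m[OF pm])
  have "emeasure (distr (leb I) (leb I) f) A = (\<integral>\<^sup>+x. indicator A (f x) \<partial>leb I)"
    using nn_integral_distr[OF f, of "indicator A"] by simp
  \<comment> \<open>The factor 1 is written as the total mass of \<open>b\<close>, translated by
    \<open>f x\<close>.\<close>
  also have "\<dots> = (\<integral>\<^sup>+x. (\<integral>\<^sup>+y. indicator A (f x) * b (\<lambda>i\<in>I. y i + f x i) \<partial>leb I) \<partial>leb I)"
  proof (rule nn_integral_cong)
    fix x assume x: "x \<in> space (leb I)"
    have [measurable]: "(\<lambda>y. \<lambda>i\<in>I. y i + f x i) \<in> measurable (leb I) (leb I)"
      by (intro measurable_restrict) measurable
    have "(\<integral>\<^sup>+y. indicator A (f x) * b (\<lambda>i\<in>I. y i + f x i) \<partial>leb I)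
        = indicator A (f x) * (\<integral>\<^sup>+y. b (\<lambda>i\<in>I. f x i + 1 * y i) \<partial>leb I)"
      by (subst nn_integral_cmult) (auto simp: add.commute)
    also have "(\<integral>\<^sup>+y. b (\<lambda>i\<in>I. f x i + 1 * y i) \<partial>leb I) = 1"
      by (subst nn_integral_leb_isometry) (auto simp: I b1)
    finally show "indicator A (f x) = (\<integral>\<^sup>+y. indicator A (f x) * b (\<lambda>i\<in>I. y i + f x i) \<partial>leb I)"
      by (simp only: mult_1_right)
  qed
  also have "\<dots> = (\<integral>\<^sup>+y. (\<integral>\<^sup>+x. indicator A (f x) * b (\<lambda>i\<in>I. y i + f x i) \<partial>leb I) \<partial>leb I)"
    by (rule LL.Fubini'[symmetric]) (simp add: split_beta)
  \<comment> \<open>Surjectivity gives \<open>f x0 = y\<close>. Substituting \<open>x - x0\<close>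
    for \<open>x\<close> turns \<open>f x\<close> into \<open>f x - y\<close>, so the argument of
    \<open>b\<close> becomes \<open>f x\<close>, and \<open>b (f x) = b x\<close>.\<close>
  also have "\<dots> = (\<integral>\<^sup>+y. (\<integral>\<^sup>+x. indicator A (\<lambda>i\<in>I. f x i - y i) * b x \<partial>leb I) \<partial>leb I)"
  proof (rule nn_integral_cong)
    fix y assume y: "y \<in> space (leb I)"
    obtain x0 where x0: "x0 \<in> space (leb I)" "f x0 = y" using surj[OF y] by auto
    have [measurable]: "(\<lambda>x. \<lambda>i\<in>I. y i + f x i) \<in> measurable (leb I) (leb I)"
      by (intro measurable_restrict, subst measurable_lborel1, intro borel_measurable_add fm) auto
    have "(\<integral>\<^sup>+x. indicator A (f x) * b (\<lambda>i\<in>I. y i + f x i) \<partial>leb I)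
       = (\<integral>\<^sup>+x. indicator A (f (\<lambda>i\<in>I. - x0 i + 1 * x i)) * b (\<lambda>i\<in>I. y i + f (\<lambda>i\<in>I. - x0 i + 1 * x i) i) \<partial>leb I)"
      by (rule nn_integral_leb_isometry[symmetric, OF I]) auto
    also have "\<dots> = (\<integral>\<^sup>+x. indicator A (\<lambda>i\<in>I. f x i - y i) * b x \<partial>leb I)"
    proof (rule nn_integral_cong)
      fix x assume x: "x \<in> space (leb I)"
      have e: "f (\<lambda>i\<in>I. - x0 i + 1 * x i) i = f x i - y i" if "i \<in> I" for i
        using diff[OF x x0(1) that] x0(2) by simp
      have *: "f (\<lambda>i\<in>I. - x0 i + 1 * x i) = (\<lambda>i\<in>I. f x i - y i)"
      proof -
        have m: "(\<lambda>i\<in>I. - x0 i + 1 * x i) \<in> space (leb I)" by (simp add: space_PiM)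
        have "f (\<lambda>i\<in>I. - x0 i + 1 * x i) = (\<lambda>i\<in>I. f (\<lambda>i\<in>I. - x0 i + 1 * x i) i)"
          by (rule ext[OF fsp[OF m], symmetric])
        also have "\<dots> = (\<lambda>i\<in>I. f x i - y i)" by (intro restrict_ext) (simp only: e)
        finally show ?thesis .
      qed
      have "(\<lambda>i\<in>I. y i + f (\<lambda>i\<in>I. - x0 i + 1 * x i) i) = (\<lambda>i\<in>I. f x i)"
        by (intro restrict_ext) (subst e, assumption, linarith)
      also note ext[OF fsp[OF x]]
      finally have h: "(\<lambda>i\<in>I. y i + f (\<lambda>i\<in>I. - x0 i + 1 * x i) i) = f x" .
      show "indicator A (f (\<lambda>i\<in>I. - x0 i + 1 * x i)) * b (\<lambda>i\<in>I. y i + f (\<lambda>i\<in>I. - x0 i + 1 * x i) i)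
          = indicator A (\<lambda>i\<in>I. f x i - y i) * b x"
        by (subst h, subst *, subst bf[OF x], rule refl)
    qed
    finally show "(\<integral>\<^sup>+x. indicator A (f x) * b (\<lambda>i\<in>I. y i + f x i) \<partial>leb I) = \<dots>" .
  qed
  also have "\<dots> = (\<integral>\<^sup>+x. (\<integral>\<^sup>+y. indicator A (\<lambda>i\<in>I. f x i - y i) * b x \<partial>leb I) \<partial>leb I)"
    by (rule LL.Fubini') (simp add: split_beta)
  \<comment> \<open>For fixed \<open>x\<close> the reflection \<open>y\<close> to
    \<open>f x - y\<close> removes \<open>x\<close> from the indicator; the two integrals now
    factor.\<close>
  also have "\<dots> = (\<integral>\<^sup>+x. emeasure (leb I) A * b x \<partial>leb I)"
  proof (rule nn_integral_cong)
    fix x assume x: "x \<in> space (leb I)"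
    have [measurable]: "(\<lambda>y. \<lambda>i\<in>I. f x i - y i) \<in> measurable (leb I) (leb I)"
      by (intro measurable_restrict) measurable
    have "(\<integral>\<^sup>+y. indicator A (\<lambda>i\<in>I. f x i - y i) * b x \<partial>leb I)
      = (\<integral>\<^sup>+y. indicator A (\<lambda>i\<in>I. f x i + (-1) * y i) \<partial>leb I) * b x"
      by (subst nn_integral_multc) auto
    also have "(\<integral>\<^sup>+y. indicator A (\<lambda>i\<in>I. f x i + (-1) * y i) \<partial>leb I) = (\<integral>\<^sup>+y. indicator A y \<partial>leb I)"
      by (rule nn_integral_leb_isometry) (auto simp: I)
    also have "(\<integral>\<^sup>+y. indicator A y \<partial>leb I) = emeasure (leb I) A"
      by (rule nn_integral_indicator) fact
    finally show "(\<integral>\<^sup>+y. indicator A (\<lambda>i\<in>I. f x i - y i) * b x \<partial>leb I) = emeasure (leb I) A * b x" .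
  qed
  also have "\<dots> = emeasure (leb I) A" by (simp add: nn_integral_cmult b1)
  finally show "emeasure (distr (leb I) (leb I) f) A = emeasure (leb I) A" .
qed simp

text \<open>Base measure and density are both invariant. Coordinatewise differences and surjectivity
  encode a linear bijection. The deviations \<open>\<sigma>\<close> may vary with the index, as they
  do between diagonal and off-diagonal entries of the GOE.\<close>

theorem gauss_distr_quadratic_invariant:
  fixes f :: "('i \<Rightarrow> real) \<Rightarrow> 'i \<Rightarrow> real"
  assumes I: "finite I" and \<sigma>: "\<And>i. i \<in> I \<Longrightarrow> \<sigma> i > 0"
    and f [measurable]: "f \<in> measurable (leb I) (leb I)"
    and diff: "\<And>x y i. x \<in> space (leb I) \<Longrightarrow> y \<in> space (leb I) \<Longrightarrow> i \<in> I \<Longrightarrow>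
                  f (\<lambda>i\<in>I. x i - y i) i = f x i - f y i"
    and surj: "\<And>y. y \<in> space (leb I) \<Longrightarrow> \<exists>x\<in>space (leb I). f x = y"
    and Q: "\<And>x. x \<in> space (leb I) \<Longrightarrow>
               (\<Sum>i\<in>I. (f x i)\<^sup>2 / (\<sigma> i)\<^sup>2) = (\<Sum>i\<in>I. (x i)\<^sup>2 / (\<sigma> i)\<^sup>2)"
  shows "distr (gauss I \<sigma>) (gauss I \<sigma>) f = gauss I \<sigma>"
proof -
  define b where "b = (\<lambda>x. \<Prod>i\<in>I. ennreal (normal_density 0 (\<sigma> i) (x i)))"
  have [measurable]: "b \<in> borel_measurable (leb I)" unfolding b_def using I by measurable
  have g: "gauss I \<sigma> = density (leb I) b" using gauss_eq_density[of I \<sigma>] I \<sigma> by (simp add: b_def)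
  have bf: "b (f x) = b x" if "x \<in> space (leb I)" for x
    unfolding b_def prod_normal_density[OF I] Q[OF that] ..
  have inv: "distr (leb I) (leb I) f = leb I"
    by (rule leb_distr_quadratic_invariant[where \<sigma>=\<sigma>]) fact+
  have "gauss I \<sigma> = density (distr (leb I) (leb I) f) b"
    unfolding inv g ..
  also have "\<dots> = distr (density (leb I) (\<lambda>x. b (f x))) (leb I) f"
    by (intro density_distr) measurable
  also have "density (leb I) (\<lambda>x. b (f x)) = density (leb I) b"
    by (rule density_cong) (auto simp: bf)
  also have "distr (density (leb I) b) (leb I) f = distr (gauss I \<sigma>) (gauss I \<sigma>) f"
    unfolding g by (rule distr_cong) auto
  finally show ?thesis by (rule sym)
qed

lemma measurable_leb_component: "i \<in> I \<Longrightarrow> (\<lambda>w. w i) \<in> borel_measurable (leb I)"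
  using measurable_component_singleton[of i I "\<lambda>_. lborel :: real measure"] by (simp add: measurable_lborel1)

definition sgauss :: "'i set \<Rightarrow> ('i \<Rightarrow> real) measure" where
  "sgauss I = gauss I (\<lambda>_. 1)"

lemma sets_sgauss [measurable_cong, simp]: "sets (sgauss I) = sets (leb I)"
  by (simp add: sgauss_def)

lemma space_sgauss: "space (sgauss I) = (\<Pi>\<^sub>E i\<in>I. UNIV)"
  by (simp add: sgauss_def)

lemma prob_space_sgauss: "prob_space (sgauss I)"
  unfolding sgauss_def by (rule prob_space_gauss) simp

lemma measurable_sgauss_iff: "f \<in> measurable (sgauss I) B \<longleftrightarrow> f \<in> measurable (leb I) B"
  by (simp cong: measurable_cong_sets)

section \<open>Orthonormal systems and simplicity of the spectrum\<close>

text \<open>Vectors are plain functions of which only the values below \<open>N\<close> count. This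
  avoids carrier conditions, at the price of identities that hold for \<open>p < N\<close>
  only.\<close>

definition ip :: "nat \<Rightarrow> (nat \<Rightarrow> real) \<Rightarrow> (nat \<Rightarrow> real) \<Rightarrow> real" where
  "ip N x y = (\<Sum>p<N. x p * y p)"

definition orthosys :: "nat \<Rightarrow> 'i set \<Rightarrow> ('i \<Rightarrow> nat \<Rightarrow> real) \<Rightarrow> bool" where
  "orthosys N I v \<longleftrightarrow> (\<forall>i\<in>I. \<forall>j\<in>I. ip N (v i) (v j) = (if i = j then 1 else 0))"

definition eigvec :: "nat \<Rightarrow> (nat \<Rightarrow> nat \<Rightarrow> real) \<Rightarrow> real \<Rightarrow> (nat \<Rightarrow> real) \<Rightarrow> bool" where
  "eigvec N h \<mu> u \<longleftrightarrow> (\<forall>p<N. (\<Sum>q<N. h p q * u q) = \<mu> * u p)"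

lemma orthosysD: "orthosys N I v \<Longrightarrow> i \<in> I \<Longrightarrow> j \<in> I \<Longrightarrow> ip N (v i) (v j) = (if i = j then 1 else 0)"
  by (simp add: orthosys_def)

lemma ip_commute: "ip N x y = ip N y x"
  by (simp add: ip_def mult.commute)

lemma ip_diff_left: "ip N (\<lambda>p. x p - y p) z = ip N x z - ip N y z"
  by (simp add: ip_def algebra_simps sum_subtractf)

lemma ip_scale_left: "ip N (\<lambda>p. c * x p) z = c * ip N x z"
  by (simp add: ip_def sum_distrib_left mult_ac)

lemma ip_scale_right: "ip N x (\<lambda>p. c * z p) = c * ip N x z"
  by (simp add: ip_def sum_distrib_left mult_ac)

lemma ip_sum_left: "ip N (\<lambda>p. \<Sum>i\<in>I. x i p) z = (\<Sum>i\<in>I. ip N (x i) z)"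
  unfolding ip_def by (simp add: sum_distrib_right sum.swap[of _ I])

lemma ip_sum_right: "ip N z (\<lambda>p. \<Sum>i\<in>I. x i p) = (\<Sum>i\<in>I. ip N z (x i))"
  using ip_sum_left[of N x I z] by (simp add: ip_commute)

lemma ip_cong: "(\<And>p. p < N \<Longrightarrow> x p = x' p) \<Longrightarrow> (\<And>p. p < N \<Longrightarrow> y p = y' p) \<Longrightarrow> ip N x y = ip N x' y'"
  by (simp add: ip_def)

lemma ip_self_eq_0D: "ip N x x = 0 \<Longrightarrow> p < N \<Longrightarrow> x p = 0"
  by (simp add: ip_def sum_nonneg_eq_0_iff)

text \<open>A one-sided inverse of a square matrix is two-sided, so orthonormality of the rows
  passes to the columns.\<close>

lemma orthosys_transpose:
  assumes "orthosys N {..<N} v" "p < N" "q < N"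
  shows "(\<Sum>i<N. v i p * v i q) = (if p = q then 1 else 0)"
proof -
  define M where "M = mat N N (\<lambda>(i,p). v i p)"
  have M: "M \<in> carrier_mat N N" "M\<^sup>T \<in> carrier_mat N N" by (auto simp: M_def)
  have "M * M\<^sup>T = 1\<^sub>m N"
    using assms(1) by (intro eq_matI)
      (auto simp: M_def scalar_prod_def orthosys_def ip_def atLeast0LessThan)
  then have "M\<^sup>T * M = 1\<^sub>m N" by (rule mat_mult_left_right_inverse[OF M])
  then have "(M\<^sup>T * M) $$ (p, q) = (if p = q then 1 else 0)" using assms by simp
  moreover have "(M\<^sup>T * M) $$ (p, q) = (\<Sum>i<N. v i p * v i q)"
    using assms by (simp add: M_def scalar_prod_def atLeast0LessThan)
  ultimately show ?thesis by simp
qed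

lemma orthobasis_expansion:
  assumes "orthosys N {..<N} v" "p < N"
  shows "(\<Sum>i<N. ip N (v i) x * v i p) = x p"
proof -
  have "(\<Sum>i<N. ip N (v i) x * v i p) = (\<Sum>q<N. x q * (\<Sum>i<N. v i q * v i p))"
    unfolding ip_def sum_distrib_right sum_distrib_left by (subst sum.swap) (simp add: mult_ac)
  also have "\<dots> = (\<Sum>q<N. x q * (if q = p then 1 else 0))"
    using assms by (intro sum.cong refl) (simp add: orthosys_transpose)
  also have "\<dots> = x p" using assms by (simp add: if_distrib cong: if_cong)
  finally show ?thesis .
qed

lemma parseval:
  assumes "orthosys N {..<N} v"
  shows "(\<Sum>i<N. ip N (v i) x * ip N (v i) y) = ip N x y"
proof -
  have "ip N x y = ip N (\<lambda>p. \<Sum>i<N. ip N (v i) x * v i p) y"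
    by (rule ip_cong) (simp_all add: orthobasis_expansion[OF assms])
  then show ?thesis by (simp add: ip_sum_left ip_scale_left)
qed

section \<open>Krylov vectors as a polynomial test for simple spectrum\<close>

primrec krylov :: "nat \<Rightarrow> (nat \<Rightarrow> nat \<Rightarrow> 'a::comm_ring_1) \<Rightarrow> nat \<Rightarrow> nat \<Rightarrow> 'a" where
  "krylov N h 0 p = 1"
| "krylov N h (Suc j) p = (\<Sum>q<N. h p q * krylov N h j q)"

text \<open>Row \<open>j\<close> is the \<open>j\<close>-th power of the matrix applied to the
  all-ones vector. A nonzero determinant says that this vector is cyclic, which for a symmetric
  matrix forces one-dimensional eigenspaces. As a polynomial in the entries, it reduces simplicity
  of the spectrum to the zero set of a polynomial.\<close>

definition krylov_det :: "nat \<Rightarrow> (nat \<Rightarrow> nat \<Rightarrow> 'a::comm_ring_1) \<Rightarrow> 'a" where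
  "krylov_det N h = det (mat N N (\<lambda>(j,p). krylov N h j p))"

lemma krylov_det_cong:
  assumes "\<And>p q. p < N \<Longrightarrow> q < N \<Longrightarrow> h p q = h' p q"
  shows "krylov_det N h = krylov_det N h'"
proof -
  have "krylov N h j p = krylov N h' j p" if "p < N" for j p
    using that by (induction j arbitrary: p) (simp_all add: assms)
  then show ?thesis unfolding krylov_det_def by (intro arg_cong[of _ _ det] cong_mat) auto
qed

lemma krylov_det_0_iff:
  fixes h :: "nat \<Rightarrow> nat \<Rightarrow> real"
  shows "krylov_det N h = 0 \<longleftrightarrow> (\<exists>w. (\<exists>p<N. w p \<noteq> 0) \<and> (\<forall>j<N. (\<Sum>p<N. krylov N h j p * w p) = 0))"
proof -
  have c: "mat N N (\<lambda>(j,p). krylov N h j p) \<in> carrier_mat N N" by simp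
  show ?thesis unfolding krylov_det_def det_0_iff_vec_prod_zero[OF c]
  proof safe
    fix v :: "real vec" assume v: "v \<in> carrier_vec N" "v \<noteq> 0\<^sub>v N"
      and 0: "mat N N (\<lambda>(j, p). krylov N h j p) *\<^sub>v v = 0\<^sub>v N"
    have "\<exists>p<N. vec_index v p \<noteq> 0" using v by (metis carrier_vecD eq_vecI index_zero_vec)
    moreover have "(\<Sum>p<N. krylov N h j p * vec_index v p) = 0" if "j < N" for j
      using arg_cong[OF 0, of "\<lambda>u. vec_index u j"] that v
      by (simp add: scalar_prod_def atLeast0LessThan)
    ultimately show "\<exists>w. (\<exists>p<N. w p \<noteq> 0) \<and> (\<forall>j<N. (\<Sum>p<N. krylov N h j p * w p) = 0)" by blast
  next
    fix w p assume w: "p < N" "w p \<noteq> 0" "\<forall>j<N. (\<Sum>p<N. krylov N h j p * w p) = 0"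
    have "vec N w \<noteq> 0\<^sub>v N" using w by (metis index_vec index_zero_vec(1))
    moreover have "mat N N (\<lambda>(j, p). krylov N h j p) *\<^sub>v vec N w = 0\<^sub>v N"
      using w by (intro eq_vecI) (auto simp: scalar_prod_def atLeast0LessThan)
    ultimately show "\<exists>v. v \<in> carrier_vec N \<and> v \<noteq> 0\<^sub>v N \<and> mat N N (\<lambda>(j, p). krylov N h j p) *\<^sub>v v = 0\<^sub>v N"
      by (intro exI[of _ "vec N w"]) auto
  qed
qed

text \<open>By symmetry each application of \<open>h\<close> moves from the Krylov vector onto
  \<open>u\<close>, where it becomes a factor \<open>\<mu>\<close>.\<close>

lemma eigvec_krylov:
  assumes "eigvec N h \<mu> u" "\<And>p q. h p q = h q p"
  shows "(\<Sum>p<N. krylov N h j p * u p) = \<mu> ^ j * (\<Sum>p<N. u p)"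
proof (induction j)
  case (Suc j)
  have "(\<Sum>p<N. krylov N h (Suc j) p * u p) = (\<Sum>p<N. \<Sum>q<N. krylov N h j q * (h q p * u p))"
    using assms(2) by (simp add: sum_distrib_right sum_distrib_left mult_ac)
  also have "\<dots> = (\<Sum>q<N. krylov N h j q * (\<Sum>p<N. h q p * u p))"
    by (subst sum.swap) (simp add: sum_distrib_left)
  also have "\<dots> = \<mu> * (\<Sum>q<N. krylov N h j q * u q)"
    using assms(1) by (simp add: eigvec_def sum_distrib_left mult_ac)
  finally show ?case using Suc by simp
qed simp

text \<open>An eigenvector orthogonal to the all-ones vector is orthogonal to every Krylov vector,
  hence lies in the kernel of an invertible matrix.\<close>

lemma eigvec_sum_zero:
  assumes "eigvec N h \<mu> u" "\<And>p q. h p q = h q p" "krylov_det N h \<noteq> 0" "(\<Sum>p<N. u p) = 0" "p < N"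
  shows "u p = 0"
  using eigvec_krylov[OF assms(1,2)] assms(3-5) krylov_det_0_iff[of N h] by auto

text \<open>With coordinate sums \<open>a\<close> of \<open>u\<close> and \<open>b\<close> of
  \<open>v\<close>, the combination \<open>b u - a v\<close> is annihilated or an eigenvector with
  coordinate sum zero, so it vanishes; normalisation leaves only a sign.\<close>

lemma eigvec_unique:
  assumes u: "eigvec N h \<mu> u" and v: "eigvec N h \<mu> v" and sym: "\<And>p q. h p q = h q p"
    and K: "krylov_det N h \<noteq> 0" and 1: "ip N u u = 1" "ip N v v = 1"
  shows "\<exists>s. s\<^sup>2 = 1 \<and> (\<forall>p<N. v p = s * u p)"
proof -
  define a b where "a = (\<Sum>p<N. u p)" and "b = (\<Sum>p<N. v p)"
  have "eigvec N h \<mu> (\<lambda>p. b * u p - a * v p)"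
    unfolding eigvec_def
  proof (intro allI impI)
    fix p assume "p < N"
    have "(\<Sum>q<N. h p q * (b * u q - a * v q)) = b * (\<Sum>q<N. h p q * u q) - a * (\<Sum>q<N. h p q * v q)"
      by (simp add: sum_distrib_left algebra_simps sum_subtractf)
    then show "(\<Sum>q<N. h p q * (b * u q - a * v q)) = \<mu> * (b * u p - a * v p)"
      using u v \<open>p < N\<close> by (simp add: eigvec_def algebra_simps)
  qed
  moreover have "(\<Sum>p<N. b * u p - a * v p) = 0"
    by (simp add: sum_subtractf sum_distrib_left[symmetric] a_def b_def)
  ultimately have eq: "b * u p = a * v p" if "p < N" for p
    using eigvec_sum_zero[of N h \<mu> "\<lambda>p. b * u p - a * v p" p] sym K that by simp
  have "a \<noteq> 0"
  proof
    assume "a = 0"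
    then have "\<forall>p<N. u p = 0" using eigvec_sum_zero[OF u sym K] by (simp add: a_def)
    then show False using 1 by (simp add: ip_def)
  qed
  then have vs: "v p = (b / a) * u p" if "p < N" for p using eq[OF that] by (simp add: field_simps)
  have "ip N v v = ip N (\<lambda>p. (b/a) * u p) (\<lambda>p. (b/a) * u p)" by (rule ip_cong) (auto simp: vs)
  also have "\<dots> = (b / a)\<^sup>2 * ip N u u"
    by (simp only: ip_scale_left ip_scale_right power2_eq_square mult.assoc)
  finally have "(b / a)\<^sup>2 = 1" using 1 by simp
  then show ?thesis using vs by blast
qed

lemma eigvec_orthogonal:
  assumes u: "eigvec N h \<mu> u" and v: "eigvec N h \<nu> v" and sym: "\<And>p q. h p q = h q p"
    and "ip N u v \<noteq> 0"
  shows "\<mu> = \<nu>"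
proof -
  have "\<mu> * ip N u v = (\<Sum>p<N. \<Sum>q<N. h p q * u q * v p)"
  proof -
    have "\<mu> * ip N u v = (\<Sum>p<N. (\<Sum>q<N. h p q * u q) * v p)"
      using u by (simp add: eigvec_def ip_def sum_distrib_left mult_ac)
    then show ?thesis by (simp only: sum_distrib_right)
  qed
  also have "\<dots> = (\<Sum>q<N. \<Sum>p<N. u q * (h q p * v p))"
    by (subst sum.swap) (simp add: sym mult_ac)
  also have "\<dots> = \<nu> * ip N u v"
  proof -
    have "\<nu> * ip N u v = (\<Sum>q<N. u q * (\<Sum>p<N. h q p * v p))"
      using v by (simp add: eigvec_def ip_def sum_distrib_left mult_ac)
    then show ?thesis by (simp only: sum_distrib_left)
  qed
  finally show ?thesis using assms by simp
qed

text \<open>By Parseval \<open>x i\<close> is not orthogonal to every \<open>y j\<close>. Two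
  non-orthogonal eigenvectors share their eigenvalue, and that eigenvalue is simple.\<close>

lemma eigenbasis_unique:
  assumes x: "orthosys N {..<N} x" "\<And>i. i < N \<Longrightarrow> \<exists>\<mu>. eigvec N h \<mu> (x i)"
    and y: "orthosys N {..<N} y" "\<And>i. i < N \<Longrightarrow> \<exists>\<mu>. eigvec N h \<mu> (y i)"
    and sym: "\<And>p q. h p q = h q p" and K: "krylov_det N h \<noteq> 0" and "i < N"
  shows "\<exists>j<N. \<exists>s. s\<^sup>2 = 1 \<and> (\<forall>p<N. x i p = s * y j p)"
proof -
  have "\<exists>j<N. ip N (y j) (x i) \<noteq> 0"
  proof (rule ccontr)
    assume "\<not> ?thesis"
    then have "ip N (x i) (x i) = 0"
      using parseval[OF y(1), of "x i" "x i"] by auto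
    then show False using orthosysD[OF x(1), of i i] \<open>i < N\<close> by simp
  qed
  then obtain j where j: "j < N" "ip N (y j) (x i) \<noteq> 0" by auto
  obtain \<mu> \<nu> where e: "eigvec N h \<mu> (x i)" "eigvec N h \<nu> (y j)" using x(2) y(2) j \<open>i < N\<close> by blast
  have "\<nu> = \<mu>" using eigvec_orthogonal[OF e(2,1) sym j(2)] .
  then show ?thesis
    using eigvec_unique[of N h \<mu> "y j" "x i"] e sym K orthosysD[OF x(1), of i i] orthosysD[OF y(1), of j j] \<open>i < N\<close> j
    by auto
qed

text \<open>
  Krylov vectors of \<open>D + s H\<close> at \<open>s = 0\<close> form a Vandermonde matrix, so \<open>krylov_det N (D + s H)\<close> is
  a nonzero polynomial in \<open>s\<close>; passing to \<open>t = 1 / s\<close> gives the statement for \<open>H + t D\<close>.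
\<close>

lemma krylov_det_diag_nonzero:
  "krylov_det N (\<lambda>p q. if p = q then real p else 0) \<noteq> 0"
proof
  let ?D = "\<lambda>p q::nat. if p = q then real p else 0"
  assume "krylov_det N ?D = 0"
  then obtain w where w: "\<exists>p<N. w p \<noteq> 0" and 0: "\<And>j. j < N \<Longrightarrow> (\<Sum>p<N. krylov N ?D j p * w p) = 0"
    unfolding krylov_det_0_iff by blast
  have k: "krylov N ?D j p = real p ^ j" if "p < N" for j p
    using that
  proof (induction j)
    case (Suc j)
    have "krylov N ?D (Suc j) p = (\<Sum>q<N. if q = p then real p * krylov N ?D j q else 0)"
      unfolding krylov.simps by (intro sum.cong) auto
    then show ?case using Suc by simp
  qed simp
  have *: "(\<Sum>p<N. poly q (real p) * w p) = 0" if "degree q < N" for q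
  proof -
    have "(\<Sum>p<N. poly q (real p) * w p) = (\<Sum>p<N. \<Sum>j\<le>degree q. coeff q j * (real p ^ j * w p))"
      by (simp add: poly_altdef sum_distrib_right sum_distrib_left mult_ac)
    also have "\<dots> = (\<Sum>j\<le>degree q. coeff q j * (\<Sum>p<N. real p ^ j * w p))"
      by (subst sum.swap) (simp add: sum_distrib_left)
    also have "\<dots> = 0"
    proof (intro sum.neutral ballI)
      fix j assume "j \<in> {..degree q}"
      then have "j < N" using that by auto
      then have "(\<Sum>p<N. real p ^ j * w p) = 0" using 0[of j] by (simp add: k)
      then show "coeff q j * (\<Sum>p<N. real p ^ j * w p) = 0" by simp
    qed
    finally show ?thesis .
  qed
  from w obtain r where r: "r < N" "w r \<noteq> 0" by auto
  \<comment> \<open>Unnormalised Lagrange polynomial: it vanishes at every node except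
    \<open>r\<close>, so its zero pairing with \<open>w\<close> forces
    \<open>w r = 0\<close>.\<close>
  define q where "q = (\<Prod>i\<in>{..<N} - {r}. [:- real i, 1:])"
  have "degree q \<le> (\<Sum>i\<in>{..<N} - {r}. degree [:- real i, 1:])"
    unfolding q_def using degree_prod_sum_le[of "{..<N} - {r}" "\<lambda>i. [:- real i, 1:]"] by (simp add: comp_def)
  also have "\<dots> < N" using r by simp
  finally have "(\<Sum>p<N. poly q (real p) * w p) = 0" by (rule *)
  moreover have "(\<Sum>p<N. poly q (real p) * w p) = poly q (real r) * w r"
  proof (subst sum.remove[of _ r])
    show "poly q (real r) * w r + (\<Sum>p\<in>{..<N} - {r}. poly q (real p) * w p) = poly q (real r) * w r"
      by (auto simp: q_def poly_prod intro!: sum.neutral)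
  qed (use r in auto)
  moreover have "poly q (real r) \<noteq> 0" by (auto simp: q_def poly_prod)
  ultimately show False using r by simp
qed

lemma finite_krylov_det_zeros:
  fixes h :: "nat \<Rightarrow> nat \<Rightarrow> real"
  shows "finite {t. krylov_det N (\<lambda>p q. h p q + t * (if p = q then real p else 0)) = 0}"
proof -
  define D where "D = (\<lambda>p q::nat. if p = q then real p else 0)"
  \<comment> \<open>The entries are linear polynomials with value \<open>D p q + s * h p q\<close>
    at \<open>s\<close>; \<open>krylov\<close> is defined over any commutative ring so that it can
    be evaluated on them.\<close>
  define P where "P = krylov_det N (\<lambda>p q. [:D p q, h p q:])"
  have kP: "poly (krylov N (\<lambda>p q. [:D p q, h p q:]) j p) s = krylov N (\<lambda>p q. D p q + s * h p q) j p" for j p s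
    by (induction j arbitrary: p) (simp_all add: poly_sum algebra_simps)
  have P: "poly P s = krylov_det N (\<lambda>p q. D p q + s * h p q)" for s
    unfolding P_def krylov_det_def by (rule poly_det_cong[of _ N]) (auto simp: kP)
  have "poly P 0 \<noteq> 0" unfolding P using krylov_det_diag_nonzero[of N] by (simp add: D_def)
  then have "P \<noteq> 0" by auto
  \<comment> \<open>Row \<open>j\<close> is homogeneous of degree \<open>j\<close> in the matrix, so
    for \<open>t \<noteq> 0\<close> the kernel equations of \<open>H + t D\<close> and of
    \<open>D + H / t\<close> agree row by row.\<close>
  have scale: "krylov N (\<lambda>p q. h p q + t * D p q) j p = t ^ j * krylov N (\<lambda>p q. D p q + (1/t) * h p q) j p"
    if "t \<noteq> 0" for t j p
  proof (induction j arbitrary: p)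
    case (Suc j)
    let ?k = "krylov N (\<lambda>p q. D p q + (1/t) * h p q) j"
    have "(h p q + t * D p q) * (t ^ j * ?k q) = t ^ Suc j * ((D p q + (1/t) * h p q) * ?k q)" for q
    proof -
      have "h p q + t * D p q = t * (D p q + (1/t) * h p q)" using that by (simp add: algebra_simps)
      then show ?thesis by simp
    qed
    then show ?case by (simp only: krylov.simps Suc.IH sum_distrib_left)
  qed simp
  \<comment> \<open>The substitution \<open>s = 1 / t\<close> says nothing about
    \<open>t = 0\<close>, which is added to the finite exceptional set outright.\<close>
  have "{t. krylov_det N (\<lambda>p q. h p q + t * D p q) = 0} \<subseteq> insert 0 ((\<lambda>s. 1 / s) ` {s. poly P s = 0})"
  proof safe
    fix t assume t: "krylov_det N (\<lambda>p q. h p q + t * D p q) = 0" "t \<notin> (\<lambda>s. 1 / s) ` {s. poly P s = 0}"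
    show "t = 0"
    proof (rule ccontr)
      assume "t \<noteq> 0"
      obtain w where w: "\<exists>p<N. w p \<noteq> 0" and
        0: "\<And>j. j < N \<Longrightarrow> (\<Sum>p<N. krylov N (\<lambda>p q. h p q + t * D p q) j p * w p) = 0"
        using t(1) unfolding krylov_det_0_iff by blast
      have "(\<Sum>p<N. krylov N (\<lambda>p q. D p q + (1/t) * h p q) j p * w p) = 0" if "j < N" for j
      proof -
        have "t ^ j * (\<Sum>p<N. krylov N (\<lambda>p q. D p q + (1/t) * h p q) j p * w p) = 0"
          using 0[OF that] unfolding scale[OF \<open>t \<noteq> 0\<close>] by (simp only: sum_distrib_left mult.assoc)
        then show ?thesis using \<open>t \<noteq> 0\<close> by simp
      qed
      then have "poly P (1/t) = 0" unfolding P krylov_det_0_iff using w by blast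
      then have "1 / (1 / t) \<in> (\<lambda>s. 1 / s) ` {s. poly P s = 0}" by blast
      then show False using t(2) by simp
    qed
  qed
  moreover have "finite (insert 0 ((\<lambda>s. 1 / s) ` {s. poly P s = 0}))"
    using poly_roots_finite[OF \<open>P \<noteq> 0\<close>] by simp
  ultimately show ?thesis unfolding D_def by (rule finite_subset)
qed

section \<open>Orthogonal invariance of the ensemble\<close>

definition symm :: "(nat \<times> nat \<Rightarrow> real) \<Rightarrow> nat \<Rightarrow> nat \<Rightarrow> real" where
  "symm g p q = g (min p q, max p q)"

definition goe_sd :: "nat \<Rightarrow> nat \<times> nat \<Rightarrow> real" where
  "goe_sd N = (\<lambda>(i,j). sqrt ((1 + (if i = j then 1 else 0)) / real N))"

lemma symm_commute: "symm g p q = symm g q p"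
  by (simp add: symm_def min.commute max.commute)

lemma finite_goe_index [simp]: "finite (goe_index N)"
  by (rule finite_subset[of _ "{..<N} \<times> {..<N}"]) (auto simp: goe_index_def)

lemma minmax_goe_index [simp]: "p < N \<Longrightarrow> q < N \<Longrightarrow> (min p q, max p q) \<in> goe_index N"
  by (auto simp: goe_index_def min_def max_def)

lemma goe_sd_pos: "x \<in> goe_index N \<Longrightarrow> goe_sd N x > 0"
  by (auto simp: goe_index_def goe_sd_def)

lemma GOE_eq_gauss: "GOE N = gauss (goe_index N) (goe_sd N)"
  unfolding GOE_def gauss_def goe_sd_def by (intro PiM_cong) (auto split: prod.splits)

lemma sets_GOE [measurable_cong, simp]: "sets (GOE N) = sets (leb (goe_index N))"
  by (simp add: GOE_eq_gauss)

lemma space_GOE: "space (GOE N) = (\<Pi>\<^sub>E i\<in>goe_index N. UNIV)"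
  by (simp add: GOE_eq_gauss)

lemma prob_space_GOE: "prob_space (GOE N)"
  unfolding GOE_eq_gauss by (intro prob_space_gauss goe_sd_pos)

lemma measurable_symm [measurable (raw)]:
  "p < N \<Longrightarrow> q < N \<Longrightarrow> (\<lambda>g. symm g p q) \<in> borel_measurable (leb (goe_index N))"
  unfolding symm_def
  using measurable_component_singleton[of "(min p q, max p q)" "goe_index N" "\<lambda>_. lborel :: real measure"]
  by (simp add: measurable_lborel1)

lemma measurable_krylov_det: "(\<lambda>g. krylov_det N (symm g)) \<in> borel_measurable (leb (goe_index N))"
proof -
  have k: "(\<lambda>g. krylov N (symm g) j p) \<in> borel_measurable (leb (goe_index N))" if "p < N" for j p
    using that
  proof (induction j arbitrary: p)
    case (Suc j)
    show ?case unfolding krylov.simps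
      by (intro borel_measurable_sum borel_measurable_times measurable_symm Suc) (use Suc in auto)
  qed simp
  have perm: "\<pi> i < N" if "\<pi> permutes {0..<N}" "i < N" for \<pi> :: "nat \<Rightarrow> nat" and i
    using permutes_in_image[OF that(1), of i] that(2) by simp
  have *: "krylov_det N (symm g) = (\<Sum>p \<in> {p. p permutes {0..<N}}. signof p * (\<Prod>i = 0..<N. krylov N (symm g) i (p i)))" for g
    unfolding krylov_det_def
    by (subst det_def'[of _ N]) (auto intro!: sum.cong prod.cong simp: perm)
  show ?thesis unfolding *
    by (intro borel_measurable_sum borel_measurable_times borel_measurable_prod borel_measurable_const k)
      (auto simp: perm)
qed

text \<open>Let \<open>D\<close> be the diagonal matrix with entries \<open>0, ..., N - 1\<close>.
  On every line \<open>g + t D\<close> the determinant has finitely many zeros. Translating the zero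
  set along \<open>D\<close> keeps its Lebesgue measure, so averaging over \<open>t\<close> in
  \<open>{0..1}\<close> and exchanging integrals shows that it is null; the GOE has a
  density.\<close>

lemma AE_krylov_det_nonzero: "AE g in GOE N. krylov_det N (symm g) \<noteq> 0"
proof -
  let ?I = "goe_index N" and ?d = "\<lambda>(i::nat,j::nat). if i = j then real i else 0"
  define B where "B = {g \<in> space (leb ?I). krylov_det N (symm g) = 0}"
  have B [measurable]: "B \<in> sets (leb ?I)"
    unfolding B_def using measurable_krylov_det[of N] by measurable
  interpret product_sigma_finite "\<lambda>_. lborel :: real measure" by standard
  interpret L: sigma_finite_measure "leb ?I" by (intro sigma_finite finite_goe_index)
  interpret LL: pair_sigma_finite "leb ?I" "lborel :: real measure" by standard
  have pm: "(\<lambda>x. x i) \<in> borel_measurable (leb ?I)" if "i \<in> ?I" for i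
    using measurable_component_singleton[OF that, of "\<lambda>_. lborel"] by (simp add: measurable_lborel2)
  have m: "(\<lambda>z. \<lambda>i\<in>?I. snd z * ?d i + 1 * fst z i) \<in> measurable (leb ?I \<Otimes>\<^sub>M lborel) (leb ?I)"
    by (intro measurable_restrict, subst measurable_lborel1,
        intro borel_measurable_add borel_measurable_times measurable_compose[OF measurable_fst pm]) auto
  have mm: "(\<lambda>z. indicator B (\<lambda>i\<in>?I. snd z * ?d i + 1 * fst z i) * indicator {0..1} (snd z) :: ennreal)
      \<in> borel_measurable (leb ?I \<Otimes>\<^sub>M lborel)"
    by (intro borel_measurable_times_ennreal measurable_compose[OF m borel_measurable_indicator[OF B]]
        measurable_compose[OF measurable_snd]) auto
  have "emeasure (leb ?I) B = (\<integral>\<^sup>+t. emeasure (leb ?I) B * indicator {0..1::real} t \<partial>lborel)"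
    by (subst nn_integral_cmult_indicator) auto
  also have "\<dots> = (\<integral>\<^sup>+t. (\<integral>\<^sup>+g. indicator B (\<lambda>i\<in>?I. t * ?d i + 1 * g i) * indicator {0..1} t \<partial>leb ?I) \<partial>lborel)"
  proof (rule nn_integral_cong)
    fix t :: real
    have [measurable]: "(\<lambda>g. \<lambda>i\<in>?I. t * ?d i + 1 * g i) \<in> measurable (leb ?I) (leb ?I)"
      by (intro measurable_restrict) measurable
    have "(\<integral>\<^sup>+g. indicator B (\<lambda>i\<in>?I. t * ?d i + 1 * g i) * indicator {0..1} t \<partial>leb ?I)
      = (\<integral>\<^sup>+g. indicator B (\<lambda>i\<in>?I. t * ?d i + 1 * g i) \<partial>leb ?I) * indicator {0..1} t"
      by (rule nn_integral_multc) measurable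
    also have "(\<integral>\<^sup>+g. indicator B (\<lambda>i\<in>?I. t * ?d i + 1 * g i) \<partial>leb ?I) = (\<integral>\<^sup>+g. indicator B g \<partial>leb ?I)"
      by (rule nn_integral_leb_isometry) auto
    also have "\<dots> = emeasure (leb ?I) B" by (rule nn_integral_indicator) fact
    finally show "emeasure (leb ?I) B * indicator {0..1} t
       = (\<integral>\<^sup>+g. indicator B (\<lambda>i\<in>?I. t * ?d i + 1 * g i) * indicator {0..1} t \<partial>leb ?I)" by (rule sym)
  qed
  also have "\<dots> = (\<integral>\<^sup>+g. (\<integral>\<^sup>+t. indicator B (\<lambda>i\<in>?I. t * ?d i + 1 * g i) * indicator {0..1} t \<partial>lborel) \<partial>leb ?I)"
    using LL.Fubini'[of "\<lambda>g t. indicator B (\<lambda>i\<in>?I. t * ?d i + 1 * g i) * indicator {0..1} t"] mm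
    by (simp add: split_beta)
  also have "\<dots> = (\<integral>\<^sup>+g. 0 \<partial>leb ?I)"
  proof (rule nn_integral_cong)
    fix g :: "nat \<times> nat \<Rightarrow> real"
    define Z where "Z = {t. krylov_det N (\<lambda>p q. symm g p q + t * (if p = q then real p else 0)) = 0}"
    have "finite Z" unfolding Z_def by (rule finite_krylov_det_zeros)
    have "symm (\<lambda>i\<in>?I. t * ?d i + 1 * g i) p q = symm g p q + t * (if p = q then real p else 0)"
      if "p < N" "q < N" for p q t
      unfolding symm_def using that by (simp add: min_def max_def goe_index_def)
    then have "krylov_det N (symm (\<lambda>i\<in>?I. t * ?d i + 1 * g i))
        = krylov_det N (\<lambda>p q. symm g p q + t * (if p = q then real p else 0))" for t
      by (intro krylov_det_cong)
    then have "t \<in> Z" if "(\<lambda>i\<in>?I. t * ?d i + 1 * g i) \<in> B" for t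
      using that by (auto simp: B_def Z_def)
    then have "AE t in lborel. (indicator B (\<lambda>i\<in>?I. t * ?d i + 1 * g i) * indicator {0..1} t :: ennreal) = 0"
      using AE_not_in[OF finite_imp_null_set_lborel[OF \<open>finite Z\<close>]] by (auto simp: indicator_def)
    then show "(\<integral>\<^sup>+t. indicator B (\<lambda>i\<in>?I. t * ?d i + 1 * g i) * indicator {0..1} t \<partial>lborel) = 0"
      by (subst nn_integral_cong_AE[where v="\<lambda>_. 0"]) auto
  qed
  finally have "emeasure (leb ?I) B = 0" by simp
  then have "AE g in leb ?I. g \<notin> B" using B by (intro AE_not_in) (auto simp: null_sets_def)
  then have ae: "AE g in leb ?I. krylov_det N (symm g) \<noteq> 0"
    by (auto simp: B_def)
  have eq: "GOE N = density (leb ?I) (\<lambda>x. \<Prod>i\<in>?I. ennreal (normal_density 0 (goe_sd N i) (x i)))"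
    unfolding GOE_eq_gauss by (rule gauss_eq_density) (auto intro: goe_sd_pos)
  show ?thesis
    unfolding eq by (subst AE_density) (use ae in auto)
qed

text \<open>The upper triangle of \<open>Q H\<close> times the transpose of \<open>Q\<close>, where
  \<open>Q i\<close> is the \<open>i\<close>-th row. The restriction to \<open>goe_index N\<close>
  keeps it an element of the product space, whose functions are extensional.\<close>

definition conj_goe :: "nat \<Rightarrow> (nat \<Rightarrow> nat \<Rightarrow> real) \<Rightarrow> (nat \<times> nat \<Rightarrow> real) \<Rightarrow> nat \<times> nat \<Rightarrow> real" where
  "conj_goe N Q g = (\<lambda>(i,j)\<in>goe_index N. \<Sum>p<N. Q i p * (\<Sum>q<N. Q j q * symm g p q))"

lemma symm_conj_goe:
  assumes "i < N" "j < N"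
  shows "symm (conj_goe N Q g) i j = (\<Sum>p<N. Q i p * (\<Sum>q<N. Q j q * symm g p q))"
proof -
  have sw: "(\<Sum>p<N. Q i p * (\<Sum>q<N. Q j q * symm g p q)) = (\<Sum>p<N. Q j p * (\<Sum>q<N. Q i q * symm g p q))" for i j
    unfolding sum_distrib_left by (subst sum.swap) (simp add: symm_commute[of g] mult_ac)
  show ?thesis
  proof (cases "i \<le> j")
    case True
    then show ?thesis using assms unfolding symm_def[of "conj_goe N Q g"]
      by (simp add: conj_goe_def goe_index_def min_def max_def)
  next
    case False
    then have "symm (conj_goe N Q g) i j = (\<Sum>p<N. Q j p * (\<Sum>q<N. Q i q * symm g p q))"
      using assms unfolding symm_def[of "conj_goe N Q g"]
      by (simp add: conj_goe_def goe_index_def min_def max_def)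
    then show ?thesis using sw by simp
  qed
qed

lemma sum_goe_index:
  fixes f :: "nat \<Rightarrow> nat \<Rightarrow> real"
  assumes "\<And>p q. f p q = f q p"
  shows "(\<Sum>p<N. \<Sum>q<N. f p q) = (\<Sum>(p,q)\<in>goe_index N. (if p = q then 1 else 2) * f p q)"
proof -
  define L where "L = {(p,q). p < q \<and> q < N}"
  define D where "D = {(p,q). p = q \<and> q < N}"
  have fin: "finite L" "finite D"
    by (rule finite_subset[of _ "{..<N} \<times> {..<N}"]; auto simp: L_def D_def)+
  have LU: "(\<Sum>(p,q)\<in>prod.swap ` L. f p q) = (\<Sum>(p,q)\<in>L. f p q)"
    by (subst sum.reindex) (auto simp: split_beta assms intro!: sum.cong)
  have "(\<Sum>p<N. \<Sum>q<N. f p q) = (\<Sum>(p,q)\<in>{..<N} \<times> {..<N}. f p q)" by (simp add: sum.cartesian_product)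
  also have "{..<N} \<times> {..<N} = D \<union> (L \<union> prod.swap ` L)" by (force simp: L_def D_def image_iff)
  also have "(\<Sum>(p,q)\<in>\<dots>. f p q) = (\<Sum>(p,q)\<in>D. f p q) + ((\<Sum>(p,q)\<in>L. f p q) + (\<Sum>(p,q)\<in>prod.swap ` L. f p q))"
    using fin by (subst sum.union_disjoint, auto simp: L_def D_def)
      (subst sum.union_disjoint, auto simp: L_def D_def)
  also have "\<dots> = (\<Sum>(p,q)\<in>D. f p q) + (\<Sum>(p,q)\<in>L. 2 * f p q)"
    unfolding LU by (simp add: split_beta sum_distrib_left[symmetric])
  also have "\<dots> = (\<Sum>(p,q)\<in>D. (if p = q then 1 else 2) * f p q) + (\<Sum>(p,q)\<in>L. (if p = q then 1 else 2) * f p q)"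
    by (intro arg_cong2[where f="(+)"] sum.cong) (auto simp: L_def D_def)
  also have "\<dots> = (\<Sum>(p,q)\<in>D \<union> L. (if p = q then 1 else 2) * f p q)"
    using fin by (intro sum.union_disjoint[symmetric]) (auto simp: L_def D_def)
  also have "D \<union> L = goe_index N" by (auto simp: L_def D_def goe_index_def)
  finally show ?thesis .
qed

text \<open>The variances \<open>2 / N\<close> on the diagonal and \<open>1 / N\<close> off it are
  what makes the Gaussian exponent a multiple of the squared Frobenius norm: an off-diagonal entry
  occurs twice in the full matrix. Orthogonal invariance rests on this.\<close>

lemma goe_quadratic_form:
  "(\<Sum>i\<in>goe_index N. (g i)\<^sup>2 / (goe_sd N i)\<^sup>2) = real N / 2 * (\<Sum>p<N. \<Sum>q<N. (symm g p q)\<^sup>2)"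
proof -
  have "(\<Sum>p<N. \<Sum>q<N. (symm g p q)\<^sup>2) = (\<Sum>(p,q)\<in>goe_index N. (if p = q then 1 else 2) * (symm g p q)\<^sup>2)"
    by (rule sum_goe_index) (metis symm_commute)
  then have "real N / 2 * (\<Sum>p<N. \<Sum>q<N. (symm g p q)\<^sup>2)
     = (\<Sum>x\<in>goe_index N. real N / 2 * (case x of (p,q) \<Rightarrow> (if p = q then 1 else 2) * (symm g p q)\<^sup>2))"
    by (simp only: sum_distrib_left)
  also have "\<dots> = (\<Sum>x\<in>goe_index N. (g x)\<^sup>2 / (goe_sd N x)\<^sup>2)"
    by (intro sum.cong refl) (auto simp: goe_index_def goe_sd_def symm_def min_def max_def field_simps)
  finally show ?thesis by (rule sym)
qed

text \<open>Parseval is applied twice, once for each side on which \<open>Q\<close> acts.\<close>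

lemma frobenius_conj:
  assumes "orthosys N {..<N} Q"
  shows "(\<Sum>i<N. \<Sum>j<N. (\<Sum>p<N. Q i p * (\<Sum>q<N. Q j q * h p q))\<^sup>2) = (\<Sum>p<N. \<Sum>q<N. (h p q)\<^sup>2)"
proof -
  have "(\<Sum>i<N. \<Sum>j<N. (\<Sum>p<N. Q i p * (\<Sum>q<N. Q j q * h p q))\<^sup>2)
     = (\<Sum>j<N. \<Sum>i<N. ip N (Q i) (\<lambda>p. ip N (Q j) (h p)) * ip N (Q i) (\<lambda>p. ip N (Q j) (h p)))"
    by (subst sum.swap) (simp add: ip_def power2_eq_square)
  also have "\<dots> = (\<Sum>j<N. \<Sum>p<N. ip N (Q j) (h p) * ip N (Q j) (h p))"
    by (simp add: parseval[OF assms]) (simp add: ip_def)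
  also have "\<dots> = (\<Sum>p<N. \<Sum>j<N. ip N (Q j) (h p) * ip N (Q j) (h p))" by (rule sum.swap)
  also have "\<dots> = (\<Sum>p<N. ip N (h p) (h p))" by (simp add: parseval[OF assms])
  finally show ?thesis by (simp add: ip_def power2_eq_square)
qed

lemma orthosys_transpose_orthosys: "orthosys N {..<N} Q \<Longrightarrow> orthosys N {..<N} (\<lambda>i p. Q p i)"
  by (simp add: orthosys_def[of N "{..<N}" "\<lambda>i p. Q p i"] ip_def orthosys_transpose)

lemma orthosys_roundtrip:
  assumes "orthosys N {..<N} Q" "i < N"
  shows "(\<Sum>p<N. Q i p * (\<Sum>r<N. Q r p * x r)) = x i"
  using orthobasis_expansion[OF orthosys_transpose_orthosys[OF assms(1)] assms(2), of x]
  by (simp add: ip_def mult_ac)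

lemma measurable_conj_goe: "conj_goe N Q \<in> measurable (leb (goe_index N)) (leb (goe_index N))"
proof -
  have "(\<lambda>g. \<Sum>p<N. Q i p * (\<Sum>q<N. Q j q * symm g p q)) \<in> borel_measurable (leb (goe_index N))" for i j
    by (intro borel_measurable_sum borel_measurable_times borel_measurable_const measurable_symm) auto
  then show ?thesis unfolding conj_goe_def
    by (intro measurable_restrict) (auto simp: measurable_lborel1 split: prod.splits)
qed

lemma distr_conj_goe:
  assumes Q: "orthosys N {..<N} Q"
  shows "distr (GOE N) (GOE N) (conj_goe N Q) = GOE N"
  unfolding GOE_eq_gauss
proof (rule gauss_distr_quadratic_invariant)
  show "goe_sd N i > 0" if "i \<in> goe_index N" for i using that by (rule goe_sd_pos)
  show "conj_goe N Q \<in> measurable (leb (goe_index N)) (leb (goe_index N))" by (rule measurable_conj_goe)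
  show "conj_goe N Q (\<lambda>i\<in>goe_index N. x i - y i) i = conj_goe N Q x i - conj_goe N Q y i" if "i \<in> goe_index N" for x y i
  proof -
    have s: "symm (\<lambda>i\<in>goe_index N. x i - y i) p q = symm x p q - symm y p q" if "p < N" "q < N" for p q
      using that by (simp add: symm_def)
    show ?thesis using that by (auto simp: conj_goe_def s algebra_simps sum_subtractf split: prod.splits)
  qed
  \<comment> \<open>Conjugation by the transpose of \<open>Q\<close> provides the preimage.\<close>
  show "\<exists>x\<in>space (leb (goe_index N)). conj_goe N Q x = y" if y: "y \<in> space (leb (goe_index N))" for y
  proof (rule bexI[of _ "conj_goe N (\<lambda>i p. Q p i) y"])
    show "conj_goe N (\<lambda>i p. Q p i) y \<in> space (leb (goe_index N))"
      using measurable_space[OF measurable_conj_goe y] .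
    show "conj_goe N Q (conj_goe N (\<lambda>i p. Q p i) y) = y"
    proof
      fix x :: "nat \<times> nat"
      show "conj_goe N Q (conj_goe N (\<lambda>i p. Q p i) y) x = y x"
      proof (cases "x \<in> goe_index N")
        case False
        then show ?thesis using y
          by (cases x) (auto simp: conj_goe_def space_PiM PiE_def extensional_def)
      next
        case True
        then obtain i j where ij: "x = (i,j)" "i \<le> j" "j < N" by (auto simp: goe_index_def)
        let ?y = "conj_goe N (\<lambda>i p. Q p i) y"
        have "conj_goe N Q ?y x = (\<Sum>p<N. Q i p * (\<Sum>q<N. Q j q * symm ?y p q))"
          using True ij by (simp add: conj_goe_def)
        also have "\<dots> = (\<Sum>q<N. Q j q * (\<Sum>p<N. Q i p * symm ?y p q))"
          unfolding sum_distrib_left by (subst sum.swap) (simp add: mult_ac)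
        also have "\<dots> = (\<Sum>q<N. Q j q * (\<Sum>p<N. Q i p * (\<Sum>r<N. Q r p * (\<Sum>s<N. Q s q * symm y r s))))"
          by (simp add: symm_conj_goe)
        also have "\<dots> = (\<Sum>q<N. Q j q * (\<Sum>s<N. Q s q * symm y i s))"
          using ij by (simp add: orthosys_roundtrip[OF Q, of i])
        also have "\<dots> = symm y i j" using ij by (simp add: orthosys_roundtrip[OF Q])
        also have "\<dots> = y x" using ij by (simp add: symm_def)
        finally show ?thesis .
      qed
    qed
  qed
  show "(\<Sum>i\<in>goe_index N. (conj_goe N Q x i)\<^sup>2 / (goe_sd N i)\<^sup>2) = (\<Sum>i\<in>goe_index N. (x i)\<^sup>2 / (goe_sd N i)\<^sup>2)" for x
    unfolding goe_quadratic_form using frobenius_conj[OF Q, of "symm x"] by (simp add: symm_conj_goe)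
qed simp

lemma eigvec_conj_goe:
  assumes Q: "orthosys N {..<N} Q" and u: "eigvec N (symm g) \<mu> u"
  shows "eigvec N (symm (conj_goe N Q g)) \<mu> (\<lambda>i. ip N (Q i) u)"
  unfolding eigvec_def
proof (intro allI impI)
  fix i assume i: "i < N"
  have "(\<Sum>j<N. symm (conj_goe N Q g) i j * ip N (Q j) u)
     = (\<Sum>j<N. \<Sum>p<N. \<Sum>q<N. Q i p * (symm g p q * (ip N (Q j) u * Q j q)))"
    using i by (simp add: symm_conj_goe sum_distrib_left sum_distrib_right mult_ac)
  also have "\<dots> = (\<Sum>p<N. \<Sum>q<N. \<Sum>j<N. Q i p * (symm g p q * (ip N (Q j) u * Q j q)))"
    by (rule trans[OF sum.swap], rule sum.cong[OF refl], rule sum.swap)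
  also have "\<dots> = (\<Sum>p<N. Q i p * (\<Sum>q<N. symm g p q * (\<Sum>j<N. ip N (Q j) u * Q j q)))"
    by (simp only: sum_distrib_left)
  also have "\<dots> = (\<Sum>p<N. Q i p * (\<Sum>q<N. symm g p q * u q))"
    by (simp add: orthobasis_expansion[OF Q])
  also have "\<dots> = \<mu> * ip N (Q i) u"
    using u by (simp add: eigvec_def ip_def sum_distrib_left mult_ac)
  finally show "(\<Sum>j<N. symm (conj_goe N Q g) i j * ip N (Q j) u) = \<mu> * ip N (Q i) u" .
qed

section \<open>The law of quadratic forms in the eigenvectors\<close>

text \<open>Householder reflections move the vectors of one system onto the other, one at a time.\<close>

lemma orthosys_rotation:
  assumes "finite J" "orthosys N J v" "orthosys N J e"
  shows "\<exists>Q. orthosys N {..<N} Q \<and> (\<forall>j\<in>J. \<forall>p<N. ip N (Q p) (v j) = e j p)"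
  using assms
proof (induction J)
  case empty
  show ?case
  proof -
    have "(\<Sum>r<N. (if p = r then 1 else 0) * (if q = r then 1 else 0)) = (if p = q then 1 else 0 :: real)"
      if "p < N" for p q
    proof -
      have "(\<Sum>r<N. (if p = r then 1 else 0) * (if q = r then 1 else 0))
          = (\<Sum>r<N. if r = p then if p = q then 1 else 0 else 0 :: real)"
        by (intro sum.cong) auto
      then show ?thesis using that by simp
    qed
    then show ?thesis
      by (intro exI[of _ "\<lambda>p q. if p = q then 1 else 0"]) (simp add: orthosys_def ip_def)
  qed
next
  case (insert j J)
  then obtain Q where Q: "orthosys N {..<N} Q" and Qv: "\<And>l p. l \<in> J \<Longrightarrow> p < N \<Longrightarrow> ip N (Q p) (v l) = e l p"
    by (auto simp: orthosys_def)
  define x where "x = (\<lambda>p. ip N (Q p) (v j))"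
  define d where "d = (\<lambda>p. x p - e j p)"
  \<comment> \<open>If the image \<open>x\<close> already equals \<open>e j\<close>, then
    \<open>d = 0\<close> and division by zero gives \<open>c = 0\<close>, so the reflection
    degenerates to the identity as it should.\<close>
  define c where "c = 2 / ip N d d"
  define t where "t = (\<lambda>q. \<Sum>r<N. d r * Q r q)"
  define Q' where "Q' = (\<lambda>p q. Q p q - c * d p * t q)"
  have vj: "ip N (v j) (v j) = 1" and ej: "ip N (e j) (e j) = 1"
    using insert.prems by (auto simp: orthosys_def)
  have vjl: "ip N (v j) (v l) = 0" and ejl: "ip N (e j) (e l) = 0" if "l \<in> J" for l
    using insert.prems insert.hyps that by (auto simp: orthosys_def)
  have xx: "ip N x x = 1"
    using parseval[OF Q, of "v j" "v j"] vj by (simp add: x_def ip_def[of N "\<lambda>p. ip N (Q p) (v j)"])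
  have tz: "ip N t z = ip N d (\<lambda>r. ip N (Q r) z)" for z
    unfolding t_def by (simp add: ip_sum_left ip_scale_left) (simp add: ip_def)
  have Q'z: "ip N (Q' p) z = ip N (Q p) z - c * d p * ip N d (\<lambda>r. ip N (Q r) z)" for p z
    by (simp add: Q'_def ip_diff_left ip_scale_left tz)
  have QQ: "ip N (Q p) (Q q) = (if p = q then 1 else 0)" if "p < N" "q < N" for p q
    using Q that by (auto simp: orthosys_def)
  have dQ: "ip N d (\<lambda>r. ip N (Q r) (Q q)) = d q" if "q < N" for q
  proof -
    have "ip N d (\<lambda>r. ip N (Q r) (Q q)) = (\<Sum>r<N. if r = q then d q else 0)"
      unfolding ip_def[of N d] using that by (intro sum.cong) (auto simp: QQ)
    then show ?thesis using that by simp
  qed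
  have "orthosys N {..<N} Q'"
    unfolding orthosys_def
  proof (intro ballI)
    fix p q assume "p \<in> {..<N}" "q \<in> {..<N}"
    then have pq: "p < N" "q < N" by auto
    have Qq: "ip N (Q p) (Q' q) = ip N (Q p) (Q q) - c * d q * d p" if "p < N" for p
      using Q'z[of q "Q p"] dQ[OF that] by (simp add: ip_commute)
    have "ip N d (\<lambda>r. ip N (Q r) (Q' q)) = (\<Sum>r<N. d r * (ip N (Q r) (Q q) - c * d q * d r))"
      unfolding ip_def[of N d] by (intro sum.cong) (auto simp: Qq)
    also have "\<dots> = ip N d (\<lambda>r. ip N (Q r) (Q q)) - c * d q * ip N d d"
      by (simp add: ip_def[of N d] algebra_simps sum_subtractf sum_distrib_left)
    finally have dd: "ip N d (\<lambda>r. ip N (Q r) (Q' q)) = d q - c * d q * ip N d d" using dQ[OF pq(2)] by simp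
    have "ip N (Q' p) (Q' q) = ip N (Q p) (Q q) - c * d q * d p - c * d p * (d q - c * d q * ip N d d)"
      using Q'z[of p "Q' q"] Qq[OF pq(1)] dd by simp
    also have "\<dots> = ip N (Q p) (Q q) + d p * d q * (c * (c * ip N d d - 2))" by (simp add: algebra_simps)
    also have "c * (c * ip N d d - 2) = 0" by (auto simp: c_def)
    finally show "ip N (Q' p) (Q' q) = (if p = q then 1 else 0)" using QQ[OF pq] by simp
  qed
  moreover have "ip N (Q' p) (v l) = e l p" if l: "l \<in> insert j J" and p: "p < N" for l p
  proof (cases "l = j")
    case True
    have dd: "ip N d d = 2 - 2 * ip N (e j) x"
      using xx ej by (simp add: d_def ip_diff_left ip_commute[of N _ "\<lambda>p. x p - e j p"]) (simp add: ip_commute)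
    have dx: "ip N d x = 1 - ip N (e j) x" using xx by (simp add: d_def ip_diff_left)
    have eq: "ip N (Q' p) (v l) = x p - c * d p * ip N d x"
      using True Q'z[of p "v j"] by (simp add: x_def)
    show ?thesis
    proof (cases "ip N d d = 0")
      case z: True
      then have "d p = 0" using p by (rule ip_self_eq_0D)
      then show ?thesis using eq True by (simp add: d_def)
    next
      case False
      \<comment> \<open>Since \<open>x\<close> and \<open>e j\<close> are unit vectors,
        \<open>ip N d d = 2 * ip N d x\<close>; the reflection thus subtracts exactly
        \<open>d = x - e j\<close> from \<open>x\<close>.\<close>
      have "c * ip N d x = 1" using False unfolding c_def dx dd by (simp add: field_simps)
      then have "c * d p * ip N d x = d p" by (metis mult.commute mult.left_commute mult_1_right)
      moreover have "d p = x p - e j p" by (simp add: d_def)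
      ultimately have "ip N (Q' p) (v l) = e j p" using eq by linarith
      then show ?thesis using True by simp
    qed
  next
    case False
    then have l: "l \<in> J" using l by simp
    \<comment> \<open>Vectors placed earlier are orthogonal to \<open>x\<close> and to
      \<open>e j\<close>, hence to \<open>d\<close>, and the reflection leaves them fixed.\<close>
    have "ip N d (\<lambda>r. ip N (Q r) (v l)) = ip N x (e l) - ip N (e j) (e l)"
      unfolding ip_diff_left[symmetric] d_def using Qv[OF l] by (intro ip_cong) auto
    also have "ip N x (e l) = ip N x (\<lambda>r. ip N (Q r) (v l))" using Qv[OF l] by (intro ip_cong) auto
    also have "\<dots> = ip N (v j) (v l)" unfolding x_def using parseval[OF Q, of "v j" "v l"] by (simp add: ip_def)
    finally show ?thesis using Q'z[of p "v l"] Qv[OF l p] vjl[OF l] ejl[OF l] by simp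
  qed
  ultimately show ?case by blast
qed

text \<open>A measurable choice of eigenbasis at every sample, without any convention on order or
  signs, so the results hold for each such choice.\<close>

locale eigenbasis_selection =
  fixes N :: nat and u :: "(nat \<times> nat \<Rightarrow> real) \<Rightarrow> nat \<Rightarrow> nat \<Rightarrow> real"
  assumes ortho: "g \<in> space (GOE N) \<Longrightarrow> orthosys N {..<N} (u g)"
    and eig: "g \<in> space (GOE N) \<Longrightarrow> i < N \<Longrightarrow> \<exists>\<mu>. eigvec N (symm g) \<mu> (u g i)"
    and meas: "i < N \<Longrightarrow> p < N \<Longrightarrow> (\<lambda>g. u g i p) \<in> borel_measurable (GOE N)"
begin

text \<open>The maximum is seen only through its sublevel events: \<open>S\<close> is a half-line
  for the maximum and a symmetric interval for the maximum of absolute values. The system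
  \<open>v\<close> stands for the eigenvectors of the deterministic matrix with eigenvalues
  \<open>a\<close>.\<close>

definition quad_event :: "real set \<Rightarrow> 'j set \<Rightarrow> ('j \<Rightarrow> real) \<Rightarrow> ('j \<Rightarrow> nat \<Rightarrow> real) \<Rightarrow> (nat \<times> nat \<Rightarrow> real) set" where
  "quad_event S J a v = {g \<in> space (GOE N). \<forall>i<N. (\<Sum>j\<in>J. a j * (ip N (v j) (u g i))\<^sup>2) \<in> S}"

lemma sets_quad_event:
  assumes S: "S \<in> sets borel"
  shows "quad_event S J a v \<in> sets (GOE N)"
proof -
  have m: "(\<lambda>g. \<Sum>j\<in>J. a j * (ip N (v j) (u g i))\<^sup>2) \<in> borel_measurable (GOE N)" if "i < N" for i
    unfolding ip_def
    by (intro borel_measurable_sum borel_measurable_times borel_measurable_const borel_measurable_power meas) (use that in auto)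
  have "{g \<in> space (GOE N). (\<Sum>j\<in>J. a j * (ip N (v j) (u g i))\<^sup>2) \<in> S} \<in> sets (GOE N)" if "i < N" for i
  proof -
    have "{g \<in> space (GOE N). (\<Sum>j\<in>J. a j * (ip N (v j) (u g i))\<^sup>2) \<in> S}
      = (\<lambda>g. \<Sum>j\<in>J. a j * (ip N (v j) (u g i))\<^sup>2) -` S \<inter> space (GOE N)" by blast
    then show ?thesis using measurable_sets[OF m[OF that] S] by simp
  qed
  then have "{g \<in> space (GOE N). \<forall>i\<in>{..<N}. (\<Sum>j\<in>J. a j * (ip N (v j) (u g i))\<^sup>2) \<in> S} \<in> sets (GOE N)"
    by (intro sets.sets_Collect_finite_All) auto
  then show ?thesis by (simp only: quad_event_def Ball_def lessThan_iff)
qed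

text \<open>The basis selected at the conjugated sample and the rotated basis selected at
  \<open>g\<close> diagonalise the same matrix. With simple spectrum they agree up to order and
  sign; the square ignores signs and the quantifier over \<open>i\<close> ignores order.\<close>

lemma quad_event_conj_iff:
  assumes Q: "orthosys N {..<N} Q" and Qv: "\<And>j p. j \<in> J \<Longrightarrow> p < N \<Longrightarrow> ip N (Q p) (v j) = e j p"
    and g: "g \<in> space (GOE N)" and K: "krylov_det N (symm (conj_goe N Q g)) \<noteq> 0"
  shows "conj_goe N Q g \<in> quad_event S J a e \<longleftrightarrow> g \<in> quad_event S J a v"
proof -
  let ?g = "conj_goe N Q g"
  define x where "x = u ?g"
  define y where "y = (\<lambda>i p. ip N (Q p) (u g i))"
  have g': "?g \<in> space (GOE N)" by (simp add: space_GOE conj_goe_def)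
  have x: "orthosys N {..<N} x" "\<And>i. i < N \<Longrightarrow> \<exists>\<mu>. eigvec N (symm ?g) \<mu> (x i)"
    using ortho[OF g'] eig[OF g'] by (auto simp: x_def)
  have yip: "ip N (\<lambda>p. ip N (Q p) z) (\<lambda>p. ip N (Q p) z') = ip N z z'" for z z'
    using parseval[OF Q, of z z'] by (simp add: ip_def)
  have y: "orthosys N {..<N} y" "\<And>i. i < N \<Longrightarrow> \<exists>\<mu>. eigvec N (symm ?g) \<mu> (y i)"
    using ortho[OF g] eig[OF g] eigvec_conj_goe[OF Q]
    by (auto simp: orthosys_def y_def yip) (metis (no_types))
  have ey: "ip N (e j) (y i) = ip N (v j) (u g i)" if "j \<in> J" for i j
  proof -
    have "ip N (e j) (y i) = ip N (\<lambda>p. ip N (Q p) (v j)) (y i)" using Qv[OF that] by (intro ip_cong) auto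
    then show ?thesis by (simp add: y_def yip)
  qed
  define F where "F = (\<lambda>z. \<Sum>j\<in>J. a j * (ip N (e j) z)\<^sup>2)"
  have Fs: "F z = F z'" if "s\<^sup>2 = 1" "\<forall>p<N. z p = s * z' p" for s z z'
  proof -
    have "ip N (e j) z = s * ip N (e j) z'" for j
      using that(2) unfolding ip_scale_right[symmetric] by (intro ip_cong) auto
    then show ?thesis using that(1) by (simp add: F_def power_mult_distrib)
  qed
  have "\<exists>j<N. F (x i) = F (y j)" if "i < N" for i
    using eigenbasis_unique[OF x y symm_commute K that] Fs by blast
  moreover have "\<exists>j<N. F (y i) = F (x j)" if "i < N" for i
    using eigenbasis_unique[OF y x symm_commute K that] Fs by blast
  ultimately have "(\<forall>i<N. F (x i) \<in> S) \<longleftrightarrow> (\<forall>i<N. F (y i) \<in> S)" by metis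
  then show ?thesis using g g' by (simp add: quad_event_def F_def x_def ey)
qed

text \<open>Conjugation by a rotation carrying \<open>v\<close> to \<open>e\<close> maps one event
  to the other outside the zero set of \<open>krylov_det\<close>; this set is null for the
  conjugated sample too, which has the same law. Since \<open>v\<close> is arbitrary, it can later
  be a frozen value of random vectors.\<close>

lemma prob_quad_event_invariant:
  assumes "finite J" "orthosys N J v" "orthosys N J e" "S \<in> sets borel"
  shows "measure (GOE N) (quad_event S J a v) = measure (GOE N) (quad_event S J a e)"
proof -
  interpret prob_space "GOE N" by (rule prob_space_GOE)
  obtain Q where Q: "orthosys N {..<N} Q" and Qv: "\<And>j p. j \<in> J \<Longrightarrow> p < N \<Longrightarrow> ip N (Q p) (v j) = e j p"
    using orthosys_rotation[OF assms(1-3)] by blast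
  have m: "conj_goe N Q \<in> measurable (GOE N) (GOE N)"
    using measurable_conj_goe[of N Q] by (simp cong: measurable_cong_sets)
  have "AE g in distr (GOE N) (GOE N) (conj_goe N Q). krylov_det N (symm g) \<noteq> 0"
    unfolding distr_conj_goe[OF Q] by (rule AE_krylov_det_nonzero)
  then have K: "AE g in GOE N. krylov_det N (symm (conj_goe N Q g)) \<noteq> 0"
    by (rule AE_distrD[OF m])
  have "measure (GOE N) (quad_event S J a e) = measure (distr (GOE N) (GOE N) (conj_goe N Q)) (quad_event S J a e)"
    unfolding distr_conj_goe[OF Q] ..
  also have "\<dots> = measure (GOE N) (conj_goe N Q -` quad_event S J a e \<inter> space (GOE N))"
    by (rule measure_distr[OF m sets_quad_event[OF assms(4)]])
  also have "\<dots> = measure (GOE N) (quad_event S J a v)"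
  proof (rule measure_eq_AE)
    have "conj_goe N Q g \<in> quad_event S J a e \<longleftrightarrow> g \<in> quad_event S J a v"
      if "g \<in> space (GOE N)" "krylov_det N (symm (conj_goe N Q g)) \<noteq> 0" for g
      by (rule quad_event_conj_iff[OF Q _ that]) (rule Qv)
    then show "AE g in GOE N. (g \<in> conj_goe N Q -` quad_event S J a e \<inter> space (GOE N)) = (g \<in> quad_event S J a v)"
      using K AE_space by (auto elim!: eventually_elim2)
  qed (use measurable_sets[OF m] sets_quad_event[OF assms(4)] in auto)
  finally show ?thesis by (rule sym)
qed

end

section \<open>Spectrum and quadratic form of the deterministic matrices\<close>

lemma order_prod_mset_linear:
  "order c (\<Prod>x\<in>#M. [:- x, 1:]) = count M (c :: 'a :: idom)"
proof (induction M)
  case (add x M)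
  have nz: "(\<Prod>x\<in>#M. [:- x, 1:]) \<noteq> (0 :: 'a poly)" by (auto simp: prod_mset_zero_iff)
  have "order c [:- x, 1:] = (if x = c then 1 else 0)"
    using order_power_n_n[of c 1] by (auto intro!: order_0I)
  then show ?case using add nz by (simp add: order_mult del: mult_pCons_left)
qed (simp add: order_0I)

text \<open>Diagonalising by \<open>W\<close> factors the characteristic polynomial over the
  eigenvalues of the basis. Root multiplicities determine this multiset, so a permutation matches it
  with the prescribed eigenvalues, and those equal to 0 drop out of the form.\<close>

lemma symmetric_mat_eigenbasis_form:
  fixes A :: "real mat"
  assumes A: "A \<in> carrier_mat N N" "A\<^sup>T = A" and k: "k \<le> N"
    and cp: "char_poly A = (\<Prod>j\<in>{1..k}. [:- a j, 1:]) * monom 1 (N - k)"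
    and W: "orthonormal_eigenbasis N A W"
  shows "\<exists>e. orthosys N {1..k} e \<and> (\<forall>x\<in>carrier_vec N.
     scalar_prod x (A *\<^sub>v x) = (\<Sum>j\<in>{1..k}. a j * (ip N (e j) (vec_index x))\<^sup>2))"
proof -
  define w where "w i = vec_index (W i)" for i
  have Wc: "W i \<in> carrier_vec N" if "i < N" for i using W that by (auto simp: orthonormal_eigenbasis_def)
  have "dim_vec (W i) = N" if "i < N" for i using Wc[OF that] by simp
  then have w: "orthosys N {..<N} w"
    using W by (auto simp: orthonormal_eigenbasis_def orthosys_def ip_def w_def scalar_prod_def atLeast0LessThan)
  obtain \<mu> where \<mu>: "\<And>i. i < N \<Longrightarrow> A *\<^sub>v W i = \<mu> i \<cdot>\<^sub>v W i"
    using W unfolding orthonormal_eigenbasis_def by metis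
  have Aw: "(\<Sum>q<N. A $$ (p,q) * w i q) = \<mu> i * w i p" if "i < N" "p < N" for i p
    using arg_cong[OF \<mu>[OF that(1)], of "\<lambda>v. vec_index v p"] that A Wc[OF that(1)]
    by (simp add: w_def scalar_prod_def atLeast0LessThan)
  have Asym: "A $$ (p,q) = A $$ (q,p)" if "p < N" "q < N" for p q
    using A that by (metis carrier_matD index_transpose_mat(1))
  define P where "P = mat N N (\<lambda>(p,i). w i p)"
  define D where "D = mat N N (\<lambda>(i,j). if i = j then \<mu> i else 0)"
  have c: "P \<in> carrier_mat N N" "D \<in> carrier_mat N N" "P\<^sup>T \<in> carrier_mat N N" by (auto simp: P_def D_def)
  have "P\<^sup>T * P = 1\<^sub>m N"
    using w by (intro eq_matI) (auto simp: P_def scalar_prod_def atLeast0LessThan orthosys_def ip_def)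
  then have PP: "P * P\<^sup>T = 1\<^sub>m N" using c mat_mult_left_right_inverse by blast
  have AP: "A * P = P * D"
  proof (rule eq_matI)
    fix p i assume "p < dim_row (P * D)" "i < dim_col (P * D)"
    then have pi: "p < N" "i < N" by (auto simp: P_def D_def)
    have "(P * D) $$ (p,i) = (\<Sum>l<N. w l p * (if l = i then \<mu> l else 0))"
      using pi by (simp add: P_def D_def scalar_prod_def atLeast0LessThan)
    also have "\<dots> = (\<Sum>l<N. if l = i then w i p * \<mu> i else 0)"
      by (intro sum.cong) auto
    finally show "(A * P) $$ (p,i) = (P * D) $$ (p,i)"
      using pi A Aw[OF pi(2,1)] by (simp add: P_def scalar_prod_def atLeast0LessThan)
  qed (use A in \<open>auto simp: P_def D_def\<close>)
  have "A = A * (P * P\<^sup>T)" using A PP by simp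
  also have "\<dots> = (P * D) * P\<^sup>T" using A c AP by (metis assoc_mult_mat)
  finally have "similar_mat_wit A D P (P\<^sup>T)"
    using A c PP \<open>P\<^sup>T * P = 1\<^sub>m N\<close> by (auto simp: similar_mat_wit_def Let_def)
  then have "char_poly A = char_poly D" by (intro char_poly_similar) (auto simp: similar_mat_def)
  also have "\<dots> = (\<Prod>x\<leftarrow>diag_mat D. [:- x, 1:])"
    by (rule char_poly_upper_triangular[OF c(2)]) (auto simp: D_def)
  also have "diag_mat D = map \<mu> [0..<N]" by (auto simp: diag_mat_def D_def)
  finally have cp1: "char_poly A = (\<Prod>x\<in>#mset (map \<mu> [0..<N]). [:- x, 1:])"
    by (metis mset_map prod_mset_prod_list)
  \<comment> \<open>The prescribed spectrum as a sequence indexed from 0: \<open>a\<close> counts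
    from 1, hence the \<open>Suc\<close>, and the \<open>N - k\<close> remaining eigenvalues are
    0.\<close>
  define b where "b i = (if i < k then a (Suc i) else 0)" for i
  have "char_poly A = (\<Prod>i<N. [:- b i, 1:])"
  proof -
    have "{..<N} = {..<k} \<union> {k..<N}" using k by auto
    then have "(\<Prod>i<N. [:- b i, 1:]) = (\<Prod>i<k. [:- b i, 1:]) * (\<Prod>i\<in>{k..<N}. [:- b i, 1:])"
      by (simp add: prod.union_disjoint ivl_disj_int)
    also have "(\<Prod>i\<in>{k..<N}. [:- b i, 1:]) = (\<Prod>i\<in>{k..<N}. [:0, 1:])" by (intro prod.cong) (auto simp: b_def)
    also have "\<dots> = monom 1 (N - k)" by (simp add: monom_altdef)
    also have "(\<Prod>i<k. [:- b i, 1:]) = (\<Prod>j\<in>{1..k}. [:- a j, 1:])"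
      by (rule prod.reindex_bij_witness[of _ "\<lambda>j. j - 1" Suc]) (auto simp: b_def)
    finally show ?thesis using cp by simp
  qed
  also have "\<dots> = (\<Prod>x\<in>#mset (map b [0..<N]). [:- x, 1:])"
  proof -
    have "(\<Prod>x\<in>#mset (map b [0..<N]). [:- x, 1:]) = prod_list (map (\<lambda>i. [:- b i, 1:]) [0..<N])"
      by (metis (mono_tags, lifting) comp_apply list.map_comp map_eq_conv mset_map prod_mset_prod_list)
    also have "\<dots> = (\<Prod>i\<in>set [0..<N]. [:- b i, 1:])" by (rule prod.distinct_set_conv_list[symmetric]) simp
    finally show ?thesis by (simp add: atLeast0LessThan)
  qed
  finally have "mset (map \<mu> [0..<N]) = mset (map b [0..<N])"
    using cp1 by (intro multiset_eqI) (metis order_prod_mset_linear)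
  then obtain \<pi> where \<pi>: "\<pi> permutes {..<N}" "permute_list \<pi> (map \<mu> [0..<N]) = map b [0..<N]"
    using mset_eq_permutation[of "map b [0..<N]" "map \<mu> [0..<N]"] by auto
  have \<pi>lt: "\<pi> i < N" if "i < N" for i using permutes_in_image[OF \<pi>(1), of i] that by simp
  have b\<mu>: "b i = \<mu> (\<pi> i)" if "i < N" for i
  proof -
    have "map b [0..<N] ! i = map \<mu> [0..<N] ! (\<pi> i)"
      unfolding \<pi>(2)[symmetric] using that \<pi>(1) by (intro permute_list_nth) auto
    then show ?thesis using that \<pi>lt[OF that] by simp
  qed
  have "scalar_prod x (A *\<^sub>v x) = (\<Sum>j\<in>{1..k}. a j * (ip N (w (\<pi> (j - 1))) (vec_index x))\<^sup>2)" if x: "x \<in> carrier_vec N" for x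
  proof -
    let ?x = "vec_index x"
    define y where "y = (\<lambda>p. \<Sum>q<N. A $$ (p,q) * ?x q)"
    have wy: "ip N (w i) y = \<mu> i * ip N (w i) ?x" if "i < N" for i
    proof -
      have "ip N (w i) y = (\<Sum>p<N. \<Sum>q<N. A $$ (q,p) * w i p * ?x q)"
        unfolding ip_def y_def sum_distrib_left using Asym by (intro sum.cong) (auto simp: mult_ac)
      also have "\<dots> = (\<Sum>q<N. (\<Sum>p<N. A $$ (q,p) * w i p) * ?x q)"
        unfolding sum_distrib_right by (rule sum.swap)
      also have "\<dots> = \<mu> i * ip N (w i) ?x"
      proof -
        have "(\<Sum>q<N. (\<Sum>p<N. A $$ (q,p) * w i p) * ?x q) = (\<Sum>q<N. \<mu> i * (w i q * ?x q))"
          by (intro sum.cong refl) (simp add: Aw that)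
        then show ?thesis by (simp add: ip_def sum_distrib_left)
      qed
      finally show ?thesis .
    qed
    have "scalar_prod x (A *\<^sub>v x) = ip N ?x y"
    proof -
      have d: "dim_vec x = N" "dim_row A = N" "dim_col A = N" using x A(1) by auto
      show ?thesis unfolding scalar_prod_def ip_def y_def
        by (intro sum.cong) (auto simp: d scalar_prod_def atLeast0LessThan)
    qed
    also have "\<dots> = (\<Sum>i<N. \<mu> i * (ip N (w i) ?x)\<^sup>2)"
      by (subst parseval[OF w, symmetric], intro sum.cong) (auto simp: wy power2_eq_square)
    also have "\<dots> = (\<Sum>i<N. \<mu> (\<pi> i) * (ip N (w (\<pi> i)) ?x)\<^sup>2)"
      by (rule sum.permute[OF \<pi>(1), unfolded comp_def])
    also have "\<dots> = (\<Sum>i<N. b i * (ip N (w (\<pi> i)) ?x)\<^sup>2)" by (intro sum.cong) (auto simp: b\<mu>)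
    also have "\<dots> = (\<Sum>i<k. b i * (ip N (w (\<pi> i)) ?x)\<^sup>2)"
      using k by (intro sum.mono_neutral_right) (auto simp: b_def)
    also have "\<dots> = (\<Sum>j\<in>{1..k}. a j * (ip N (w (\<pi> (j - 1))) ?x)\<^sup>2)"
      by (rule sum.reindex_bij_witness[of _ "\<lambda>j. j - 1" Suc]) (auto simp: b_def)
    finally show ?thesis .
  qed
  moreover have "orthosys N {1..k} (\<lambda>j. w (\<pi> (j - 1)))"
    unfolding orthosys_def
  proof (intro ballI)
    fix i j assume ij: "i \<in> {1..k}" "j \<in> {1..k}"
    then have l: "i - 1 < N" "j - 1 < N" using k by auto
    have "\<pi> (i - 1) = \<pi> (j - 1) \<longleftrightarrow> i = j"
      using ij inj_eq[OF permutes_inj[OF \<pi>(1)], of "i-1" "j-1"] by auto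
    then show "ip N (w (\<pi> (i - 1))) (w (\<pi> (j - 1))) = (if i = j then 1 else 0)"
      using orthosysD[OF w, of "\<pi> (i-1)" "\<pi> (j-1)"] \<pi>lt l by simp
  qed
  ultimately show ?thesis by (intro exI[of _ "\<lambda>j. w (\<pi> (j - 1))"]) blast
qed

section \<open>Gram--Schmidt on nearly orthonormal vectors\<close>

text \<open>If the residual \<open>z\<close> has norm 0, division by zero returns the zero vector.
  The function is thus total, and equivariance and measurability hold for every input; only
  orthonormality requires control of the input.\<close>

fun gram_schmidt :: "nat \<Rightarrow> (nat \<Rightarrow> nat \<Rightarrow> real) \<Rightarrow> nat \<Rightarrow> nat \<Rightarrow> real" where
  "gram_schmidt N x j =
     (let z = (\<lambda>p. x j p - (\<Sum>l\<in>{1..<j}. ip N (x j) (gram_schmidt N x l) * gram_schmidt N x l p))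
      in (\<lambda>p. z p / sqrt (ip N z z)))"

declare gram_schmidt.simps [simp del]

text \<open>The recursion consists of inner products and linear combinations, and both commute with
  passing to coordinates in an orthonormal basis.\<close>

lemma gram_schmidt_rotate:
  assumes U: "orthosys N {..<N} U"
  shows "gram_schmidt N (\<lambda>j i. ip N (U i) (x j)) j = (\<lambda>i. ip N (U i) (gram_schmidt N x j))"
proof (induction j rule: less_induct)
  case (less j)
  have pars: "ip N (\<lambda>i. ip N (U i) y) (\<lambda>i. ip N (U i) y') = ip N y y'" for y y'
    using parseval[OF U, of y y'] by (simp add: ip_def)
  define z where "z = (\<lambda>p. x j p - (\<Sum>l\<in>{1..<j}. ip N (x j) (gram_schmidt N x l) * gram_schmidt N x l p))"
  have right_diff: "ip N a (\<lambda>p. b p - c p) = ip N a b - ip N a c" for a b c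
    by (metis ip_commute ip_diff_left)
  have "(\<lambda>i. ip N (U i) (x j) - (\<Sum>l\<in>{1..<j}. ip N (\<lambda>i. ip N (U i) (x j)) (gram_schmidt N (\<lambda>j i. ip N (U i) (x j)) l)
            * gram_schmidt N (\<lambda>j i. ip N (U i) (x j)) l i)) = (\<lambda>i. ip N (U i) z)"
    using less by (simp add: pars z_def right_diff ip_sum_right ip_scale_right)
  then have "gram_schmidt N (\<lambda>j i. ip N (U i) (x j)) j = (\<lambda>i. ip N (U i) z / sqrt (ip N z z))"
    by (subst gram_schmidt.simps) (simp add: Let_def pars)
  also have "\<dots> = (\<lambda>i. ip N (U i) (\<lambda>p. z p / sqrt (ip N z z)))"
    using ip_scale_right[of N _ "1 / sqrt (ip N z z)" z] by simp
  also have "(\<lambda>p. z p / sqrt (ip N z z)) = gram_schmidt N x j"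
    by (subst gram_schmidt.simps) (simp add: Let_def z_def)
  finally show ?case .
qed

lemma gram_schmidt_cong:
  assumes "\<And>l p. l \<in> {1..k} \<Longrightarrow> p < N \<Longrightarrow> x l p = y l p" "j \<in> {1..k}" "p < N"
  shows "gram_schmidt N x j p = gram_schmidt N y j p"
  using assms(2,3)
proof (induction j arbitrary: p rule: less_induct)
  case (less j)
  let ?z = "\<lambda>x p. x j p - (\<Sum>l\<in>{1..<j}. ip N (x j) (gram_schmidt N x l) * gram_schmidt N x l p)"
  have IH: "gram_schmidt N x l p = gram_schmidt N y l p" if "l \<in> {1..<j}" "p < N" for l p
    using that less.prems by (intro less.IH) auto
  have ips: "ip N (x j) (gram_schmidt N x l) = ip N (y j) (gram_schmidt N y l)" if "l \<in> {1..<j}" for l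
    using IH[OF that] assms(1) less.prems by (intro ip_cong) auto
  have z: "?z x p = ?z y p" if "p < N" for p
    using that IH ips assms(1)[of j p] less.prems by simp
  have "ip N (?z x) (?z x) = ip N (?z y) (?z y)" using z by (intro ip_cong) auto
  then show ?case
    using z[OF less.prems(2)] gram_schmidt.simps[of N x j] gram_schmidt.simps[of N y j] by (simp add: Let_def)
qed

lemma gram_schmidt_measurable:
  assumes x: "\<And>l p. l \<in> {1..k} \<Longrightarrow> p < N \<Longrightarrow> (\<lambda>w. x w l p) \<in> borel_measurable M"
    and "j \<in> {1..k}" "p < N"
  shows "(\<lambda>w. gram_schmidt N (x w) j p) \<in> borel_measurable M"
  using assms(2,3)
proof (induction j arbitrary: p rule: less_induct)
  case (less j)
  let ?z = "\<lambda>x p. x j p - (\<Sum>l\<in>{1..<j}. ip N (x j) (gram_schmidt N x l) * gram_schmidt N x l p)"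
  have IH: "(\<lambda>w. gram_schmidt N (x w) l p) \<in> borel_measurable M" if "l \<in> {1..<j}" "p < N" for l p
    using that less.prems by (intro less.IH) auto
  have z: "(\<lambda>w. ?z (x w) p) \<in> borel_measurable M" if "p < N" for p
    unfolding ip_def using that less.prems
    by (intro borel_measurable_diff borel_measurable_sum borel_measurable_times x IH) auto
  have "(\<lambda>w. ip N (?z (x w)) (?z (x w))) \<in> borel_measurable M"
    unfolding ip_def[of N "?z _" "?z _"] by (intro borel_measurable_sum borel_measurable_times z) auto
  then have "(\<lambda>w. ?z (x w) p / sqrt (ip N (?z (x w)) (?z (x w)))) \<in> borel_measurable M"
    using z[OF less.prems(2)] by measurable
  then show ?case by (subst gram_schmidt.simps) (simp add: Let_def)
qed

definition near_orthonormal :: "nat \<Rightarrow> nat \<Rightarrow> real \<Rightarrow> (nat \<Rightarrow> nat \<Rightarrow> real) \<Rightarrow> bool" where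
  "near_orthonormal N k \<epsilon> x \<longleftrightarrow>
     (\<forall>j\<in>{1..k}. \<forall>l\<in>{1..k}. \<bar>ip N (x j) (x l) - (if j = l then 1 else 0)\<bar> \<le> \<epsilon>)"

lemma abs_inverse_sqrt_minus_1:
  assumes "1/2 \<le> (y::real)"
  shows "\<bar>1 / sqrt y - 1\<bar> \<le> 2 * \<bar>1 - y\<bar>" "0 < 1 / sqrt y" "1 / sqrt y \<le> 2"
proof -
  have y: "y > 0" using assms by simp
  have s: "sqrt y \<ge> 1/2"
    by (rule real_le_rsqrt) (use assms in \<open>simp add: power2_eq_square\<close>)
  show "0 < 1 / sqrt y" using y by simp
  show "1 / sqrt y \<le> 2" using s y by (simp add: divide_le_eq)
  have "\<bar>1 - y\<bar> = \<bar>1 - sqrt y\<bar> * (1 + sqrt y)"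
  proof -
    have "1 - y = (1 - sqrt y) * (1 + sqrt y)" using y by (simp add: algebra_simps)
    then show ?thesis using s by (simp add: abs_mult)
  qed
  then have A: "2 * \<bar>1 - y\<bar> * sqrt y = \<bar>1 - sqrt y\<bar> * (2 * sqrt y * (1 + sqrt y))" by simp
  have B: "1 \<le> 2 * sqrt y * (1 + sqrt y)" using mult_mono[of 1 "2 * sqrt y" 1 "1 + sqrt y"] s y by simp
  have "\<bar>1 - sqrt y\<bar> \<le> 2 * \<bar>1 - y\<bar> * sqrt y"
    unfolding A using mult_left_mono[OF B abs_ge_zero] by (simp only: mult_1_right)
  moreover have "\<bar>1 / sqrt y - 1\<bar> = \<bar>1 - sqrt y\<bar> / sqrt y"
    using s y by (simp add: abs_if field_simps)
  ultimately show "\<bar>1 / sqrt y - 1\<bar> \<le> 2 * \<bar>1 - y\<bar>" using s y by (simp add: field_simps)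
qed

text \<open>Here \<open>m\<close> counts the vectors processed so far. The coefficients
  \<open>c j l\<close> do not depend on the coordinate \<open>p\<close>; an entry of the output is
  therefore controlled by the inputs at the same coordinate, which gives estimates valid in all rows
  at once.\<close>

definition gs_close :: "nat \<Rightarrow> nat \<Rightarrow> real \<Rightarrow> nat \<Rightarrow> (nat \<Rightarrow> nat \<Rightarrow> real) \<Rightarrow> bool" where
  "gs_close N k \<delta> m x \<longleftrightarrow> orthosys N {1..m} (gram_schmidt N x) \<and>
     (\<exists>c. \<forall>j\<in>{1..m}. (\<forall>p. gram_schmidt N x j p = (\<Sum>l\<in>{1..k}. c j l * x l p)) \<and>
        (\<forall>l\<in>{1..k}. \<bar>c j l - (if j = l then 1 else 0)\<bar> \<le> \<delta>))"

text \<open>Of the constants, \<open>C1\<close> bounds the projections of the new vector onto the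
  previous ones, \<open>C2\<close> the resulting change of its coefficients, and \<open>C3\<close>
  the deviation of the squared residual norm from 1. The condition
  \<open>\<epsilon> \<le> 1 / (2 * C3)\<close> keeps that norm at least \<open>1/2\<close>, so
  normalising is stable.\<close>

lemma gram_schmidt_step:
  fixes C \<epsilon> :: real and k :: nat
  defines "C1 \<equiv> 2 * C + real k * (1 + C)"
  defines "C2 \<equiv> real k * C1 * (1 + C)" and "C3 \<equiv> 1 + real k * C1\<^sup>2"
  assumes G: "near_orthonormal N k \<epsilon> x" and close: "gs_close N k (C * \<epsilon>) m x"
    and C: "C \<ge> 0" and m: "m < k" and \<epsilon>: "0 \<le> \<epsilon>" "\<epsilon> \<le> 1" "\<epsilon> \<le> 1 / (2 * C3)"
  shows "gs_close N k ((C + 2 * C2 + 2 * C3) * \<epsilon>) (Suc m) x"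
proof -
  let ?j = "Suc m" and ?v = "gram_schmidt N x"
  have j: "?j \<in> {1..k}" using m by auto
  obtain c where cv: "\<And>l p. l \<in> {1..m} \<Longrightarrow> ?v l p = (\<Sum>r\<in>{1..k}. c l r * x r p)"
    and cb: "\<And>l r. l \<in> {1..m} \<Longrightarrow> r \<in> {1..k} \<Longrightarrow> \<bar>c l r - (if l = r then 1 else 0)\<bar> \<le> C * \<epsilon>"
    using close unfolding gs_close_def by blast
  have orth: "orthosys N {1..m} ?v" using close by (simp add: gs_close_def)
  have Gb: "\<bar>ip N (x a) (x b) - (if a = b then 1 else 0)\<bar> \<le> \<epsilon>" if "a \<in> {1..k}" "b \<in> {1..k}" for a b
    using G that by (auto simp: near_orthonormal_def)
  have C1: "C1 \<ge> 0" and C2: "C2 \<ge> 0" and C3: "C3 \<ge> 1" using C by (auto simp: C1_def C2_def C3_def)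
  have Ce: "C * \<epsilon> \<le> C" using mult_left_mono[OF \<epsilon>(2) C] by simp
  have c1: "\<bar>c l r\<bar> \<le> 1 + C" if "l \<in> {1..m}" "r \<in> {1..k}" for l r
    using cb[OF that] Ce by (auto split: if_splits)
  define \<beta> where "\<beta> = (\<lambda>l. ip N (x ?j) (?v l))"
  have \<beta>: "\<bar>\<beta> l\<bar> \<le> C1 * \<epsilon>" if l: "l \<in> {1..m}" for l
  proof -
    have "ip N (x ?j) (?v l) = (\<Sum>r\<in>{1..k}. c l r * ip N (x ?j) (x r))"
      unfolding ip_scale_right[symmetric] ip_sum_right[symmetric] using cv[OF l] by (intro ip_cong) auto
    also have "\<dots> = c l ?j * ip N (x ?j) (x ?j) + (\<Sum>r\<in>{1..k}-{?j}. c l r * ip N (x ?j) (x r))"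
      using j by (subst sum.remove[of _ ?j]) auto
    finally have e: "\<beta> l = \<dots>" by (simp add: \<beta>_def)
    \<comment> \<open>Each term of the projection is small: in the term \<open>r = ?j\<close> the
      coefficient is off-diagonal, and in all other terms the inner product of the inputs
      is.\<close>
    have "\<bar>c l ?j\<bar> \<le> C * \<epsilon>" using cb[OF l j] l by (auto split: if_splits)
    moreover have "\<bar>ip N (x ?j) (x ?j)\<bar> \<le> 2" using Gb[OF j j] \<epsilon> by auto
    ultimately have 1: "\<bar>c l ?j * ip N (x ?j) (x ?j)\<bar> \<le> (C * \<epsilon>) * 2" unfolding abs_mult by (intro mult_mono) auto
    have "\<bar>\<Sum>r\<in>{1..k}-{?j}. c l r * ip N (x ?j) (x r)\<bar> \<le> (\<Sum>r\<in>{1..k}-{?j}. (1 + C) * \<epsilon>)"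
    proof (rule order_trans[OF sum_abs sum_mono])
      fix r assume r: "r \<in> {1..k}-{?j}"
      have "\<bar>ip N (x ?j) (x r)\<bar> \<le> \<epsilon>" using Gb[OF j, of r] r by (auto split: if_splits)
      then show "\<bar>c l r * ip N (x ?j) (x r)\<bar> \<le> (1 + C) * \<epsilon>"
        unfolding abs_mult using c1[OF l, of r] r C by (intro mult_mono) auto
    qed
    also have "\<dots> \<le> real k * ((1 + C) * \<epsilon>)"
    proof -
      have "real (card ({1..k}-{?j})) \<le> real k" using card_mono[of "{1..k}" "{1..k}-{?j}"] by simp
      then show ?thesis using C \<epsilon> by (simp add: mult_right_mono)
    qed
    finally show ?thesis using 1 unfolding e C1_def by (simp add: algebra_simps)
  qed
  define z where "z = (\<lambda>p. x ?j p - (\<Sum>l\<in>{1..m}. \<beta> l * ?v l p))"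
  define d where "d = (\<lambda>r. (if ?j = r then 1 else 0) - (\<Sum>l\<in>{1..m}. \<beta> l * c l r))"
  have vj: "?v ?j = (\<lambda>p. z p / sqrt (ip N z z))"
    by (subst gram_schmidt.simps) (simp add: Let_def z_def \<beta>_def atLeastLessThanSuc_atLeastAtMost)
  have zd: "z p = (\<Sum>r\<in>{1..k}. d r * x r p)" for p
  proof -
    have "(\<Sum>l\<in>{1..m}. \<beta> l * ?v l p) = (\<Sum>l\<in>{1..m}. \<Sum>r\<in>{1..k}. \<beta> l * c l r * x r p)"
      using cv by (intro sum.cong refl) (simp add: sum_distrib_left mult_ac)
    also have "\<dots> = (\<Sum>r\<in>{1..k}. (\<Sum>l\<in>{1..m}. \<beta> l * c l r) * x r p)"
      by (subst sum.swap) (simp add: sum_distrib_right)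
    finally have s: "(\<Sum>l\<in>{1..m}. \<beta> l * ?v l p) = \<dots>" .
    have "x ?j p = (\<Sum>r\<in>{1..k}. if r = ?j then x r p else 0)" using j by simp
    also have "\<dots> = (\<Sum>r\<in>{1..k}. (if ?j = r then 1 else 0) * x r p)" by (intro sum.cong) auto
    finally show ?thesis unfolding z_def s d_def by (simp add: left_diff_distrib sum_subtractf)
  qed
  have db: "\<bar>d r - (if ?j = r then 1 else 0)\<bar> \<le> C2 * \<epsilon>" if r: "r \<in> {1..k}" for r
  proof -
    have "\<bar>d r - (if ?j = r then 1 else 0)\<bar> = \<bar>\<Sum>l\<in>{1..m}. \<beta> l * c l r\<bar>" by (simp add: d_def)
    also have "\<dots> \<le> (\<Sum>l\<in>{1..m}. C1 * \<epsilon> * (1 + C))"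
      by (rule order_trans[OF sum_abs sum_mono], unfold abs_mult, intro mult_mono)
         (use \<beta> c1[OF _ r] C1 \<epsilon> in auto)
    also have "\<dots> \<le> real k * (C1 * \<epsilon> * (1 + C))"
      using m C1 C \<epsilon> by (simp add: mult_right_mono)
    finally show ?thesis by (simp add: C2_def mult_ac)
  qed
  have zv: "ip N z (?v l) = 0" if l: "l \<in> {1..m}" for l
  proof -
    have "ip N z (?v l) = \<beta> l - (\<Sum>r\<in>{1..m}. \<beta> r * ip N (?v r) (?v l))"
      unfolding z_def by (simp add: ip_diff_left ip_sum_left ip_scale_left \<beta>_def)
    also have "(\<Sum>r\<in>{1..m}. \<beta> r * ip N (?v r) (?v l)) = (\<Sum>r\<in>{1..m}. if r = l then \<beta> l else 0)"
      using l by (intro sum.cong refl) (simp add: orthosysD[OF orth])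
    also have "\<dots> = \<beta> l" using l by simp
    finally show ?thesis by simp
  qed
  have zz: "ip N z z = ip N (x ?j) (x ?j) - (\<Sum>l\<in>{1..m}. (\<beta> l)\<^sup>2)"
  proof -
    have "ip N z z = ip N (x ?j) z - (\<Sum>l\<in>{1..m}. \<beta> l * ip N (?v l) z)"
      by (subst z_def) (simp add: ip_diff_left ip_sum_left ip_scale_left)
    also have "(\<Sum>l\<in>{1..m}. \<beta> l * ip N (?v l) z) = 0"
      using zv by (intro sum.neutral ballI) (metis ip_commute mult_zero_right)
    also have "ip N (x ?j) z = ip N z (x ?j)" by (rule ip_commute)
    also have "\<dots> = ip N (x ?j) (x ?j) - (\<Sum>l\<in>{1..m}. \<beta> l * ip N (?v l) (x ?j))"
      by (subst z_def) (simp add: ip_diff_left ip_sum_left ip_scale_left)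
    also have "(\<Sum>l\<in>{1..m}. \<beta> l * ip N (?v l) (x ?j)) = (\<Sum>l\<in>{1..m}. (\<beta> l)\<^sup>2)"
      by (intro sum.cong refl) (metis \<beta>_def ip_commute power2_eq_square)
    finally show ?thesis by simp
  qed
  have "\<bar>1 - ip N z z\<bar> \<le> C3 * \<epsilon>"
  proof -
    have "(\<Sum>l\<in>{1..m}. (\<beta> l)\<^sup>2) \<le> (\<Sum>l\<in>{1..m}. C1\<^sup>2 * \<epsilon>)"
    proof (rule sum_mono)
      fix l assume l: "l \<in> {1..m}"
      have "(\<beta> l)\<^sup>2 \<le> (C1 * \<epsilon>)\<^sup>2" using \<beta>[OF l] by (metis abs_ge_zero power2_abs power_mono)
      also have "\<dots> = C1\<^sup>2 * (\<epsilon> * \<epsilon>)" by (simp add: power2_eq_square mult_ac)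
      also have "\<dots> \<le> C1\<^sup>2 * \<epsilon>" using \<epsilon> mult_left_mono[OF \<epsilon>(2) \<epsilon>(1)] by (intro mult_left_mono) auto
      finally show "(\<beta> l)\<^sup>2 \<le> C1\<^sup>2 * \<epsilon>" .
    qed
    also have "\<dots> \<le> real k * (C1\<^sup>2 * \<epsilon>)" using m \<epsilon> by (simp add: mult_right_mono)
    finally have "(\<Sum>l\<in>{1..m}. (\<beta> l)\<^sup>2) \<le> real k * (C1\<^sup>2 * \<epsilon>)" .
    moreover have "(\<Sum>l\<in>{1..m}. (\<beta> l)\<^sup>2) \<ge> 0" by (simp add: sum_nonneg)
    ultimately show ?thesis using Gb[OF j j] unfolding zz C3_def by (simp add: algebra_simps)
  qed
  moreover have "C3 * \<epsilon> \<le> 1/2" using \<epsilon>(3) C3 by (simp add: field_simps)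
  ultimately have half: "1/2 \<le> ip N z z" by (simp add: abs_if split: if_splits)
  define s where "s = 1 / sqrt (ip N z z)"
  have s: "\<bar>s - 1\<bar> \<le> 2 * (C3 * \<epsilon>)" "0 < s" "s \<le> 2"
    using abs_inverse_sqrt_minus_1[OF half] \<open>\<bar>1 - ip N z z\<bar> \<le> C3 * \<epsilon>\<close> unfolding s_def by auto
  have vjs: "?v ?j = (\<lambda>p. s * z p)" unfolding vj s_def by simp
  have "ip N (?v ?j) (?v ?j) = 1"
  proof -
    have "s * s * ip N z z = 1" using half by (simp add: s_def)
    then show ?thesis unfolding vjs by (simp add: ip_scale_left ip_scale_right)
  qed
  moreover have "ip N (?v ?j) (?v l) = 0" if "l \<in> {1..m}" for l
    unfolding vjs using zv[OF that] by (simp add: ip_scale_left)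
  ultimately have nv: "ip N (?v ?j) (?v ?j) = 1" "\<And>l. l \<in> {1..m} \<Longrightarrow> ip N (?v ?j) (?v l) = 0"
    by blast+
  have "orthosys N {1..?j} ?v"
    unfolding orthosys_def
  proof (intro ballI)
    fix a b assume ab: "a \<in> {1..?j}" "b \<in> {1..?j}"
    then consider "a = ?j" "b = ?j" | "a = ?j" "b \<in> {1..m}" | "a \<in> {1..m}" "b = ?j" | "a \<in> {1..m}" "b \<in> {1..m}"
      by fastforce
    then show "ip N (?v a) (?v b) = (if a = b then 1 else 0)"
    proof cases
      case 3
      then show ?thesis using nv(2)[of a] ip_commute[of N "?v ?j" "?v a"] by auto
    next
      case 4
      then show ?thesis by (rule orthosysD[OF orth])
    qed (use nv in auto)
  qed
  moreover define c' where "c' = (\<lambda>l r. if l = ?j then s * d r else c l r)"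
  have "\<forall>l\<in>{1..?j}. (\<forall>p. ?v l p = (\<Sum>r\<in>{1..k}. c' l r * x r p)) \<and>
        (\<forall>r\<in>{1..k}. \<bar>c' l r - (if l = r then 1 else 0)\<bar> \<le> (C + 2 * C2 + 2 * C3) * \<epsilon>)"
  proof (intro ballI conjI allI)
    fix l p assume l: "l \<in> {1..?j}"
    show "?v l p = (\<Sum>r\<in>{1..k}. c' l r * x r p)"
    proof (cases "l = ?j")
      case True
      then show ?thesis using vjs zd by (simp add: c'_def sum_distrib_left mult_ac)
    next
      case False
      then show ?thesis using l cv[of l p] by (simp add: c'_def)
    qed
  next
    fix l r assume l: "l \<in> {1..?j}" and r: "r \<in> {1..k}"
    show "\<bar>c' l r - (if l = r then 1 else 0)\<bar> \<le> (C + 2 * C2 + 2 * C3) * \<epsilon>"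
    proof (cases "l = ?j")
      case True
      define \<delta> :: real where "\<delta> = (if ?j = r then 1 else 0)"
      have "\<bar>s * d r - \<delta>\<bar> = \<bar>s * (d r - \<delta>) + (s - 1) * \<delta>\<bar>" by (simp add: algebra_simps)
      also have "\<dots> \<le> s * \<bar>d r - \<delta>\<bar> + \<bar>s - 1\<bar> * \<delta>"
        using s by (intro order_trans[OF abs_triangle_ineq]) (simp add: abs_mult \<delta>_def)
      also have "\<dots> \<le> 2 * (C2 * \<epsilon>) + 2 * (C3 * \<epsilon>) * 1"
        using db[OF r] s C3 \<epsilon> by (intro add_mono mult_mono) (auto simp: \<delta>_def)
      also have "\<dots> \<le> (C + 2 * C2 + 2 * C3) * \<epsilon>" using C \<epsilon> by (simp add: algebra_simps)
      finally show ?thesis using True by (simp add: c'_def \<delta>_def)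
    next
      case False
      then have "\<bar>c l r - (if l = r then 1 else 0)\<bar> \<le> C * \<epsilon>" using l r by (intro cb) auto
      also have "\<dots> \<le> (C + 2 * C2 + 2 * C3) * \<epsilon>" using C2 C3 \<epsilon> by (intro mult_right_mono) auto
      finally show ?thesis using False by (simp add: c'_def)
    qed
  qed
  ultimately show ?thesis unfolding gs_close_def by blast
qed

text \<open>Induction on the number of processed vectors; the \<open>k\<close> steps enlarge the
  constant and shrink the threshold, both of which depend on \<open>k\<close> alone and not on the
  dimension \<open>N\<close>.\<close>

theorem gram_schmidt_near_orthonormal:
  "\<exists>C \<epsilon>0. C \<ge> 0 \<and> \<epsilon>0 > 0 \<and> (\<forall>N x \<epsilon>. 0 \<le> \<epsilon> \<longrightarrow> \<epsilon> \<le> \<epsilon>0 \<longrightarrow> near_orthonormal N k \<epsilon> x \<longrightarrow> gs_close N k (C * \<epsilon>) k x)"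
proof -
  have "\<exists>C \<epsilon>0. C \<ge> 0 \<and> \<epsilon>0 > 0 \<and> (\<forall>N x \<epsilon>. 0 \<le> \<epsilon> \<longrightarrow> \<epsilon> \<le> \<epsilon>0 \<longrightarrow> near_orthonormal N k \<epsilon> x \<longrightarrow> gs_close N k (C * \<epsilon>) m x)"
    if "m \<le> k" for m
    using that
  proof (induction m)
    case 0
    show ?case by (rule exI[of _ 0], rule exI[of _ 1]) (auto simp: gs_close_def orthosys_def)
  next
    case (Suc m)
    then obtain C \<epsilon>0 where C: "C \<ge> 0" "\<epsilon>0 > 0"
      and IH: "\<And>N x \<epsilon>. 0 \<le> \<epsilon> \<Longrightarrow> \<epsilon> \<le> \<epsilon>0 \<Longrightarrow> near_orthonormal N k \<epsilon> x \<Longrightarrow> gs_close N k (C * \<epsilon>) m x"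
      by auto
    define C1 where "C1 = 2 * C + real k * (1 + C)"
    define C2 where "C2 = real k * C1 * (1 + C)"
    define C3 where "C3 = 1 + real k * C1\<^sup>2"
    have C3: "C3 > 0" unfolding C3_def by (intro add_pos_nonneg) auto
    have pos: "C2 \<ge> 0" using C by (simp add: C2_def C1_def)
    show ?case
    proof (rule exI[of _ "C + 2 * C2 + 2 * C3"], rule exI[of _ "min \<epsilon>0 (min 1 (1 / (2 * C3)))"], intro conjI allI impI)
      fix N x \<epsilon> assume "0 \<le> \<epsilon>" "\<epsilon> \<le> min \<epsilon>0 (min 1 (1 / (2 * C3)))" "near_orthonormal N k \<epsilon> x"
      then show "gs_close N k ((C + 2 * C2 + 2 * C3) * \<epsilon>) (Suc m) x"
        using gram_schmidt_step[of N k \<epsilon> x C m] IH[of \<epsilon> N x] C Suc.prems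
        unfolding C1_def C2_def C3_def by auto
    qed (use C C3 pos in auto)
  qed
  from this[of k] show ?thesis by simp
qed

section \<open>Comparison with a Gaussian matrix\<close>

definition matgauss :: "nat \<Rightarrow> nat \<Rightarrow> (nat \<times> nat \<Rightarrow> real) measure" where
  "matgauss N k = gauss ({..<N} \<times> {1..k}) (\<lambda>_. 1)"

text \<open>The factor \<open>1 / sqrt N\<close> gives the columns mean squared norm 1, so that
  their Gram matrix concentrates at the identity.\<close>

definition gauss_column :: "nat \<Rightarrow> (nat \<times> nat \<Rightarrow> real) \<Rightarrow> nat \<Rightarrow> nat \<Rightarrow> real" where
  "gauss_column N w j p = w (p, j) / sqrt (real N)"

definition rotate_columns :: "nat \<Rightarrow> nat \<Rightarrow> (nat \<Rightarrow> nat \<Rightarrow> real) \<Rightarrow> (nat \<times> nat \<Rightarrow> real) \<Rightarrow> nat \<times> nat \<Rightarrow> real" where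
  "rotate_columns N k Q w = (\<lambda>(i,j)\<in>{..<N} \<times> {1..k}. ip N (Q i) (\<lambda>p. w (p, j)))"

lemma prob_space_matgauss: "prob_space (matgauss N k)"
  unfolding matgauss_def by (rule prob_space_gauss) simp

lemma sets_matgauss [measurable_cong, simp]: "sets (matgauss N k) = sets (leb ({..<N} \<times> {1..k}))"
  by (simp add: matgauss_def)

lemma space_matgauss: "space (matgauss N k) = (\<Pi>\<^sub>E i\<in>{..<N} \<times> {1..k}. UNIV)"
  by (simp add: matgauss_def)

lemma measurable_column:
  assumes "p < N" "j \<in> {1..k}"
  shows "(\<lambda>w. gauss_column N w j p) \<in> borel_measurable (leb ({..<N} \<times> {1..k}))"
proof -
  have [measurable]: "(\<lambda>w. w (p, j)) \<in> borel_measurable (leb ({..<N} \<times> {1..k}))"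
    by (rule measurable_leb_component) (use assms in auto)
  show ?thesis unfolding gauss_column_def by measurable
qed

lemma measurable_rotate_columns:
  "rotate_columns N k Q \<in> measurable (leb ({..<N} \<times> {1..k})) (leb ({..<N} \<times> {1..k}))"
proof -
  have "(\<lambda>w. ip N (Q i) (\<lambda>p. w (p, j))) \<in> borel_measurable (leb ({..<N} \<times> {1..k}))" if "j \<in> {1..k}" for i j
    unfolding ip_def using that
    by (intro borel_measurable_sum borel_measurable_times borel_measurable_const measurable_leb_component) auto
  then show ?thesis unfolding rotate_columns_def
    by (intro measurable_restrict) (auto simp: measurable_lborel1 split: prod.splits)
qed

lemma distr_rotate_columns:
  assumes Q: "orthosys N {..<N} Q"
  shows "distr (matgauss N k) (matgauss N k) (rotate_columns N k Q) = matgauss N k"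
  unfolding matgauss_def
proof (rule gauss_distr_quadratic_invariant)
  let ?I = "{..<N} \<times> {1..k}"
  show "rotate_columns N k Q \<in> measurable (leb ?I) (leb ?I)" by (rule measurable_rotate_columns)
  show "rotate_columns N k Q (\<lambda>i\<in>?I. x i - y i) i = rotate_columns N k Q x i - rotate_columns N k Q y i" if "i \<in> ?I" for x y i
    using that by (auto simp: rotate_columns_def ip_def algebra_simps sum_subtractf)
  show "\<exists>x\<in>space (leb ?I). rotate_columns N k Q x = y" if y: "y \<in> space (leb ?I)" for y
  proof (rule bexI[of _ "rotate_columns N k (\<lambda>i p. Q p i) y"])
    show "rotate_columns N k (\<lambda>i p. Q p i) y \<in> space (leb ?I)"
      using measurable_space[OF measurable_rotate_columns y] .
    show "rotate_columns N k Q (rotate_columns N k (\<lambda>i p. Q p i) y) = y"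
    proof
      fix x :: "nat \<times> nat"
      show "rotate_columns N k Q (rotate_columns N k (\<lambda>i p. Q p i) y) x = y x"
      proof (cases "x \<in> ?I")
        case False
        then show ?thesis using y by (cases x) (auto simp: rotate_columns_def space_PiM PiE_def extensional_def)
      next
        case True
        then obtain i j where ij: "x = (i,j)" "i < N" "j \<in> {1..k}" by auto
        then show ?thesis using orthosys_roundtrip[OF Q ij(2), of "\<lambda>p. y (p, j)"]
          by (simp add: rotate_columns_def ip_def)
      qed
    qed
  qed
  show "(\<Sum>i\<in>?I. (rotate_columns N k Q x i)\<^sup>2 / 1\<^sup>2) = (\<Sum>i\<in>?I. (x i)\<^sup>2 / 1\<^sup>2)" for x
  proof -
    have "(\<Sum>i\<in>?I. (rotate_columns N k Q x i)\<^sup>2 / 1\<^sup>2)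
        = (\<Sum>j\<in>{1..k}. \<Sum>i<N. ip N (Q i) (\<lambda>p. x (p, j)) * ip N (Q i) (\<lambda>p. x (p, j)))"
      by (subst sum.swap) (simp add: sum.cartesian_product rotate_columns_def split_beta power2_eq_square)
    also have "\<dots> = (\<Sum>j\<in>{1..k}. \<Sum>p<N. x (p, j) * x (p, j))"
      by (simp add: parseval[OF Q]) (simp add: ip_def)
    also have "\<dots> = (\<Sum>i\<in>?I. (x i)\<^sup>2 / 1\<^sup>2)"
      by (subst sum.swap) (simp add: sum.cartesian_product split_beta power2_eq_square)
    finally show ?thesis .
  qed
qed simp_all

lemma measurable_near_orthonormal:
  "Measurable.pred (leb ({..<N} \<times> {1..k})) (\<lambda>w. near_orthonormal N k \<epsilon> (gauss_column N w))"
proof -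
  have "(\<lambda>w. ip N (gauss_column N w j) (gauss_column N w l)) \<in> borel_measurable (leb ({..<N} \<times> {1..k}))"
    if "j \<in> {1..k}" "l \<in> {1..k}" for j l
    unfolding ip_def using that by (intro borel_measurable_sum borel_measurable_times measurable_column) auto
  then show ?thesis unfolding near_orthonormal_def pred_def
    by (intro sets.sets_Collect_finite_All borel_measurable_le borel_measurable_abs borel_measurable_diff
        borel_measurable_const) auto
qed

lemma column_rotate:
  assumes "j \<in> {1..k}" "i < N"
  shows "gauss_column N (rotate_columns N k Q w) j i = ip N (Q i) (gauss_column N w j)"
proof -
  have "gauss_column N w j = (\<lambda>p. 1 / sqrt (real N) * w (p, j))" by (simp add: gauss_column_def fun_eq_iff)
  then show ?thesis
    using assms by (simp only: ip_scale_right) (simp add: gauss_column_def rotate_columns_def)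
qed

lemma near_orthonormal_rotate:
  assumes Q: "orthosys N {..<N} Q"
  shows "near_orthonormal N k \<epsilon> (gauss_column N (rotate_columns N k Q w)) \<longleftrightarrow> near_orthonormal N k \<epsilon> (gauss_column N w)"
proof -
  have "ip N (gauss_column N (rotate_columns N k Q w) j) (gauss_column N (rotate_columns N k Q w) l) = ip N (gauss_column N w j) (gauss_column N w l)"
    if "j \<in> {1..k}" "l \<in> {1..k}" for j l
  proof -
    have "ip N (gauss_column N (rotate_columns N k Q w) j) (gauss_column N (rotate_columns N k Q w) l)
       = (\<Sum>i<N. ip N (Q i) (gauss_column N w j) * ip N (Q i) (gauss_column N w l))"
      unfolding ip_def[of N "gauss_column N (rotate_columns N k Q w) j"] using that by (simp add: column_rotate)
    then show ?thesis by (simp add: parseval[OF Q])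
  qed
  then show ?thesis by (simp add: near_orthonormal_def)
qed

lemma gram_schmidt_column_rotate:
  assumes Q: "orthosys N {..<N} Q" and j: "j \<in> {1..k}" and i: "i < N"
  shows "gram_schmidt N (gauss_column N (rotate_columns N k Q w)) j i = ip N (Q i) (gram_schmidt N (gauss_column N w) j)"
proof -
  have "gram_schmidt N (gauss_column N (rotate_columns N k Q w)) j i
      = gram_schmidt N (\<lambda>j i. ip N (Q i) (gauss_column N w j)) j i"
    by (rule gram_schmidt_cong[of k N]) (use j i in \<open>auto simp: column_rotate\<close>)
  then show ?thesis by (simp add: gram_schmidt_rotate[OF Q])
qed

text \<open>The restriction to near-orthonormal columns ensures that Gram--Schmidt returns an
  orthonormal system, the only kind of system for which the law of \<open>quad_event\<close> is
  known to be constant.\<close>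

definition gs_event :: "nat \<Rightarrow> nat \<Rightarrow> real \<Rightarrow> (nat \<Rightarrow> real) \<Rightarrow> real set \<Rightarrow> (nat \<times> nat \<Rightarrow> real) set" where
  "gs_event N k \<epsilon> a S = {w \<in> space (matgauss N k). near_orthonormal N k \<epsilon> (gauss_column N w) \<and>
      (\<forall>i<N. (\<Sum>j\<in>{1..k}. a j * (gram_schmidt N (gauss_column N w) j i)\<^sup>2) \<in> S)}"

lemma measurable_gram_schmidt_column:
  "j \<in> {1..k} \<Longrightarrow> p < N \<Longrightarrow> (\<lambda>w. gram_schmidt N (gauss_column N w) j p) \<in> borel_measurable (leb ({..<N} \<times> {1..k}))"
  by (rule gram_schmidt_measurable[of k]) (rule measurable_column; assumption)+

lemma sets_Collect_all_in:
  assumes "\<And>i. i < (N::nat) \<Longrightarrow> F i \<in> borel_measurable M" and S: "S \<in> sets borel"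
  shows "{x \<in> space M. \<forall>i<N. F i x \<in> S} \<in> sets M"
proof -
  have "{x \<in> space M. F i x \<in> S} \<in> sets M" if "i < N" for i
  proof -
    have "{x \<in> space M. F i x \<in> S} = F i -` S \<inter> space M" by blast
    then show ?thesis using measurable_sets[OF assms(1)[OF that] S] by simp
  qed
  then have "{x \<in> space M. \<forall>i\<in>{..<N}. F i x \<in> S} \<in> sets M"
    by (intro sets.sets_Collect_finite_All) auto
  then show ?thesis by (simp only: Ball_def lessThan_iff)
qed

lemma sets_near: "{w \<in> space (matgauss N k). near_orthonormal N k \<epsilon> (gauss_column N w)} \<in> sets (matgauss N k)"
  using measurable_near_orthonormal[of N k \<epsilon>] unfolding pred_def
  by (simp add: space_matgauss space_PiM)

lemma sets_gs_event:
  assumes S: "S \<in> sets borel"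
  shows "gs_event N k \<epsilon> a S \<in> sets (matgauss N k)"
proof -
  have "{w \<in> space (matgauss N k). \<forall>i<N. (\<Sum>j\<in>{1..k}. a j * (gram_schmidt N (gauss_column N w) j i)\<^sup>2) \<in> S} \<in> sets (matgauss N k)"
  proof (rule sets_Collect_all_in[OF _ S])
    show "(\<lambda>w. \<Sum>j\<in>{1..k}. a j * (gram_schmidt N (gauss_column N w) j i)\<^sup>2) \<in> borel_measurable (matgauss N k)" if "i < N" for i
      unfolding measurable_cong_sets[OF sets_matgauss refl] using that
      by (intro borel_measurable_sum borel_measurable_times borel_measurable_const borel_measurable_power
          measurable_gram_schmidt_column) auto
  qed
  from sets.Int[OF sets_near[of N k \<epsilon>] this]
  show ?thesis unfolding gs_event_def by (rule back_subst[of "\<lambda>A. A \<in> sets (matgauss N k)"]) blast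
qed

text \<open>
  Both sides are the probability of one event for an independent pair of a Gaussian matrix and
  a GOE matrix: conditionally on the first, the law of the GOE eigenbasis may be tested on the
  orthonormalised columns; conditionally on the second, the Gaussian matrix may be written in
  the eigenbasis.
\<close>

lemma (in eigenbasis_selection) prob_quad_event_gram_schmidt:
  assumes e: "orthosys N {1..k} e" and S: "S \<in> sets borel"
    and near: "\<And>x. near_orthonormal N k \<epsilon> x \<Longrightarrow> orthosys N {1..k} (gram_schmidt N x)"
  shows "measure (matgauss N k) {w \<in> space (matgauss N k). near_orthonormal N k \<epsilon> (gauss_column N w)}
           * measure (GOE N) (quad_event S {1..k} a e)
       = measure (matgauss N k) (gs_event N k \<epsilon> a S)"
proof -
  let ?M = "matgauss N k" and ?v = "\<lambda>w. gram_schmidt N (gauss_column N w)"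
  let ?E = "{w \<in> space ?M. near_orthonormal N k \<epsilon> (gauss_column N w)}"
  interpret M: prob_space ?M by (rule prob_space_matgauss)
  interpret G: prob_space "GOE N" by (rule prob_space_GOE)
  interpret MG: pair_sigma_finite ?M "GOE N" by standard
  define H where "H = {z \<in> space (?M \<Otimes>\<^sub>M GOE N). near_orthonormal N k \<epsilon> (gauss_column N (fst z)) \<and>
      (\<forall>i<N. (\<Sum>j\<in>{1..k}. a j * (ip N (?v (fst z) j) (u (snd z) i))\<^sup>2) \<in> S)}"
  have H: "H \<in> sets (?M \<Otimes>\<^sub>M GOE N)"
  proof -
    have 1: "{z \<in> space (?M \<Otimes>\<^sub>M GOE N). \<forall>i<N. (\<Sum>j\<in>{1..k}. a j * (ip N (?v (fst z) j) (u (snd z) i))\<^sup>2) \<in> S}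
        \<in> sets (?M \<Otimes>\<^sub>M GOE N)"
    proof (rule sets_Collect_all_in[OF _ S])
      fix i assume i: "i < N"
      have v: "(\<lambda>z. ?v (fst z) j p) \<in> borel_measurable (?M \<Otimes>\<^sub>M GOE N)" if "j \<in> {1..k}" "p < N" for j p
        using measurable_gram_schmidt_column[OF that]
        by (intro measurable_compose[OF measurable_fst]) (simp only: measurable_cong_sets[OF sets_matgauss refl])
      have uu: "(\<lambda>z. u (snd z) i p) \<in> borel_measurable (?M \<Otimes>\<^sub>M GOE N)" if "p < N" for p
        by (intro measurable_compose[OF measurable_snd] meas i that)
      show "(\<lambda>z. \<Sum>j\<in>{1..k}. a j * (ip N (?v (fst z) j) (u (snd z) i))\<^sup>2) \<in> borel_measurable (?M \<Otimes>\<^sub>M GOE N)"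
        unfolding ip_def
        by (intro borel_measurable_sum borel_measurable_times borel_measurable_const borel_measurable_power v uu) auto
    qed
    have "fst -` ?E \<inter> space (?M \<Otimes>\<^sub>M GOE N) \<in> sets (?M \<Otimes>\<^sub>M GOE N)"
      by (rule measurable_sets[OF measurable_fst sets_near])
    from sets.Int[OF this 1] show ?thesis unfolding H_def
      by (rule back_subst[of "\<lambda>A. A \<in> sets (?M \<Otimes>\<^sub>M GOE N)"]) (auto simp: space_pair_measure)
  qed
  have "emeasure (?M \<Otimes>\<^sub>M GOE N) H = (\<integral>\<^sup>+w. emeasure (GOE N) (Pair w -` H) \<partial>?M)"
    by (rule G.emeasure_pair_measure_alt[OF H])
  also have "\<dots> = (\<integral>\<^sup>+w. emeasure (GOE N) (quad_event S {1..k} a e) * indicator ?E w \<partial>?M)"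
  proof (rule nn_integral_cong)
    fix w assume w: "w \<in> space ?M"
    show "emeasure (GOE N) (Pair w -` H) = emeasure (GOE N) (quad_event S {1..k} a e) * indicator ?E w"
    proof (cases "near_orthonormal N k \<epsilon> (gauss_column N w)")
      case True
      then have "Pair w -` H = quad_event S {1..k} a (?v w)"
        using w by (auto simp: H_def quad_event_def space_pair_measure)
      moreover have "measure (GOE N) (quad_event S {1..k} a (?v w)) = measure (GOE N) (quad_event S {1..k} a e)"
        by (rule prob_quad_event_invariant[OF _ near[OF True] e S]) simp
      ultimately show ?thesis using True w by (simp add: G.emeasure_eq_measure)
    next
      case False
      then have "Pair w -` H = {}" by (auto simp: H_def)
      then show ?thesis using False by simp
    qed
  qed
  also have "\<dots> = emeasure (GOE N) (quad_event S {1..k} a e) * emeasure ?M ?E"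
    by (rule nn_integral_cmult_indicator[OF sets_near])
  finally have A: "emeasure (?M \<Otimes>\<^sub>M GOE N) H = emeasure (GOE N) (quad_event S {1..k} a e) * emeasure ?M ?E" .
  have "emeasure (?M \<Otimes>\<^sub>M GOE N) H = (\<integral>\<^sup>+g. emeasure ?M ((\<lambda>w. (w, g)) -` H) \<partial>GOE N)"
    by (rule MG.emeasure_pair_measure_alt2[OF H])
  also have "\<dots> = (\<integral>\<^sup>+g. emeasure ?M (gs_event N k \<epsilon> a S) \<partial>GOE N)"
  proof (rule nn_integral_cong)
    fix g assume g: "g \<in> space (GOE N)"
    note Q = ortho[OF g]
    have m: "rotate_columns N k (u g) \<in> measurable ?M ?M"
      using measurable_rotate_columns by (simp cong: measurable_cong_sets)
    have "emeasure ?M (gs_event N k \<epsilon> a S) = emeasure (distr ?M ?M (rotate_columns N k (u g))) (gs_event N k \<epsilon> a S)"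
      unfolding distr_rotate_columns[OF Q] ..
    also have "\<dots> = emeasure ?M (rotate_columns N k (u g) -` gs_event N k \<epsilon> a S \<inter> space ?M)"
      by (rule emeasure_distr[OF m sets_gs_event[OF S]])
    \<comment> \<open>By equivariance, coordinate \<open>i\<close> of the orthonormalised rotated
      columns is the inner product of the orthonormalised columns with \<open>u g i\<close>;
      near-orthonormality is unaffected by the rotation.\<close>
    also have "rotate_columns N k (u g) -` gs_event N k \<epsilon> a S \<inter> space ?M = (\<lambda>w. (w, g)) -` H"
    proof -
      have s: "(\<Sum>j\<in>{1..k}. a j * (?v (rotate_columns N k (u g) w) j i)\<^sup>2)
          = (\<Sum>j\<in>{1..k}. a j * (ip N (?v w j) (u g i))\<^sup>2)" if "i < N" for i w
        using gram_schmidt_column_rotate[OF Q _ that] by (intro sum.cong refl) (metis ip_commute)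
      have "rotate_columns N k (u g) w \<in> space ?M" for w
        by (simp add: space_matgauss rotate_columns_def)
      then show ?thesis using g near_orthonormal_rotate[OF Q]
        by (auto simp: gs_event_def H_def space_pair_measure s simp del: One_nat_def)
    qed
    finally show "emeasure ?M ((\<lambda>w. (w, g)) -` H) = emeasure ?M (gs_event N k \<epsilon> a S)" by (rule sym)
  qed
  also have "\<dots> = emeasure ?M (gs_event N k \<epsilon> a S)" by (simp add: G.emeasure_space_1)
  finally have "emeasure ?M (gs_event N k \<epsilon> a S) = emeasure (GOE N) (quad_event S {1..k} a e) * emeasure ?M ?E"
    using A by simp
  then have "ennreal (measure ?M (gs_event N k \<epsilon> a S))
     = ennreal (measure (GOE N) (quad_event S {1..k} a e) * measure ?M ?E)"
    by (simp add: M.emeasure_eq_measure G.emeasure_eq_measure ennreal_mult)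
  then show ?thesis by (simp add: mult.commute)
qed

section \<open>Independence of the rows\<close>

definition gauss_row :: "nat \<Rightarrow> nat \<Rightarrow> (nat \<times> nat \<Rightarrow> real) \<Rightarrow> nat \<Rightarrow> real" where
  "gauss_row k p w = (\<lambda>j\<in>{1..k}. w (p, j))"

lemma matgauss_eq_sgauss: "matgauss N k = sgauss ({..<N} \<times> {1..k})"
  by (simp add: matgauss_def sgauss_def)

lemma measurable_gauss_row:
  assumes "p < N"
  shows "gauss_row k p \<in> measurable (matgauss N k) (sgauss {1..k})"
proof -
  have "(\<lambda>w. \<lambda>j\<in>{1..k}. w (p, j)) \<in> measurable (leb ({..<N} \<times> {1..k})) (leb {1..k})"
    using assms by (intro measurable_restrict) (simp add: measurable_lborel1 measurable_leb_component)
  then show ?thesis by (simp add: gauss_row_def[abs_def] cong: measurable_cong_sets)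
qed

lemma distr_gauss_row:
  assumes "p < N"
  shows "distr (matgauss N k) (sgauss {1..k}) (gauss_row k p) = sgauss {1..k}"
proof -
  let ?D = "density lborel (\<lambda>x. ennreal (normal_density 0 1 x))"
  have "distr (PiM ({..<N} \<times> {1..k}) (\<lambda>_. ?D)) (PiM {1..k} (\<lambda>_. ?D)) (\<lambda>w. \<lambda>j\<in>{1..k}. w (p, j)) = PiM {1..k} (\<lambda>_. ?D)"
    by (rule distr_PiM_reindex[where f="\<lambda>j. (p, j)" and M="\<lambda>_. ?D"])
       (use assms in \<open>auto intro!: inj_onI prob_space_normal_density\<close>)
  then show ?thesis by (simp add: matgauss_def sgauss_def gauss_def gauss_row_def[abs_def])
qed

lemma prob_gauss_row:
  assumes "p < N" "A \<in> sets (leb {1..k})"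
  shows "gauss_row k p -` A \<inter> space (matgauss N k) \<in> sets (matgauss N k)"
    "measure (matgauss N k) (gauss_row k p -` A \<inter> space (matgauss N k)) = measure (sgauss {1..k}) A"
proof -
  have A: "A \<in> sets (sgauss {1..k})" using assms by (simp only: sets_sgauss)
  show "gauss_row k p -` A \<inter> space (matgauss N k) \<in> sets (matgauss N k)"
    by (rule measurable_sets[OF measurable_gauss_row[OF assms(1)] A])
  show "measure (matgauss N k) (gauss_row k p -` A \<inter> space (matgauss N k)) = measure (sgauss {1..k}) A"
    by (rule measure_distr[OF measurable_gauss_row[OF assms(1)] A, unfolded distr_gauss_row[OF assms(1)], symmetric])
qed

lemma indep_vars_components:
  assumes "I \<noteq> {}"
  shows "prob_space.indep_vars (sgauss I) (\<lambda>_. lborel) (\<lambda>i w. w i) I"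
proof -
  interpret prob_space "sgauss I" by (rule prob_space_sgauss)
  let ?D = "density lborel (\<lambda>x. ennreal (normal_density 0 1 x))"
  have m: "(\<lambda>w. w i) \<in> measurable (sgauss I) lborel" if "i \<in> I" for i
    using measurable_leb_component[OF that] by (simp add: measurable_sgauss_iff measurable_lborel1)
  have c: "distr (sgauss I) lborel (\<lambda>w. w i) = ?D" if "i \<in> I" for i
  proof -
    have "distr (PiM I (\<lambda>_. ?D)) ?D (\<lambda>w. w i) = ?D"
      by (rule distr_PiM_component) (use that in \<open>auto intro!: prob_space_normal_density\<close>)
    moreover have "distr (sgauss I) lborel (\<lambda>w. w i) = distr (PiM I (\<lambda>_. ?D)) ?D (\<lambda>w. w i)"
      unfolding sgauss_def gauss_def by (rule distr_cong) auto
    ultimately show ?thesis by simp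
  qed
  show ?thesis
  proof (rule iffD2[OF indep_vars_iff_distr_eq_PiM'[OF assms m]])
    have "distr (sgauss I) (leb I) (\<lambda>x. \<lambda>i\<in>I. x i) = distr (sgauss I) (sgauss I) (\<lambda>x. x)"
      by (rule distr_cong) (auto simp: space_sgauss PiE_def extensional_restrict)
    also have "\<dots> = PiM I (\<lambda>i. ?D)" by (simp add: distr_id[unfolded id_def]) (simp add: sgauss_def gauss_def)
    also have "\<dots> = PiM I (\<lambda>i. distr (sgauss I) lborel (\<lambda>w. w i))"
      by (intro PiM_cong refl) (simp add: c)
    finally show "distr (sgauss I) (leb I) (\<lambda>x. \<lambda>i\<in>I. x i) = \<dots>" .
  qed
qed

lemma indep_vars_rows:
  assumes "N > 0" "k > 0"
  shows "prob_space.indep_vars (matgauss N k) (\<lambda>_. leb {1..k}) (gauss_row k) {..<N}"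
proof -
  interpret prob_space "matgauss N k" by (rule prob_space_matgauss)
  let ?I = "{..<N} \<times> {1..k}"
  have "indep_vars (\<lambda>_. lborel) (\<lambda>i w. w i) ?I"
    unfolding matgauss_eq_sgauss by (rule indep_vars_components) (use assms in auto)
  then have "indep_vars (\<lambda>p. PiM ({p} \<times> {1..k}) (\<lambda>_. lborel)) (\<lambda>p w. restrict (\<lambda>i. w i) ({p} \<times> {1..k})) {..<N}"
    by (rule indep_vars_restrict) (auto simp: disjoint_family_on_def)
  then have "indep_vars (\<lambda>_. leb {1..k}) (\<lambda>p w. (\<lambda>y. \<lambda>j\<in>{1..k}. y (p, j)) (restrict (\<lambda>i. w i) ({p} \<times> {1..k}))) {..<N}"
  proof (rule indep_vars_compose2)
    show "(\<lambda>y. \<lambda>j\<in>{1..k}. y (p, j)) \<in> measurable (leb ({p} \<times> {1..k})) (leb {1..k})" for p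
      by (intro measurable_restrict) (simp add: measurable_lborel1 measurable_leb_component)
  qed
  also have "indep_vars (\<lambda>_. leb {1..k}) (\<lambda>p w. (\<lambda>y. \<lambda>j\<in>{1..k}. y (p, j)) (restrict (\<lambda>i. w i) ({p} \<times> {1..k}))) {..<N}
     \<longleftrightarrow> indep_vars (\<lambda>_. leb {1..k}) (gauss_row k) {..<N}"
    by (rule indep_vars_cong) (auto simp: gauss_row_def fun_eq_iff)
  finally show ?thesis .
qed

lemma prob_all_rows:
  assumes "N > 0" "k > 0" and F: "F \<in> borel_measurable (leb {1..k})" and S: "S \<in> sets borel"
  shows "measure (matgauss N k) {w \<in> space (matgauss N k). \<forall>p<N. F (gauss_row k p w) \<in> S}
      = measure (sgauss {1..k}) {x \<in> space (sgauss {1..k}). F x \<in> S} ^ N"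
proof -
  interpret prob_space "matgauss N k" by (rule prob_space_matgauss)
  let ?A = "{x \<in> space (sgauss {1..k}). F x \<in> S}"
  have eqA: "?A = F -` S \<inter> space (leb {1..k})" by (auto simp: space_sgauss space_PiM)
  have A: "?A \<in> sets (leb {1..k})" unfolding eqA by (rule measurable_sets[OF F S])
  have "prob (\<Inter>p\<in>{..<N}. gauss_row k p -` ?A \<inter> space (matgauss N k)) = (\<Prod>p<N. prob (gauss_row k p -` ?A \<inter> space (matgauss N k)))"
    by (rule indep_varsD_finite[OF indep_vars_rows[OF assms(1,2)]]) (use assms A in auto)
  also have "\<dots> = (\<Prod>p<N. measure (sgauss {1..k}) ?A)"
  proof (rule prod.cong[OF refl])
    fix p assume "p \<in> {..<N}"
    then have p: "p < N" by simp
    show "prob (gauss_row k p -` ?A \<inter> space (matgauss N k)) = measure (sgauss {1..k}) ?A"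
      by (rule prob_gauss_row(2)[OF p A])
  qed
  also have "(\<Inter>p\<in>{..<N}. gauss_row k p -` ?A \<inter> space (matgauss N k)) = {w \<in> space (matgauss N k). \<forall>p<N. F (gauss_row k p w) \<in> S}"
  proof -
    have "gauss_row k p w \<in> space (sgauss {1..k})" for p w by (simp add: gauss_row_def space_sgauss)
    moreover have "{..<N} \<noteq> {}" using \<open>N > 0\<close> by auto
    ultimately show ?thesis by auto
  qed
  finally show ?thesis by simp
qed

lemma prob_ex_row_le:
  assumes F: "F \<in> borel_measurable (leb {1..k})" and S: "S \<in> sets borel"
  shows "measure (matgauss N k) {w \<in> space (matgauss N k). \<exists>p<N. F (gauss_row k p w) \<in> S}
      \<le> real N * measure (sgauss {1..k}) {x \<in> space (sgauss {1..k}). F x \<in> S}"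
proof -
  interpret prob_space "matgauss N k" by (rule prob_space_matgauss)
  let ?A = "{x \<in> space (sgauss {1..k}). F x \<in> S}"
  have eqA: "?A = F -` S \<inter> space (leb {1..k})" by (auto simp: space_sgauss space_PiM)
  have A: "?A \<in> sets (leb {1..k})" unfolding eqA by (rule measurable_sets[OF F S])
  have "{w \<in> space (matgauss N k). \<exists>p<N. F (gauss_row k p w) \<in> S} = (\<Union>p<N. gauss_row k p -` ?A \<inter> space (matgauss N k))"
    by (auto simp: gauss_row_def space_sgauss)
  also have "prob \<dots> \<le> (\<Sum>p<N. prob (gauss_row k p -` ?A \<inter> space (matgauss N k)))"
    by (intro finite_measure_subadditive_finite) (use prob_gauss_row(1)[OF _ A] in blast)+
  also have "\<dots> = (\<Sum>p<N. measure (sgauss {1..k}) ?A)"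
  proof (rule sum.cong[OF refl])
    fix p assume "p \<in> {..<N}"
    then have p: "p < N" by simp
    show "prob (gauss_row k p -` ?A \<inter> space (matgauss N k)) = measure (sgauss {1..k}) ?A"
      by (rule prob_gauss_row(2)[OF p A])
  qed
  finally show ?thesis by simp
qed

text \<open>Independence and centring make all cross terms vanish. The application is to entries of
  the Gram matrix, which are sums over rows.\<close>

lemma sum_rows_second_moment:
  assumes "N > 0" "k > 0" and F: "F \<in> borel_measurable (leb {1..k})"
    and i2: "integrable (sgauss {1..k}) (\<lambda>x. (F x)\<^sup>2)" and 0: "(\<integral>x. F x \<partial>sgauss {1..k}) = 0"
  shows "integrable (matgauss N k) (\<lambda>w. (\<Sum>p<N. F (gauss_row k p w))\<^sup>2)"
    and "(\<integral>w. (\<Sum>p<N. F (gauss_row k p w))\<^sup>2 \<partial>matgauss N k) = real N * (\<integral>x. (F x)\<^sup>2 \<partial>sgauss {1..k})"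
proof -
  interpret M: prob_space "matgauss N k" by (rule prob_space_matgauss)
  interpret R: prob_space "sgauss {1..k}" by (rule prob_space_sgauss)
  define Z where "Z p w = F (gauss_row k p w)" for p w
  have F': "F \<in> borel_measurable (sgauss {1..k})" using F by (simp add: measurable_sgauss_iff)
  have i1: "integrable (sgauss {1..k}) F"
    by (rule R.square_integrable_imp_integrable[OF F' i2])
  have tr: "integrable (matgauss N k) (\<lambda>w. G (gauss_row k p w))" "(\<integral>w. G (gauss_row k p w) \<partial>matgauss N k) = (\<integral>x. G x \<partial>sgauss {1..k})"
    if "p < N" "integrable (sgauss {1..k}) G" for p and G :: "_ \<Rightarrow> real"
  proof -
    have G: "G \<in> borel_measurable (sgauss {1..k})" using that(2) by simp
    show "integrable (matgauss N k) (\<lambda>w. G (gauss_row k p w))"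
      using that(2) integrable_distr_eq[OF measurable_gauss_row[OF that(1)] G, unfolded distr_gauss_row[OF that(1)]] by blast
    show "(\<integral>w. G (gauss_row k p w) \<partial>matgauss N k) = (\<integral>x. G x \<partial>sgauss {1..k})"
      by (rule integral_distr[OF measurable_gauss_row[OF that(1)] G, unfolded distr_gauss_row[OF that(1)], symmetric])
  qed
  have ind: "M.indep_vars (\<lambda>_. borel) Z {..<N}"
    unfolding Z_def by (rule M.indep_vars_compose2[OF indep_vars_rows[OF assms(1,2)]]) (rule F)
  have ZZ: "integrable (matgauss N k) (\<lambda>w. Z p w * Z q w)"
    "(\<integral>w. Z p w * Z q w \<partial>matgauss N k) = (if p = q then (\<integral>x. (F x)\<^sup>2 \<partial>sgauss {1..k}) else 0)"
    if "p < N" "q < N" for p q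
  proof -
    have "integrable (matgauss N k) (\<lambda>w. Z p w * Z q w) \<and>
      (\<integral>w. Z p w * Z q w \<partial>matgauss N k) = (if p = q then (\<integral>x. (F x)\<^sup>2 \<partial>sgauss {1..k}) else 0)"
    proof (cases "p = q")
      case True
      then show ?thesis using tr[OF that(1) i2] by (simp add: Z_def power2_eq_square)
    next
      case False
      have ind2: "M.indep_vars (\<lambda>_. borel) Z {p, q}"
        by (rule M.indep_vars_subset[OF ind]) (use that in auto)
      have int: "integrable (matgauss N k) (Z i)" if "i \<in> {p, q}" for i
        unfolding Z_def using tr(1)[OF _ i1] that \<open>p < N\<close> \<open>q < N\<close> by auto
      have "(\<integral>w. Z p w \<partial>matgauss N k) = 0" unfolding Z_def using tr(2)[OF that(1) i1] 0 by simp
      then show ?thesis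
        using M.indep_vars_lebesgue_integral[OF _ ind2 int] M.indep_vars_integrable[OF _ ind2 int] False
        by simp
    qed
    then show "integrable (matgauss N k) (\<lambda>w. Z p w * Z q w)"
      "(\<integral>w. Z p w * Z q w \<partial>matgauss N k) = (if p = q then (\<integral>x. (F x)\<^sup>2 \<partial>sgauss {1..k}) else 0)" by blast+
  qed
  have sq: "(\<Sum>p<N. F (gauss_row k p w))\<^sup>2 = (\<Sum>p<N. \<Sum>q<N. Z p w * Z q w)" for w
    by (simp add: Z_def power2_eq_square sum_product)
  let ?V = "\<integral>x. (F x)\<^sup>2 \<partial>sgauss {1..k}"
  have "has_bochner_integral (matgauss N k) (\<lambda>w. \<Sum>p<N. \<Sum>q<N. Z p w * Z q w) (\<Sum>p<N. \<Sum>q<N. if p = q then ?V else 0)"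
    by (intro has_bochner_integral_sum) (simp add: has_bochner_integral_iff ZZ)
  also have "(\<Sum>p<N. \<Sum>q<N. if p = q then ?V else 0) = real N * ?V" by simp
  finally show "integrable (matgauss N k) (\<lambda>w. (\<Sum>p<N. F (gauss_row k p w))\<^sup>2)"
    "(\<integral>w. (\<Sum>p<N. F (gauss_row k p w))\<^sup>2 \<partial>matgauss N k) = real N * ?V"
    unfolding sq by (auto simp: has_bochner_integral_iff)
qed

section \<open>Concentration of the Gram matrix and its effect on the quadratic forms\<close>

lemma std_normal_moments:
  "integrable (density lborel (\<lambda>x. ennreal (normal_density 0 1 x))) (\<lambda>x. x ^ n)"
  "(\<integral>x. x \<partial>density lborel (\<lambda>x. ennreal (normal_density 0 1 x))) = 0"
  "(\<integral>x. x\<^sup>2 \<partial>density lborel (\<lambda>x. ennreal (normal_density 0 1 x))) = 1"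
  "(\<integral>x. x ^ 4 \<partial>density lborel (\<lambda>x. ennreal (normal_density 0 1 x))) = 3"
proof -
  show "integrable (density lborel (\<lambda>x. ennreal (normal_density 0 1 x))) (\<lambda>x. x ^ n)"
    using integrable_std_normal_moment[of n] by (subst integrable_density) auto
  show "(\<integral>x. x \<partial>density lborel (\<lambda>x. ennreal (normal_density 0 1 x))) = 0"
    using integral_std_normal_moment_odd[of 0] by (subst integral_density) auto
  show "(\<integral>x. x\<^sup>2 \<partial>density lborel (\<lambda>x. ennreal (normal_density 0 1 x))) = 1"
    using integral_std_normal_moment_even[of 1] by (subst integral_density) auto
  show "(\<integral>x. x ^ 4 \<partial>density lborel (\<lambda>x. ennreal (normal_density 0 1 x))) = 3"
    using integral_std_normal_moment_even[of 2] by (subst integral_density) (auto simp: fact_numeral)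
qed

lemma sgauss_monomial:
  assumes "finite I"
  shows "integrable (sgauss I) (\<lambda>x. \<Prod>i\<in>I. x i ^ n i)"
    "(\<integral>x. (\<Prod>i\<in>I. x i ^ n i) \<partial>sgauss I)
       = (\<Prod>i\<in>I. \<integral>x. x ^ n i \<partial>density lborel (\<lambda>x. ennreal (normal_density 0 1 x)))"
proof -
  interpret product_prob_space "\<lambda>_. density lborel (\<lambda>x. ennreal (normal_density 0 1 x))"
    by (rule product_prob_spaceI) (auto intro!: prob_space_normal_density)
  interpret product_sigma_finite "\<lambda>_. density lborel (\<lambda>x. ennreal (normal_density 0 1 x))" ..
  show "integrable (sgauss I) (\<lambda>x. \<Prod>i\<in>I. x i ^ n i)"
    unfolding sgauss_def gauss_def by (rule product_integrable_prod[OF assms std_normal_moments(1)])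
  show "(\<integral>x. (\<Prod>i\<in>I. x i ^ n i) \<partial>sgauss I)
       = (\<Prod>i\<in>I. \<integral>x. x ^ n i \<partial>density lborel (\<lambda>x. ennreal (normal_density 0 1 x)))"
    unfolding sgauss_def gauss_def by (rule product_integral_prod[OF assms std_normal_moments(1)])
qed

text \<open>The bound 2 is attained on the diagonal: a standard normal has fourth moment 3, so its
  square has variance 2. Off the diagonal the second moment is 1.\<close>

lemma sgauss_pair_moments:
  assumes jl: "j \<in> {1..k}" "l \<in> {1..k}"
  defines "F \<equiv> (\<lambda>x :: nat \<Rightarrow> real. x j * x l - (if j = l then 1 else 0))"
  shows "integrable (sgauss {1..k}) (\<lambda>x. (F x)\<^sup>2)" "(\<integral>x. F x \<partial>sgauss {1..k}) = 0"
    "(\<integral>x. (F x)\<^sup>2 \<partial>sgauss {1..k}) \<le> 2"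
proof -
  interpret R: prob_space "sgauss {1..k}" by (rule prob_space_sgauss)
  let ?D = "density lborel (\<lambda>x. ennreal (normal_density 0 1 x))"
  interpret D: prob_space ?D by (rule prob_space_normal_density) simp
  \<comment> \<open>The product \<open>x j * x l\<close> as a monomial: \<open>n i\<close> counts
    how often \<open>i\<close> occurs among \<open>j\<close> and \<open>l\<close>, so the exponent
    is 2 when they coincide.\<close>
  define n where "n i = (if i = j then 1 else 0) + (if i = l then 1 else (0::nat))" for i
  have split: "(\<Prod>i\<in>{1..k}. y i ^ (if i = j then c else 0)) = y j ^ c" if "j \<in> {1..k}" for y :: "nat \<Rightarrow> real" and c j
  proof -
    have "(\<Prod>i\<in>{1..k}. y i ^ (if i = j then c else 0)) = (\<Prod>i\<in>{1..k}. if i = j then y i ^ c else 1)"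
      by (intro prod.cong) auto
    then show ?thesis using that by simp
  qed
  have m1: "(\<Prod>i\<in>{1..k}. x i ^ n i) = x j * x l" for x :: "nat \<Rightarrow> real"
    unfolding n_def power_add prod.distrib using split[OF jl(1), of x 1] split[OF jl(2), of x 1] by simp
  have m2: "(\<Prod>i\<in>{1..k}. x i ^ (2 * n i)) = (x j * x l)\<^sup>2" for x :: "nat \<Rightarrow> real"
    unfolding m1[symmetric] prod_power_distrib by (simp add: power_mult[symmetric] mult.commute)
  have int1: "integrable (sgauss {1..k}) (\<lambda>x. x j * x l)"
    using sgauss_monomial(1)[of "{1..k}" n] by (simp only: m1) simp
  have int2: "integrable (sgauss {1..k}) (\<lambda>x. (x j * x l)\<^sup>2)"
    using sgauss_monomial(1)[of "{1..k}" "\<lambda>i. 2 * n i"] by (simp only: m2) simp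
  define \<mu> where "\<mu> c = (\<integral>x. x ^ c \<partial>?D)" for c
  have \<mu>: "\<mu> 0 = 1" "\<mu> 1 = 0" "\<mu> 2 = 1" "\<mu> 4 = 3"
    using std_normal_moments D.prob_space by (auto simp: \<mu>_def)
  have E: "(\<Prod>i\<in>{1..k}. \<mu> (c * n i)) = (if j = l then \<mu> (2 * c) else \<mu> c * \<mu> c)" for c
  proof -
    have "(\<Prod>i\<in>{1..k}. \<mu> (c * n i)) = (\<Prod>i\<in>{1..k}. if j = l then (if i = j then \<mu> (2 * c) else 1)
         else (if i = j then \<mu> c else 1) * (if i = l then \<mu> c else 1))"
      by (intro prod.cong) (auto simp: n_def \<mu> mult_2 mult_2_right)
    also have "\<dots> = (if j = l then \<mu> (2 * c) else \<mu> c * \<mu> c)"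
      using jl by (cases "j = l") (simp_all add: prod.distrib)
    finally show ?thesis .
  qed
  have e1: "(\<integral>x. x j * x l \<partial>sgauss {1..k}) = (if j = l then 1 else 0)"
    using sgauss_monomial(2)[of "{1..k}" n] E[of 1] \<mu> unfolding m1 \<mu>_def[symmetric] by simp
  have e2: "(\<integral>x. (x j * x l)\<^sup>2 \<partial>sgauss {1..k}) = (if j = l then 3 else 1)"
    using sgauss_monomial(2)[of "{1..k}" "\<lambda>i. 2 * n i"] E[of 2] \<mu> unfolding m2 \<mu>_def[symmetric] by simp
  have F2: "(F x)\<^sup>2 = (x j * x l)\<^sup>2 - 2 * (if j = l then 1 else 0) * (x j * x l) + (if j = l then 1 else 0)" for x
    unfolding F_def power2_diff by simp
  show "integrable (sgauss {1..k}) (\<lambda>x. (F x)\<^sup>2)"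
    unfolding F2 by (intro Bochner_Integration.integrable_add Bochner_Integration.integrable_diff int2
        integrable_mult_right int1 R.integrable_const)
  show "(\<integral>x. F x \<partial>sgauss {1..k}) = 0"
    unfolding F_def by (subst Bochner_Integration.integral_diff[OF int1 R.integrable_const]) (simp add: e1 R.prob_space del: One_nat_def)
  have "(\<integral>x. (F x)\<^sup>2 \<partial>sgauss {1..k}) = (\<integral>x. (x j * x l)\<^sup>2 \<partial>sgauss {1..k})
      - 2 * (if j = l then 1 else 0) * (\<integral>x. x j * x l \<partial>sgauss {1..k}) + (if j = l then 1 else 0)"
    unfolding F2
    by (subst Bochner_Integration.integral_add, (intro Bochner_Integration.integrable_diff int2 integrable_mult_right int1 R.integrable_const)+,
        subst Bochner_Integration.integral_diff, (intro int2 integrable_mult_right int1)+) (simp add: R.prob_space del: One_nat_def)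
  also have "\<dots> \<le> 2" unfolding e1 e2 by simp
  finally show "(\<integral>x. (F x)\<^sup>2 \<partial>sgauss {1..k}) \<le> 2" .
qed

text \<open>Each entry of the Gram matrix has variance at most \<open>2 / N\<close>; Chebyshev's
  inequality and a union bound over the \<open>k\<^sup>2\<close> entries give the estimate. (The
  exponent is that of \<open>real k\<close>.)\<close>

lemma prob_not_near_orthonormal:
  assumes N: "N > 0" and k: "k > 0" and \<epsilon>: "\<epsilon> > 0"
  shows "1 - 2 * (real k)\<^sup>2 / (real N * \<epsilon>\<^sup>2)
     \<le> measure (matgauss N k) {w \<in> space (matgauss N k). near_orthonormal N k \<epsilon> (gauss_column N w)}"
proof -
  let ?M = "matgauss N k"
  interpret M: prob_space ?M by (rule prob_space_matgauss)
  define F where "F j l x = x j * x l - (if j = l then 1 else 0 :: real)" for j l and x :: "nat \<Rightarrow> real"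
  define B where "B j l = {w \<in> space ?M. real N * \<epsilon> \<le> \<bar>\<Sum>p<N. F j l (gauss_row k p w)\<bar>}" for j l
  have Fm: "F j l \<in> borel_measurable (leb {1..k})" if "j \<in> {1..k}" "l \<in> {1..k}" for j l
    unfolding F_def using that
    by (intro borel_measurable_diff borel_measurable_times measurable_leb_component borel_measurable_const)
  have Sm: "(\<lambda>w. \<Sum>p<N. F j l (gauss_row k p w)) \<in> borel_measurable ?M" if "j \<in> {1..k}" "l \<in> {1..k}" for j l
    by (intro borel_measurable_sum measurable_compose[OF measurable_gauss_row])
      (use Fm[OF that] in \<open>auto simp: measurable_sgauss_iff\<close>)
  have B: "M.prob (B j l) \<le> 2 / (real N * \<epsilon>\<^sup>2)" if jl: "j \<in> {1..k}" "l \<in> {1..k}" for j l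
  proof -
    note mom = sgauss_pair_moments[OF jl, folded F_def]
    note sm = sum_rows_second_moment[OF N k Fm[OF jl] mom(1,2)]
    have "M.prob (B j l) \<le> (\<integral>w. (\<Sum>p<N. F j l (gauss_row k p w))\<^sup>2 \<partial>?M) / (real N * \<epsilon>)\<^sup>2"
      unfolding B_def by (rule M.second_moment_method[OF Sm[OF jl] sm(1)]) (use N \<epsilon> in auto)
    also have "\<dots> \<le> (real N * 2) / (real N * \<epsilon>)\<^sup>2"
      unfolding sm(2) by (intro divide_right_mono mult_left_mono mom(3)) auto
    also have "\<dots> = 2 / (real N * \<epsilon>\<^sup>2)" using N by (simp add: power2_eq_square field_simps)
    finally show ?thesis .
  qed
  have Bs: "B j l \<in> sets ?M" if "j \<in> {1..k}" "l \<in> {1..k}" for j l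
    unfolding B_def using Sm[OF that] by measurable
  let ?U = "\<Union>(j,l)\<in>{1..k} \<times> {1..k}. B j l"
  have "M.prob ?U \<le> (\<Sum>(j,l)\<in>{1..k} \<times> {1..k}. M.prob (B j l))"
    using M.finite_measure_subadditive_finite[of "{1..k} \<times> {1..k}" "\<lambda>(j,l). B j l"] Bs by (simp add: split_beta image_subset_iff)
  also have "\<dots> \<le> (\<Sum>(j,l)\<in>{1..k} \<times> {1..k}. 2 / (real N * \<epsilon>\<^sup>2))"
    by (rule sum_mono) (use B in auto)
  also have "\<dots> = 2 * (real k)\<^sup>2 / (real N * \<epsilon>\<^sup>2)" by (simp add: power2_eq_square)
  finally have U: "M.prob ?U \<le> 2 * (real k)\<^sup>2 / (real N * \<epsilon>\<^sup>2)" .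
  have Us: "?U \<in> sets ?M" by (intro sets.finite_UN) (use Bs in auto)
  have "space ?M - ?U \<subseteq> {w \<in> space ?M. near_orthonormal N k \<epsilon> (gauss_column N w)}"
  proof
    fix w assume w: "w \<in> space ?M - ?U"
    have "\<bar>ip N (gauss_column N w j) (gauss_column N w l) - (if j = l then 1 else 0)\<bar> \<le> \<epsilon>"
      if jl: "j \<in> {1..k}" "l \<in> {1..k}" for j l
    proof -
      have "w \<notin> B j l" using w jl by blast
      then have lt: "\<bar>\<Sum>p<N. F j l (gauss_row k p w)\<bar> < real N * \<epsilon>" using w by (auto simp: B_def)
      have "(\<Sum>p<N. F j l (gauss_row k p w)) = (\<Sum>p<N. w (p, j) * w (p, l)) - real N * (if j = l then 1 else 0)"
        using jl by (simp add: F_def gauss_row_def sum_subtractf)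
      moreover have "ip N (gauss_column N w j) (gauss_column N w l) = (\<Sum>p<N. w (p, j) * w (p, l)) / real N"
        using N by (simp add: ip_def gauss_column_def sum_divide_distrib)
      ultimately have eq: "ip N (gauss_column N w j) (gauss_column N w l) - (if j = l then 1 else 0) = (\<Sum>p<N. F j l (gauss_row k p w)) / real N"
        using N by (simp add: field_simps)
      show ?thesis unfolding eq abs_divide using lt N by (simp add: field_simps)
    qed
    then show "w \<in> {w \<in> space ?M. near_orthonormal N k \<epsilon> (gauss_column N w)}"
      using w by (auto simp: near_orthonormal_def)
  qed
  then have "M.prob (space ?M - ?U) \<le> M.prob {w \<in> space ?M. near_orthonormal N k \<epsilon> (gauss_column N w)}"
    by (intro M.finite_measure_mono sets_near)
  then show ?thesis using M.prob_compl[OF Us] U by simp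
qed

text \<open>The bound at coordinate \<open>i\<close> involves the inputs at that coordinate only,
  because the Gram--Schmidt coefficients are shared by all coordinates. It is proportional to the
  squared row norm, which serves large rows and rows near 0 alike.\<close>

lemma gram_schmidt_quadratic_approx:
  fixes a :: "nat \<Rightarrow> real"
  shows "\<exists>D \<epsilon>0. D \<ge> 0 \<and> \<epsilon>0 > 0 \<and> (\<forall>N x \<epsilon>. 0 \<le> \<epsilon> \<longrightarrow> \<epsilon> \<le> \<epsilon>0 \<longrightarrow> near_orthonormal N k \<epsilon> x \<longrightarrow>
     orthosys N {1..k} (gram_schmidt N x) \<and>
     (\<forall>i. \<bar>(\<Sum>j\<in>{1..k}. a j * (gram_schmidt N x j i)\<^sup>2) - (\<Sum>j\<in>{1..k}. a j * (x j i)\<^sup>2)\<bar>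
            \<le> D * \<epsilon> * (\<Sum>j\<in>{1..k}. (x j i)\<^sup>2)))"
proof -
  obtain C \<epsilon>0 where C: "C \<ge> 0" "\<epsilon>0 > 0"
    and GS: "\<And>N x \<epsilon>. 0 \<le> \<epsilon> \<Longrightarrow> \<epsilon> \<le> \<epsilon>0 \<Longrightarrow> near_orthonormal N k \<epsilon> x \<Longrightarrow> gs_close N k (C * \<epsilon>) k x"
    using gram_schmidt_near_orthonormal[of k] by blast
  \<comment> \<open>From the factorisation of a difference of squares: the difference of new and old
    entry is at most \<open>C * \<epsilon> * k * r\<close> and their sum at most
    \<open>(2 + C * \<epsilon>0 * k) * r\<close>, where \<open>r\<close> is the row norm.\<close>
  define L where "L = C * real k * (2 + C * \<epsilon>0 * real k)"
  have L: "L \<ge> 0" using C by (simp add: L_def)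
  define D where "D = (\<Sum>j\<in>{1..k}. \<bar>a j\<bar>) * L"
  have "orthosys N {1..k} (gram_schmidt N x) \<and>
     (\<forall>i. \<bar>(\<Sum>j\<in>{1..k}. a j * (gram_schmidt N x j i)\<^sup>2) - (\<Sum>j\<in>{1..k}. a j * (x j i)\<^sup>2)\<bar>
            \<le> D * \<epsilon> * (\<Sum>j\<in>{1..k}. (x j i)\<^sup>2))"
    if \<epsilon>: "0 \<le> \<epsilon>" "\<epsilon> \<le> \<epsilon>0" and near: "near_orthonormal N k \<epsilon> x" for N x \<epsilon>
  proof (intro conjI allI)
    let ?v = "gram_schmidt N x"
    have cl: "gs_close N k (C * \<epsilon>) k x" by (rule GS[OF that])
    show "orthosys N {1..k} ?v" using cl by (simp add: gs_close_def)
    obtain c where cv: "\<And>j p. j \<in> {1..k} \<Longrightarrow> ?v j p = (\<Sum>l\<in>{1..k}. c j l * x l p)"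
      and cb: "\<And>j l. j \<in> {1..k} \<Longrightarrow> l \<in> {1..k} \<Longrightarrow> \<bar>c j l - (if j = l then 1 else 0)\<bar> \<le> C * \<epsilon>"
      using cl unfolding gs_close_def by blast
    fix i
    define r where "r = sqrt (\<Sum>j\<in>{1..k}. (x j i)\<^sup>2)"
    have r2: "r\<^sup>2 = (\<Sum>j\<in>{1..k}. (x j i)\<^sup>2)" by (simp add: r_def sum_nonneg)
    have r0: "r \<ge> 0" by (simp add: r_def sum_nonneg)
    have xr: "\<bar>x j i\<bar> \<le> r" if "j \<in> {1..k}" for j
    proof -
      have "(x j i)\<^sup>2 \<le> (\<Sum>j\<in>{1..k}. (x j i)\<^sup>2)" using that by (intro member_le_sum) auto
      then show ?thesis unfolding r_def by (metis real_sqrt_abs real_sqrt_le_iff)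
    qed
    have dv: "\<bar>?v j i - x j i\<bar> \<le> C * \<epsilon> * real k * r" if j: "j \<in> {1..k}" for j
    proof -
      have "x j i = (\<Sum>l\<in>{1..k}. if l = j then x l i else 0)" using j by simp
      also have "\<dots> = (\<Sum>l\<in>{1..k}. (if j = l then 1 else 0) * x l i)" by (intro sum.cong) auto
      finally have "?v j i - x j i = (\<Sum>l\<in>{1..k}. (c j l - (if j = l then 1 else 0)) * x l i)"
        unfolding cv[OF j] by (simp only: left_diff_distrib sum_subtractf)
      also have "\<bar>\<dots>\<bar> \<le> (\<Sum>l\<in>{1..k}. C * \<epsilon> * r)"
        by (rule order_trans[OF sum_abs sum_mono], unfold abs_mult, intro mult_mono)
           (use cb[OF j] xr C \<epsilon> in auto)
      finally show ?thesis by (simp add: mult_ac)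
    qed
    have sq: "\<bar>(?v j i)\<^sup>2 - (x j i)\<^sup>2\<bar> \<le> L * \<epsilon> * r\<^sup>2" if j: "j \<in> {1..k}" for j
    proof -
      have "\<bar>?v j i + x j i\<bar> \<le> \<bar>?v j i - x j i\<bar> + 2 * \<bar>x j i\<bar>" by linarith
      also have "\<dots> \<le> C * \<epsilon> * real k * r + 2 * r" using dv[OF j] xr[OF j] by simp
      also have "\<dots> \<le> C * \<epsilon>0 * real k * r + 2 * r"
        using C \<epsilon> r0 by (intro add_right_mono mult_right_mono mult_left_mono) auto
      finally have 1: "\<bar>?v j i + x j i\<bar> \<le> (2 + C * \<epsilon>0 * real k) * r" by (simp add: algebra_simps)
      have "\<bar>(?v j i)\<^sup>2 - (x j i)\<^sup>2\<bar> = \<bar>?v j i - x j i\<bar> * \<bar>?v j i + x j i\<bar>"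
        by (simp add: abs_mult[symmetric] power2_eq_square algebra_simps)
      also have "\<dots> \<le> (C * \<epsilon> * real k * r) * ((2 + C * \<epsilon>0 * real k) * r)"
        using C \<epsilon> r0 by (intro mult_mono dv[OF j] 1) auto
      also have "\<dots> = L * \<epsilon> * r\<^sup>2" by (simp add: L_def power2_eq_square mult_ac)
      finally show ?thesis .
    qed
    have "\<bar>(\<Sum>j\<in>{1..k}. a j * (?v j i)\<^sup>2) - (\<Sum>j\<in>{1..k}. a j * (x j i)\<^sup>2)\<bar>
        = \<bar>\<Sum>j\<in>{1..k}. a j * ((?v j i)\<^sup>2 - (x j i)\<^sup>2)\<bar>"
      by (simp add: sum_subtractf right_diff_distrib)
    also have "\<dots> \<le> (\<Sum>j\<in>{1..k}. \<bar>a j\<bar> * (L * \<epsilon> * r\<^sup>2))"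
      by (rule order_trans[OF sum_abs sum_mono], unfold abs_mult, intro mult_mono sq) auto
    also have "\<dots> = D * \<epsilon> * (\<Sum>j\<in>{1..k}. (x j i)\<^sup>2)"
      by (simp only: D_def r2 sum_distrib_right[symmetric] mult.assoc)
    finally show "\<bar>(\<Sum>j\<in>{1..k}. a j * (?v j i)\<^sup>2) - (\<Sum>j\<in>{1..k}. a j * (x j i)\<^sup>2)\<bar> \<le> \<dots>" .
  qed
  moreover have "D \<ge> 0" using L by (simp add: D_def sum_nonneg)
  ultimately show ?thesis using C(2) by blast
qed

section \<open>Tails and small balls of weighted chi-square variables\<close>

lemma nn_integral_exp_tail:
  assumes "c > 0"
  shows "(\<integral>\<^sup>+u. ennreal (exp (- c * u)) * indicator {a..} u \<partial>lborel) = ennreal (exp (- c * a) / c)"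
proof -
  have lim: "((\<lambda>x::real. - exp (- c * x) / c) \<longlongrightarrow> 0) at_top"
    using assms by real_asymp
  have "(\<integral>\<^sup>+u. ennreal (exp (- c * u)) * indicator {a..} u \<partial>lborel) = ennreal (0 - (- exp (- c * a) / c))"
    by (rule nn_integral_FTC_atLeast[OF _ _ _ lim]) (use assms in \<open>auto intro!: derivative_eq_intros\<close>)
  then show ?thesis by simp
qed

text \<open>With \<open>D = max 2 (a / \<eta>)\<close> one has
  \<open>2 + v \<le> D * (1 + v / D) \<le> D * exp (v / D)\<close>. Dominating functions use this to
  absorb polynomial factors into an exponential of arbitrarily small rate.\<close>

lemma powr_le_exp:
  fixes \<eta> a :: real
  assumes "\<eta> > 0" "a \<ge> 0"
  shows "\<exists>C>0. \<forall>v\<ge>0. (2 + v) powr a \<le> C * exp (\<eta> * v)"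
proof -
  define D where "D = max 2 (a / \<eta>)"
  have D: "D \<ge> 2" "a / D \<le> \<eta>"
    using assms by (auto simp: D_def field_simps max_def)
  have "(2 + v) powr a \<le> D powr a * exp (\<eta> * v)" if v: "v \<ge> 0" for v
  proof -
    have "2 + v \<le> D * (1 + v / D)" using D by (simp add: field_simps)
    also have "\<dots> \<le> D * exp (v / D)" using D exp_ge_add_one_self[of "v / D"] by (intro mult_left_mono) auto
    finally have "(2 + v) powr a \<le> (D * exp (v / D)) powr a" using v assms by (intro powr_mono2) auto
    also have "\<dots> = D powr a * exp (a / D * v)" using D by (simp add: powr_mult powr_def exp_of_real ln_mult algebra_simps exp_add)
    also have "\<dots> \<le> D powr a * exp (\<eta> * v)"
      using mult_right_mono[OF D(2) v] by (intro mult_left_mono) simp_all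
    finally show ?thesis .
  qed
  then show ?thesis using D by (intro exI[of _ "D powr a"]) auto
qed

text \<open>A bound that works for either sign of the exponent; the exponents below, such as
  \<open>m / 2 - 1\<close>, can be negative.\<close>

lemma powr_le_powr_abs:
  fixes \<rho> M p :: real
  assumes "\<rho> > 0" "\<rho> \<le> M" "1 / \<rho> \<le> M"
  shows "\<rho> powr p \<le> M powr \<bar>p\<bar>"
proof (cases "p \<ge> 0")
  case True
  then show ?thesis using assms by (simp add: powr_mono2)
next
  case False
  then have "\<rho> powr p = (1 / \<rho>) powr \<bar>p\<bar>" using assms by (simp add: powr_divide powr_minus_divide[symmetric])
  also have "\<dots> \<le> M powr \<bar>p\<bar>" using assms by (intro powr_mono2) auto
  finally show ?thesis .
qed

text \<open>The factor \<open>1/2\<close> makes the standard Gaussian density a constant times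
  \<open>exp (- half_norm J x)\<close>.\<close>

definition half_norm :: "'i set \<Rightarrow> ('i \<Rightarrow> real) \<Rightarrow> real" where
  "half_norm J x = (\<Sum>j\<in>J. (x j)\<^sup>2) / 2"

lemma measurable_half_norm [measurable]: "half_norm J \<in> borel_measurable (leb J)"
  unfolding half_norm_def[abs_def]
  by (intro borel_measurable_divide borel_measurable_sum borel_measurable_power measurable_leb_component) auto

lemma sgauss_density:
  assumes "finite J"
  shows "sgauss J = density (leb J) (\<lambda>x. ennreal ((2 * pi) powr (- real (card J) / 2) * exp (- half_norm J x)))"
proof -
  have "(1 / sqrt (2 * pi)) ^ card J = (2 * pi) powr (- real (card J) / 2)"
  proof -
    have eq: "1 / sqrt (2 * pi) = (2 * pi) powr (- 1 / 2)"
      by (simp add: powr_minus_divide powr_half_sqrt)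
    have "(1 / sqrt (2 * pi)) ^ card J = ((2 * pi) powr (- 1 / 2)) powr real (card J)"
      unfolding eq by (rule powr_realpow[symmetric]) simp
    also have "\<dots> = (2 * pi) powr (- real (card J) / 2)" unfolding powr_powr by simp
    finally show ?thesis .
  qed
  then show ?thesis
    unfolding sgauss_def
    by (subst gauss_eq_density[OF assms]) (simp_all add: prod_normal_density[OF assms] half_norm_def)
qed

lemma emeasure_leb_half_norm_le:
  assumes "finite J" "u > 0"
  shows "emeasure (leb J) {x \<in> space (leb J). half_norm J x \<le> u}
     = ennreal ((2 * pi) powr (real (card J) / 2) / Gamma (real (card J) / 2 + 1) * u powr (real (card J) / 2))"
proof -
  let ?m = "card J"
  have "{x \<in> space (leb J). half_norm J x \<le> u} = {f. sqrt (\<Sum>i\<in>J. (f i)\<^sup>2) \<le> sqrt (2 * u)} \<inter> space (leb J)"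
    using assms(2) by (auto simp: half_norm_def)
  then have "emeasure (leb J) {x \<in> space (leb J). half_norm J x \<le> u}
     = ennreal (unit_ball_vol (real ?m) * sqrt (2 * u) ^ ?m)"
    using emeasure_cball_aux[OF assms(1), of "sqrt (2 * u)"] assms(2) by simp
  also have "sqrt (2 * u) ^ ?m = 2 powr (real ?m / 2) * u powr (real ?m / 2)"
  proof -
    have "sqrt (2 * u) ^ ?m = sqrt (2 * u) powr real ?m" using assms(2) by (intro powr_realpow[symmetric]) simp
    also have "\<dots> = (2 * u) powr (real ?m / 2)"
      using assms(2) by (simp add: powr_half_sqrt[symmetric] powr_powr)
    finally show ?thesis using assms(2) by (simp add: powr_mult)
  qed
  also have "unit_ball_vol (real ?m) * (2 powr (real ?m / 2) * u powr (real ?m / 2))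
      = (2 * pi) powr (real ?m / 2) / Gamma (real ?m / 2 + 1) * u powr (real ?m / 2)"
    by (simp add: unit_ball_vol_def powr_mult)
  finally show ?thesis .
qed

text \<open>The upper tail of half a chi-square variable with \<open>card J\<close> degrees of
  freedom, that is, of a Gamma law of shape \<open>card J / 2\<close>.\<close>

definition chi_tail :: "'i set \<Rightarrow> real \<Rightarrow> real" where
  "chi_tail J s = measure (sgauss J) {x \<in> space (leb J). s < half_norm J x}"

text \<open>
  Layer cake: writing \<open>exp (- h) = \<integral> u in {h..}. exp (- u)\<close> turns the Gaussian tail into an
  integral over Euclidean shells, whose volumes are known.
\<close>

lemma emeasure_chi_tail:
  assumes J: "finite J" and s: "s > 0"
  shows "emeasure (sgauss J) {x \<in> space (leb J). s < half_norm J x}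
     = (\<integral>\<^sup>+v. ennreal (indicator {0<..} v * (exp (- (s + v)) * ((s + v) powr (real (card J) / 2) - s powr (real (card J) / 2))
            / Gamma (real (card J) / 2 + 1))) \<partial>lborel)"
proof -
  let ?h = "half_norm J" and ?m = "real (card J) / 2"
  define G where "G = Gamma (?m + 1)"
  have G: "G > 0" unfolding G_def by (intro Gamma_real_pos) simp
  define c where "c = (2 * pi) powr (- ?m)"
  have c: "c \<ge> 0" "c * (2 * pi) powr ?m = 1" by (simp_all add: c_def powr_minus_divide)
  interpret product_sigma_finite "\<lambda>_. lborel :: real measure" by standard
  interpret L: sigma_finite_measure "leb J" using J by (rule sigma_finite)
  interpret LL: pair_sigma_finite "leb J" "lborel :: real measure" by standard
  let ?A = "{x \<in> space (leb J). s < ?h x}"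
  have A [measurable]: "?A \<in> sets (leb J)" by measurable
  have "emeasure (sgauss J) ?A = (\<integral>\<^sup>+x. ennreal (c * exp (- ?h x)) * indicator ?A x \<partial>leb J)"
    unfolding sgauss_density[OF J] c_def by (subst emeasure_density) auto
  also have "\<dots> = (\<integral>\<^sup>+x. (\<integral>\<^sup>+u. (if s < ?h x \<and> ?h x \<le> u then ennreal (c * exp (- u)) else 0) \<partial>lborel) \<partial>leb J)"
  proof (rule nn_integral_cong)
    fix x assume x: "x \<in> space (leb J)"
    have "(\<integral>\<^sup>+u. (if s < ?h x \<and> ?h x \<le> u then ennreal (c * exp (- u)) else 0) \<partial>lborel)
      = (\<integral>\<^sup>+u. (ennreal c * indicator ?A x) * (ennreal (exp (- 1 * u)) * indicator {?h x..} u) \<partial>lborel)"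
      using x c(1) by (intro nn_integral_cong) (auto simp: indicator_def ennreal_mult)
    also have "\<dots> = (ennreal c * indicator ?A x) * ennreal (exp (- ?h x))"
      by (subst nn_integral_cmult) (auto simp: nn_integral_exp_tail[of 1, simplified])
    finally show "ennreal (c * exp (- ?h x)) * indicator ?A x = (\<integral>\<^sup>+u. (if s < ?h x \<and> ?h x \<le> u then ennreal (c * exp (- u)) else 0) \<partial>lborel)"
      using c(1) by (simp add: ennreal_mult mult_ac)
  qed
  also have "\<dots> = (\<integral>\<^sup>+u. (\<integral>\<^sup>+x. (if s < ?h x \<and> ?h x \<le> u then ennreal (c * exp (- u)) else 0) \<partial>leb J) \<partial>lborel)"
    by (rule LL.Fubini'[symmetric]) measurable
  also have "\<dots> = (\<integral>\<^sup>+u. ennreal (indicator {s<..} u * (exp (- u) * (u powr ?m - s powr ?m) / G)) \<partial>lborel)"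
  proof (rule nn_integral_cong)
    fix u :: real
    let ?B = "\<lambda>u. {x \<in> space (leb J). ?h x \<le> u}"
    have B [measurable]: "?B u \<in> sets (leb J)" for u by measurable
    have "(\<integral>\<^sup>+x. (if s < ?h x \<and> ?h x \<le> u then ennreal (c * exp (- u)) else 0) \<partial>leb J)
       = (\<integral>\<^sup>+x. ennreal (c * exp (- u)) * indicator (?B u - ?B s) x \<partial>leb J)"
      by (intro nn_integral_cong) (auto simp: indicator_def)
    also have "\<dots> = ennreal (c * exp (- u)) * emeasure (leb J) (?B u - ?B s)"
      by (rule nn_integral_cmult_indicator) measurable
    also have "\<dots> = ennreal (indicator {s<..} u * (exp (- u) * (u powr ?m - s powr ?m) / G))"
    proof (cases "s < u")
      case False
      then have "?B u - ?B s = {}" by auto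
      then show ?thesis using False by (simp only: emeasure_empty) simp
    next
      case True
      have "emeasure (leb J) (?B u - ?B s) = emeasure (leb J) (?B u) - emeasure (leb J) (?B s)"
        using True by (intro emeasure_Diff) (auto simp: emeasure_leb_half_norm_le[OF J s])
      also have "\<dots> = ennreal ((2 * pi) powr ?m / G * u powr ?m - (2 * pi) powr ?m / G * s powr ?m)"
        using True s G by (simp add: emeasure_leb_half_norm_le[OF J] ennreal_minus G_def[symmetric])
      finally have "ennreal (c * exp (- u)) * emeasure (leb J) (?B u - ?B s)
         = ennreal (c * exp (- u) * ((2 * pi) powr ?m / G * u powr ?m - (2 * pi) powr ?m / G * s powr ?m))"
        using c(1) by (simp add: ennreal_mult')
      also have "c * exp (- u) * ((2 * pi) powr ?m / G * u powr ?m - (2 * pi) powr ?m / G * s powr ?m)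
          = (c * (2 * pi) powr ?m) * (exp (- u) * (u powr ?m - s powr ?m) / G)"
        using G by (simp add: field_simps)
      finally show ?thesis using True c(2) by simp
    qed
    finally show "(\<integral>\<^sup>+x. (if s < ?h x \<and> ?h x \<le> u then ennreal (c * exp (- u)) else 0) \<partial>leb J) = \<dots>" .
  qed
  \<comment> \<open>The shift \<open>u = s + v\<close> makes the domain independent of
    \<open>s\<close>, as dominated convergence requires.\<close>
  also have "\<dots> = (\<integral>\<^sup>+v. ennreal (indicator {0<..} v * (exp (- (s + v)) * ((s + v) powr ?m - s powr ?m) / G)) \<partial>lborel)"
    by (subst nn_integral_real_affine[where c=1 and t=s]) (auto simp: indicator_def intro!: nn_integral_cong)
  finally show ?thesis unfolding G_def .
qed

lemma chi_tail_integral: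
  assumes J: "finite J" and s: "s > 0"
  shows "chi_tail J s = (\<integral>v. indicator {0<..} v * (exp (- (s + v)) * ((s + v) powr (real (card J) / 2) - s powr (real (card J) / 2))
            / Gamma (real (card J) / 2 + 1)) \<partial>lborel)"
proof -
  have G: "Gamma (real (card J) / 2 + 1) > 0" by (intro Gamma_real_pos) simp
  show ?thesis
    unfolding chi_tail_def measure_def emeasure_chi_tail[OF assms]
    by (rule integral_eq_nn_integral[symmetric])
       (use s G in \<open>auto simp: indicator_def intro!: AE_I2 divide_nonneg_pos mult_nonneg_nonneg powr_mono2\<close>)
qed

text \<open>The mean value theorem bounds the increment by its derivative at some \<open>z\<close>
  between \<open>s\<close> and \<open>s + v\<close>. As \<open>z / s \<ge> 1\<close>, the exponent
  \<open>\<alpha> - 1\<close> may be raised to \<open>\<alpha>\<close>, so its sign does not matter,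
  and the resulting bound is uniform in \<open>s \<ge> 1\<close>.\<close>

lemma powr_increment_bound:
  fixes s v \<alpha> :: real
  assumes "s \<ge> 1" "v > 0" "\<alpha> > 0"
  shows "s powr (1 - \<alpha>) * ((s + v) powr \<alpha> - s powr \<alpha>) \<le> \<alpha> * (2 + v) powr (\<alpha> + 1)"
proof -
  have "\<exists>z>s. z < s + v \<and> (s + v) powr \<alpha> - s powr \<alpha> = (s + v - s) * (\<alpha> * z powr (\<alpha> - 1))"
    by (rule MVT2) (use assms in \<open>auto intro!: derivative_eq_intros\<close>)
  then obtain z where z: "z > s" "z < s + v" "(s + v) powr \<alpha> - s powr \<alpha> = v * (\<alpha> * z powr (\<alpha> - 1))" by auto
  have "s powr (1 - \<alpha>) * z powr (\<alpha> - 1) = (z / s) powr (\<alpha> - 1)"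
    using assms z by (simp add: powr_divide powr_diff field_simps)
  also have "\<dots> \<le> (z / s) powr \<alpha>" using assms z by (intro powr_mono) auto
  also have "\<dots> \<le> (2 + v) powr \<alpha>"
  proof (rule powr_mono2)
    have "v \<le> v * s" using assms by simp
    then have "z \<le> (1 + v) * s" using z(2) by (simp add: algebra_simps)
    then show "z / s \<le> 2 + v" using assms by (simp add: field_simps)
  qed (use assms z in auto)
  finally have 1: "s powr (1 - \<alpha>) * z powr (\<alpha> - 1) \<le> (2 + v) powr \<alpha>" .
  have "s powr (1 - \<alpha>) * ((s + v) powr \<alpha> - s powr \<alpha>) = \<alpha> * (v * (s powr (1 - \<alpha>) * z powr (\<alpha> - 1)))"
    using z(3) by (simp add: mult_ac)
  also have "\<dots> \<le> \<alpha> * ((2 + v) * (2 + v) powr \<alpha>)"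
    using assms by (intro mult_left_mono mult_mono 1) auto
  finally show ?thesis using assms by (simp add: powr_add mult.commute)
qed

text \<open>With \<open>\<alpha> = card J / 2\<close>, the normalised integrand tends to
  \<open>exp (- v) * \<alpha> * v / Gamma (\<alpha> + 1)\<close>. The integral of
  \<open>v * exp (- v)\<close> over the half-line is 1, which leaves
  \<open>\<alpha> / Gamma (\<alpha> + 1) = 1 / Gamma \<alpha>\<close>.\<close>

lemma chi_tail_asymp:
  assumes J: "finite J" "J \<noteq> {}"
  shows "((\<lambda>s. chi_tail J s * exp s * s powr (1 - real (card J) / 2)) \<longlongrightarrow> 1 / Gamma (real (card J) / 2)) at_top"
proof -
  define \<alpha> where "\<alpha> = real (card J) / 2"
  have a: "\<alpha> > 0" using J by (simp add: \<alpha>_def card_gt_0_iff)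
  define G where "G = Gamma (\<alpha> + 1)"
  have G: "G > 0" unfolding G_def using a by (intro Gamma_real_pos) simp
  \<comment> \<open>Half of the exponential decay is spent on the polynomial factor; the remaining
    \<open>exp (- v / 2)\<close> is integrable.\<close>
  obtain C where C: "C > 0" "\<And>v. v \<ge> 0 \<Longrightarrow> (2 + v) powr (\<alpha> + 1) \<le> C * exp (1/2 * v)"
    using powr_le_exp[of "1/2" "\<alpha> + 1"] a by auto
  define f where "f s v = indicator {0<..} v * (exp (- v) * (s powr (1 - \<alpha>) * ((s + v) powr \<alpha> - s powr \<alpha>)) / G)" for s v :: real
  have eq: "chi_tail J s * exp s * s powr (1 - \<alpha>) = (\<integral>v. f s v \<partial>lborel)" if "s > 0" for s
  proof -
    have "chi_tail J s * exp s * s powr (1 - \<alpha>) = (\<integral>v. (exp s * s powr (1 - \<alpha>)) * (indicator {0<..} v * (exp (- (s + v)) * ((s + v) powr \<alpha> - s powr \<alpha>) / G)) \<partial>lborel)"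
      unfolding chi_tail_integral[OF J(1) that] \<alpha>_def G_def by simp
    also have "\<dots> = (\<integral>v. f s v \<partial>lborel)"
    proof (intro Bochner_Integration.integral_cong refl)
      fix v :: real
      have "exp (- v) = exp s * exp (- (s + v))" by (simp add: exp_add[symmetric])
      then show "(exp s * s powr (1 - \<alpha>)) * (indicator {0<..} v * (exp (- (s + v)) * ((s + v) powr \<alpha> - s powr \<alpha>) / G)) = f s v"
        unfolding f_def by (simp only:) simp
    qed
    finally show ?thesis .
  qed
  define w where "w v = indicator {0..} v * (\<alpha> * C / G * exp (- (1/2) * v))" for v :: real
  have "integrable lborel (\<lambda>v::real. indicator {0..} v * exp (- (1/2) * v))"
  proof (rule integrableI_nonneg)
    have "(\<integral>\<^sup>+v. ennreal (indicator {0..} v * exp (- (1/2) * v)) \<partial>lborel) = (\<integral>\<^sup>+v. ennreal (exp (- (1/2) * v)) * indicator {0..} v \<partial>lborel)"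
      by (intro nn_integral_cong) (auto simp: indicator_def)
    then show "(\<integral>\<^sup>+v. ennreal (indicator {0..} v * exp (- (1/2) * v)) \<partial>lborel) < \<infinity>"
      by (simp only: nn_integral_exp_tail) simp
  qed auto
  then have "integrable lborel (\<lambda>v::real. (\<alpha> * C / G) * (indicator {0..} v * exp (- (1/2) * v)))" by (rule integrable_mult_right)
  then have w: "integrable lborel w" by (simp add: w_def[abs_def] mult_ac)
  have "((\<lambda>s. \<integral>v. f s v \<partial>lborel) \<longlongrightarrow> (\<integral>v. indicator {0..} v * (exp (- v) * (\<alpha> * v) / G) \<partial>lborel)) at_top"
  proof (rule integral_dominated_convergence_at_top[where w=w])
    show "AE v in lborel. ((\<lambda>s. f s v) \<longlongrightarrow> indicator {0..} v * (exp (- v) * (\<alpha> * v) / G)) at_top"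
    proof (rule AE_I2)
      fix v :: real
      have "((\<lambda>s. s powr (1 - \<alpha>) * ((s + v) powr \<alpha> - s powr \<alpha>)) \<longlongrightarrow> \<alpha> * v) at_top" if "v > 0"
        using that a by real_asymp
      then show "((\<lambda>s. f s v) \<longlongrightarrow> indicator {0..} v * (exp (- v) * (\<alpha> * v) / G)) at_top"
        unfolding f_def using G by (cases "v > 0"; cases "v = 0") (auto intro!: tendsto_intros)
    qed
    show "\<forall>\<^sub>F s in at_top. AE v in lborel. norm (f s v) \<le> w v"
      using eventually_ge_at_top[of 1]
    proof eventually_elim
      case (elim s)
      show ?case
      proof (rule AE_I2)
        fix v :: real
        show "norm (f s v) \<le> w v"
        proof (cases "v > 0")
          case True
          have 0: "0 \<le> s powr (1 - \<alpha>) * ((s + v) powr \<alpha> - s powr \<alpha>)" using elim True a by (simp add: powr_mono2)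
          have fe: "f s v = exp (- v) * (s powr (1 - \<alpha>) * ((s + v) powr \<alpha> - s powr \<alpha>)) / G"
            using True by (simp add: f_def)
          have "0 \<le> f s v" unfolding fe by (rule divide_nonneg_pos[OF mult_nonneg_nonneg[OF _ 0] G]) simp
          then have "norm (f s v) = f s v" by simp
          also have "f s v = exp (- v) * (s powr (1 - \<alpha>) * ((s + v) powr \<alpha> - s powr \<alpha>)) / G" by (rule fe)
          also have "\<dots> \<le> exp (- v) * (\<alpha> * (C * exp (1/2 * v))) / G"
            using powr_increment_bound[OF elim True a] C(2)[of v] True a G
            by (intro divide_right_mono mult_left_mono) (auto intro: order_trans mult_left_mono)
          also have "\<dots> = \<alpha> * C / G * (exp (- v) * exp (1/2 * v))" by simp
          also have "exp (- v) * exp (1/2 * v) = exp (- (1/2) * v)" by (simp add: exp_add[symmetric])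
          also have "\<alpha> * C / G * exp (- (1/2) * v) = w v" using True by (simp add: w_def)
          finally show ?thesis .
        next
          case False
          then show ?thesis using a C G by (simp add: f_def w_def)
        qed
      qed
    qed
  qed (use w in \<open>auto simp: f_def[abs_def]\<close>)
  also have "(\<integral>v. indicator {0..} v * (exp (- v) * (\<alpha> * v) / G) \<partial>lborel) = \<alpha> / G"
  proof -
    have lim: "((\<lambda>x::real. - (x + 1) * exp (- x)) \<longlongrightarrow> 0) at_top" by real_asymp
    have "(\<integral>\<^sup>+v. ennreal (v * exp (- v)) * indicator {0..} v \<partial>lborel) = ennreal (0 - (- (0 + 1) * exp (- 0)))"
      by (rule nn_integral_FTC_atLeast[OF _ _ _ lim]) (auto intro!: derivative_eq_intros simp: algebra_simps)
    also have "(\<integral>\<^sup>+v. ennreal (v * exp (- v)) * indicator {0..} v \<partial>lborel) = (\<integral>\<^sup>+v. ennreal (indicator {0..} v * (v * exp (- v))) \<partial>lborel)"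
      by (intro nn_integral_cong) (auto simp: indicator_def)
    finally have nn: "(\<integral>\<^sup>+v. ennreal (indicator {0..} v * (v * exp (- v))) \<partial>lborel) = 1" by simp
    have 1: "(\<integral>v. indicator {0..} v * (v * exp (- v)) \<partial>lborel) = (1::real)"
      by (subst integral_eq_nn_integral) (use nn in \<open>auto simp: indicator_def\<close>)
    have "(\<integral>v. indicator {0..} v * (exp (- v) * (\<alpha> * v) / G) \<partial>lborel) = (\<integral>v. (\<alpha> / G) * (indicator {0..} v * (v * exp (- v))) \<partial>lborel)"
      by (intro Bochner_Integration.integral_cong) (auto simp: field_simps)
    then show ?thesis using 1 by simp
  qed
  also have "\<alpha> / G = 1 / Gamma \<alpha>"
    using a Gamma_plus1[of \<alpha>] by (simp add: G_def) (auto simp: nonpos_Ints_def)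
  finally have "((\<lambda>s. \<integral>v. f s v \<partial>lborel) \<longlongrightarrow> 1 / Gamma \<alpha>) at_top" .
  then show ?thesis
    unfolding \<alpha>_def[symmetric]
  proof (rule Lim_transform_eventually)
    show "\<forall>\<^sub>F s in at_top. (\<integral>v. f s v \<partial>lborel) = chi_tail J s * exp s * s powr (1 - \<alpha>)"
      by (rule eventually_mono[OF eventually_gt_at_top[of 0]]) (simp add: eq)
  qed
qed

lemma chi_tail_le_1: "chi_tail J s \<le> 1"
proof -
  interpret prob_space "sgauss J" by (rule prob_space_sgauss)
  show ?thesis unfolding chi_tail_def by simp
qed

lemma chi_tail_nonneg: "0 \<le> chi_tail J s"
  by (simp add: chi_tail_def)

lemma sets_sgauss_less:
  fixes f :: "_ \<Rightarrow> real"
  assumes "f \<in> borel_measurable (leb J)"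
  shows "{x \<in> space (leb J). s < f x} \<in> sets (sgauss J)"
  unfolding sets_sgauss using assms by measurable

lemma measurable_chi_tail: "chi_tail J \<in> borel_measurable borel"
proof -
  interpret prob_space "sgauss J" by (rule prob_space_sgauss)
  have "mono (\<lambda>s. - chi_tail J s)"
    unfolding chi_tail_def mono_def
    by (auto intro!: finite_measure_mono sets_sgauss_less[OF measurable_half_norm])
  then have "(\<lambda>s. - chi_tail J s) \<in> borel_measurable borel" by (rule borel_measurable_mono)
  then have "(\<lambda>s. - (- chi_tail J s)) \<in> borel_measurable borel" by (rule borel_measurable_uminus)
  then show ?thesis by simp
qed

text \<open>The asymptotics are upgraded to a bound on the whole half-line, since conditioning
  evaluates the tail at every argument. The base \<open>1 + s\<close> instead of \<open>s\<close>
  keeps the weight finite and positive at \<open>s = 0\<close> whatever the sign of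
  \<open>p\<close>.\<close>

lemma chi_tail_bound:
  assumes J: "finite J" "J \<noteq> {}"
  defines "p \<equiv> real (card J) / 2 - 1"
  shows "\<exists>C\<ge>1. \<forall>s\<ge>0. chi_tail J s \<le> C * ((1 + s) powr p * exp (- s))"
proof -
  define K where "K = 1 / Gamma (real (card J) / 2) + 1"
  have "((\<lambda>s. chi_tail J s * exp s * s powr (1 - real (card J) / 2)) \<longlongrightarrow> 1 / Gamma (real (card J) / 2)) at_top"
    by (rule chi_tail_asymp[OF J])
  then have "\<forall>\<^sub>F s in at_top. chi_tail J s * exp s * s powr (- p) < K"
    by (rule order_tendstoD(2)[where a=K, THEN eventually_mono]) (auto simp: K_def p_def)
  then obtain s0' where s0': "\<And>s. s \<ge> s0' \<Longrightarrow> chi_tail J s * exp s * s powr (- p) < K"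
    by (auto simp: eventually_at_top_linorder)
  define s0 where "s0 = max 1 s0'"
  have K: "K > 0" unfolding K_def using J by (intro add_nonneg_pos) (auto simp: card_gt_0_iff intro!: less_imp_le Gamma_real_pos)
  define C where "C = max 1 (max (K * 2 powr \<bar>p\<bar>) ((1 + s0) powr \<bar>p\<bar> * exp s0))"
  have "chi_tail J s \<le> C * ((1 + s) powr p * exp (- s))" if s: "s \<ge> 0" for s
  proof (cases "s \<ge> s0")
    case True
    then have s1: "s \<ge> 1" "s > 0" "s \<ge> s0'" by (auto simp: s0_def)
    have "(s / (1 + s)) powr p \<le> 2 powr \<bar>p\<bar>"
      using s1 by (intro powr_le_powr_abs) (auto simp: field_simps)
    then have sp: "s powr p \<le> 2 powr \<bar>p\<bar> * (1 + s) powr p"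
      using s1 by (simp add: powr_divide field_simps)
    have "chi_tail J s = (chi_tail J s * exp s * s powr (- p)) * (s powr p * exp (- s))"
    proof -
      have "exp s * exp (- s) = 1" "s powr (- p) * s powr p = 1"
        using s1 by (simp_all add: exp_add[symmetric] powr_add[symmetric])
      then show ?thesis by (metis (no_types, opaque_lifting) mult.assoc mult.commute mult_1_right)
    qed
    also have "\<dots> \<le> K * ((2 powr \<bar>p\<bar> * (1 + s) powr p) * exp (- s))"
      using s0'[OF s1(3)] K sp by (intro mult_mono mult_right_mono) auto
    also have "\<dots> = (K * 2 powr \<bar>p\<bar>) * ((1 + s) powr p * exp (- s))" by simp
    also have "\<dots> \<le> C * ((1 + s) powr p * exp (- s))" by (intro mult_right_mono) (auto simp: C_def)
    finally show ?thesis .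
  next
    case False
    have "(1 / (1 + s)) powr p \<le> (1 + s0) powr \<bar>p\<bar>"
      using s False by (intro powr_le_powr_abs) (auto simp: field_simps intro: order_trans[of _ 1])
    then have 1: "1 \<le> (1 + s0) powr \<bar>p\<bar> * (1 + s) powr p" using s by (simp add: powr_divide field_simps)
    have "chi_tail J s \<le> 1 * (exp s0 * exp (- s))"
      using chi_tail_le_1[of J s] False by (simp add: exp_add[symmetric]) (smt (verit) one_le_exp_iff)
    also have "\<dots> \<le> ((1 + s0) powr \<bar>p\<bar> * (1 + s) powr p) * (exp s0 * exp (- s))"
      by (rule mult_right_mono[OF 1]) simp
    also have "\<dots> = ((1 + s0) powr \<bar>p\<bar> * exp s0) * ((1 + s) powr p * exp (- s))" by simp
    also have "\<dots> \<le> C * ((1 + s) powr p * exp (- s))" by (intro mult_right_mono) (auto simp: C_def)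
    finally show ?thesis .
  qed
  then show ?thesis by (intro exI[of _ C]) (auto simp: C_def)
qed

section \<open>Weighted chi-square tails by conditioning on the non-maximal weights\<close>

definition wsum :: "'i set \<Rightarrow> ('i \<Rightarrow> real) \<Rightarrow> ('i \<Rightarrow> real) \<Rightarrow> real" where
  "wsum J b x = (\<Sum>j\<in>J. b j * (x j)\<^sup>2) / 2"

definition wtail :: "'i set \<Rightarrow> ('i \<Rightarrow> real) \<Rightarrow> real \<Rightarrow> real" where
  "wtail J b s = measure (sgauss J) {x \<in> space (leb J). s < wsum J b x}"

lemma measurable_wsum [measurable]: "wsum J b \<in> borel_measurable (leb J)"
  unfolding wsum_def[abs_def]
  by (intro borel_measurable_divide borel_measurable_sum borel_measurable_times borel_measurable_power
      measurable_leb_component borel_measurable_const) auto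

lemma wtail_split:
  assumes fin: "finite J1" "finite J2" "J1 \<inter> J2 = {}" and b: "\<And>j. j \<in> J1 \<Longrightarrow> b j = 1"
  shows "wtail (J2 \<union> J1) b s = (\<integral>y. chi_tail J1 (s - wsum J2 b y) \<partial>sgauss J2)"
proof -
  let ?D = "density lborel (\<lambda>x. ennreal (normal_density 0 1 x))" and ?J = "J2 \<union> J1"
  interpret product_prob_space "\<lambda>_. ?D"
    by (rule product_prob_spaceI) (auto intro!: prob_space_normal_density)
  interpret S1: prob_space "sgauss J1" by (rule prob_space_sgauss)
  have sg: "sgauss I = PiM I (\<lambda>_. ?D)" for I by (simp add: sgauss_def gauss_def)
  let ?A = "{x \<in> space (leb ?J). s < wsum ?J b x}"
  have A: "?A \<in> sets (sgauss ?J)" by (rule sets_sgauss_less) measurable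
  have "emeasure (sgauss ?J) ?A = (\<integral>\<^sup>+x. indicator ?A x \<partial>sgauss ?J)" using A by simp
  also have "\<dots> = (\<integral>\<^sup>+y. (\<integral>\<^sup>+x. indicator ?A (merge J2 J1 (y, x)) \<partial>sgauss J1) \<partial>sgauss J2)"
    unfolding sg by (rule product_nn_integral_fold) (use fin A in \<open>auto simp: sg\<close>)
  also have "\<dots> = (\<integral>\<^sup>+y. ennreal (chi_tail J1 (s - wsum J2 b y)) \<partial>sgauss J2)"
  proof (rule nn_integral_cong)
    fix y assume y: "y \<in> space (sgauss J2)"
    let ?B = "{x \<in> space (leb J1). s - wsum J2 b y < half_norm J1 x}"
    have "(\<integral>\<^sup>+x. indicator ?A (merge J2 J1 (y, x)) \<partial>sgauss J1) = (\<integral>\<^sup>+x. indicator ?B x \<partial>sgauss J1)"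
    proof (rule nn_integral_cong)
      fix x assume x: "x \<in> space (sgauss J1)"
      have m: "merge J2 J1 (y, x) \<in> space (leb ?J)" using fin by (auto simp: space_PiM PiE_def extensional_merge)
      have "wsum ?J b (merge J2 J1 (y, x)) = wsum J2 b y + half_norm J1 x"
      proof -
        have "(\<Sum>j\<in>?J. b j * (merge J2 J1 (y, x) j)\<^sup>2) = (\<Sum>j\<in>J2. b j * (merge J2 J1 (y, x) j)\<^sup>2) + (\<Sum>j\<in>J1. b j * (merge J2 J1 (y, x) j)\<^sup>2)"
          using fin by (intro sum.union_disjoint) auto
        also have "(\<Sum>j\<in>J2. b j * (merge J2 J1 (y, x) j)\<^sup>2) = (\<Sum>j\<in>J2. b j * (y j)\<^sup>2)"
          using fin by (intro sum.cong refl) (simp add: merge_def)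
        also have "(\<Sum>j\<in>J1. b j * (merge J2 J1 (y, x) j)\<^sup>2) = (\<Sum>j\<in>J1. (x j)\<^sup>2)"
          using fin b by (intro sum.cong refl) (auto simp: merge_def)
        finally show ?thesis by (simp add: wsum_def half_norm_def add_divide_distrib)
      qed
      then show "indicator ?A (merge J2 J1 (y, x)) = (indicator ?B x :: ennreal)"
        using m x by (auto simp: indicator_def space_sgauss space_PiM)
    qed
    also have "\<dots> = emeasure (sgauss J1) ?B"
      by (rule nn_integral_indicator) (rule sets_sgauss_less[OF measurable_half_norm])
    also have "\<dots> = ennreal (chi_tail J1 (s - wsum J2 b y))"
      by (simp add: chi_tail_def S1.emeasure_eq_measure)
    finally show "(\<integral>\<^sup>+x. indicator ?A (merge J2 J1 (y, x)) \<partial>sgauss J1) = \<dots>" .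
  qed
  finally have e: "emeasure (sgauss ?J) ?A = (\<integral>\<^sup>+y. ennreal (chi_tail J1 (s - wsum J2 b y)) \<partial>sgauss J2)" .
  have m: "(\<lambda>y. chi_tail J1 (s - wsum J2 b y)) \<in> borel_measurable (sgauss J2)"
    unfolding measurable_sgauss_iff by (intro measurable_compose[OF _ measurable_chi_tail]) measurable
  show ?thesis unfolding wtail_def measure_def e
    by (rule integral_eq_nn_integral[OF m, symmetric]) (simp add: chi_tail_nonneg)
qed

text \<open>Tilting the standard normal density by \<open>exp (b * x\<^sup>2 / 2)\<close> gives a
  multiple of the centred normal density with variance \<open>1 / (1 - b)\<close>. The factors under
  the square roots of \<open>c_m\<close> and \<open>c_star\<close> originate here.\<close>

lemma has_bochner_integral_exp_square:
  assumes "b < 1"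
  shows "has_bochner_integral (density lborel (\<lambda>x. ennreal (normal_density 0 1 x))) (\<lambda>x. exp (b * x\<^sup>2 / 2)) (1 / sqrt (1 - b))"
proof -
  define \<sigma> where "\<sigma> = 1 / sqrt (1 - b)"
  have \<sigma>: "\<sigma> > 0" "1 / \<sigma>\<^sup>2 = 1 - b" using assms by (auto simp: \<sigma>_def power_divide)
  have "has_bochner_integral lborel (normal_density 0 \<sigma>) 1"
    unfolding has_bochner_integral_iff using \<sigma>(1) integrable_normal_density integral_normal_density by auto
  then have h: "has_bochner_integral lborel (\<lambda>x. \<sigma> * normal_density 0 \<sigma> x) (\<sigma> * 1)"
    by (rule has_bochner_integral_mult_right)
  have "\<sigma> * normal_density 0 \<sigma> x = normal_density 0 1 x *\<^sub>R exp (b * x\<^sup>2 / 2)" for x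
  proof -
    have "- x\<^sup>2 / (2 * \<sigma>\<^sup>2) = - x\<^sup>2 / 2 * (1 / \<sigma>\<^sup>2)" by simp
    also have "\<dots> = - x\<^sup>2 / 2 + b * x\<^sup>2 / 2" unfolding \<sigma>(2) by (simp add: field_simps)
    finally have e: "exp (- x\<^sup>2 / (2 * \<sigma>\<^sup>2)) = exp (- x\<^sup>2 / 2) * exp (b * x\<^sup>2 / 2)"
      by (simp only: exp_add)
    have "sqrt (2 * pi * \<sigma>\<^sup>2) = sqrt (2 * pi) * \<sigma>" using \<sigma>(1) by (simp add: real_sqrt_mult)
    then show ?thesis using \<sigma>(1) e by (simp add: normal_density_def)
  qed
  then have "has_bochner_integral lborel (\<lambda>x. normal_density 0 1 x *\<^sub>R exp (b * x\<^sup>2 / 2)) \<sigma>" using h by simp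
  then show ?thesis unfolding \<sigma>_def
    by (subst has_bochner_integral_density) auto
qed

lemma sgauss_exp_wsum:
  assumes "finite J" "\<And>j. j \<in> J \<Longrightarrow> b j < 1"
  shows "integrable (sgauss J) (\<lambda>x. exp (wsum J b x))"
    "(\<integral>x. exp (wsum J b x) \<partial>sgauss J) = (\<Prod>j\<in>J. 1 / sqrt (1 - b j))"
proof -
  let ?D = "density lborel (\<lambda>x. ennreal (normal_density 0 1 x))"
  interpret product_prob_space "\<lambda>_. ?D"
    by (rule product_prob_spaceI) (auto intro!: prob_space_normal_density)
  have e: "exp (wsum J b x) = (\<Prod>j\<in>J. exp (b j * (x j)\<^sup>2 / 2))" for x
    using assms(1) by (simp add: wsum_def sum_divide_distrib exp_sum)
  have h: "integrable ?D (\<lambda>x. exp (b j * x\<^sup>2 / 2))" "(\<integral>x. exp (b j * x\<^sup>2 / 2) \<partial>?D) = 1 / sqrt (1 - b j)" if "j \<in> J" for j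
    using has_bochner_integral_exp_square[OF assms(2)[OF that]] by (auto simp: has_bochner_integral_iff)
  show "integrable (sgauss J) (\<lambda>x. exp (wsum J b x))"
    unfolding e sgauss_def gauss_def by (rule product_integrable_prod[OF assms(1) h(1)])
  show "(\<integral>x. exp (wsum J b x) \<partial>sgauss J) = (\<Prod>j\<in>J. 1 / sqrt (1 - b j))"
    unfolding e sgauss_def gauss_def by (subst product_integral_prod[OF assms(1) h(1)]) (auto simp: h(2))
qed

text \<open>Since finitely many weights lie strictly below 1, a little room remains for an extra
  factor \<open>exp (\<eta> * \<bar>Z\<bar>)\<close> without losing the exponential moment.\<close>

lemma ex_slack:
  assumes "finite J" "\<And>j. j \<in> J \<Longrightarrow> b j < (1::real)"
  shows "\<exists>\<eta>>0. \<forall>j\<in>J. b j + \<eta> * \<bar>b j\<bar> < 1"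
proof -
  have "\<forall>\<^sub>F \<eta> in at_right 0. b j + \<eta> * \<bar>b j\<bar> < 1" if "j \<in> J" for j
  proof -
    have "((\<lambda>\<eta>. b j + \<eta> * \<bar>b j\<bar>) \<longlongrightarrow> b j + 0 * \<bar>b j\<bar>) (at_right 0)" by (intro tendsto_intros)
    then show ?thesis using assms(2)[OF that] by (intro order_tendstoD(2)) auto
  qed
  then have "\<forall>\<^sub>F \<eta> in at_right 0. \<forall>j\<in>J. b j + \<eta> * \<bar>b j\<bar> < 1"
    using assms(1) by (simp add: eventually_ball_finite)
  then have "\<forall>\<^sub>F \<eta> in at_right 0. (\<forall>j\<in>J. b j + \<eta> * \<bar>b j\<bar> < 1) \<and> \<eta> > 0"
    by (intro eventually_conj) (auto simp: eventually_at_right_less)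
  then show ?thesis using eventually_happens[of _ "at_right (0::real)"] by auto
qed

text \<open>Given the contribution \<open>Z\<close> of the weights below 1, the rest is a chi-square
  tail at \<open>s - Z\<close>, which asymptotically is \<open>exp Z\<close> times the tail at
  \<open>s\<close>. The expectation of \<open>exp Z\<close> is the product of the factors
  \<open>1 / sqrt (1 - b j)\<close>.\<close>

lemma wtail_asymp:
  assumes J: "finite J" and b1: "\<And>j. j \<in> J \<Longrightarrow> b j \<le> 1" and ne: "{j \<in> J. b j = 1} \<noteq> {}"
  defines "m \<equiv> card {j \<in> J. b j = 1}"
  shows "((\<lambda>s. wtail J b s * exp s * s powr (1 - real m / 2)) \<longlongrightarrow>
     1 / (Gamma (real m / 2) * sqrt (\<Prod>j\<in>{j\<in>J. b j \<noteq> 1}. 1 - b j))) at_top"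
proof -
  define J1 where "J1 = {j \<in> J. b j = 1}"
  define J2 where "J2 = {j \<in> J. b j \<noteq> 1}"
  have fin: "finite J1" "finite J2" "J1 \<inter> J2 = {}" "J2 \<union> J1 = J" using J by (auto simp: J1_def J2_def)
  have J1: "J1 \<noteq> {}" "card J1 = m" using ne by (auto simp: J1_def m_def)
  have b2: "b j < 1" if "j \<in> J2" for j using b1[of j] that by (auto simp: J2_def)
  define p where "p = real m / 2 - 1"
  define Z where "Z = wsum J2 b"
  obtain C where C: "C \<ge> 1" "\<And>s. s \<ge> 0 \<Longrightarrow> chi_tail J1 s \<le> C * ((1 + s) powr p * exp (- s))"
    using chi_tail_bound[OF fin(1) J1(1)] by (auto simp: p_def J1(2))
  obtain \<eta> where \<eta>: "\<eta> > 0" "\<And>j. j \<in> J2 \<Longrightarrow> b j + \<eta> * \<bar>b j\<bar> < 1" using ex_slack[of J2 b] fin b2 by auto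
  obtain C' where C': "C' > 0" "\<And>v. v \<ge> 0 \<Longrightarrow> (2 + v) powr \<bar>p\<bar> \<le> C' * exp (\<eta> * v)"
    using powr_le_exp[OF \<eta>(1), of "\<bar>p\<bar>"] by auto
  \<comment> \<open>Weights enlarged by the slack: \<open>wsum J2 b'\<close> dominates
    \<open>Z + \<eta> * \<bar>Z\<bar>\<close> and still has a finite exponential moment.\<close>
  define b' where "b' j = b j + \<eta> * \<bar>b j\<bar>" for j
  define w where "w y = C * C' * exp (wsum J2 b' y)" for y
  have w: "integrable (sgauss J2) w"
    unfolding w_def by (intro integrable_mult_right sgauss_exp_wsum fin) (use \<eta> in \<open>auto simp: b'_def\<close>)
  have Zb: "Z y + \<eta> * \<bar>Z y\<bar> \<le> wsum J2 b' y" for y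
  proof -
    have "\<bar>Z y\<bar> \<le> (\<Sum>j\<in>J2. \<bar>b j\<bar> * (y j)\<^sup>2) / 2"
      unfolding Z_def wsum_def using sum_abs[of "\<lambda>j. b j * (y j)\<^sup>2" J2] by (simp add: abs_mult)
    then have "Z y + \<eta> * \<bar>Z y\<bar> \<le> Z y + \<eta> * ((\<Sum>j\<in>J2. \<bar>b j\<bar> * (y j)\<^sup>2) / 2)" using \<eta> by simp
    also have "\<dots> = wsum J2 b' y"
      by (simp add: Z_def wsum_def b'_def sum_distrib_left sum.distrib algebra_simps add_divide_distrib)
    finally show ?thesis .
  qed
  define R where "R s z = chi_tail J1 (s - z) * exp s * s powr (- p)" for s z
  \<comment> \<open>For \<open>z < s\<close> the global chi-square bound applies and the ratio of
    the powers of \<open>1 + (s - z)\<close> and \<open>s\<close> costs a power of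
    \<open>2 + \<bar>z\<bar>\<close>. For \<open>z \<ge> s\<close> the tail is at most 1 and
    \<open>exp s \<le> exp z\<close>.\<close>
  have Rb: "R s z \<le> C * ((2 + \<bar>z\<bar>) powr \<bar>p\<bar> * exp z)" if s: "s \<ge> 1" for s z
  proof (cases "z < s")
    case True
    define d where "d = s - z"
    have d: "d > 0" "s = d + z" using True by (auto simp: d_def)
    have "((1 + d) / s) powr p \<le> (2 + \<bar>z\<bar>) powr \<bar>p\<bar>"
    proof (rule powr_le_powr_abs)
      show "0 < (1 + d) / s" using d s by simp
      have "1 + d \<le> s * (2 + \<bar>z\<bar>)"
      proof -
        have "1 + d \<le> s + s + \<bar>z\<bar>" using d s by linarith
        also have "\<dots> \<le> s + s + s * \<bar>z\<bar>" using s mult_right_mono[of 1 s "\<bar>z\<bar>"] by simp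
        finally show ?thesis by (simp add: algebra_simps)
      qed
      then show "(1 + d) / s \<le> 2 + \<bar>z\<bar>" using s by (simp add: field_simps)
      have "s \<le> (1 + d) * (2 + \<bar>z\<bar>)"
      proof -
        have "s \<le> d + \<bar>z\<bar>" using d by linarith
        also have "\<dots> \<le> 2 + \<bar>z\<bar> + d * 2 + d * \<bar>z\<bar>" using d by simp
        finally show ?thesis by (simp add: algebra_simps)
      qed
      then show "1 / ((1 + d) / s) \<le> 2 + \<bar>z\<bar>" using d s by (simp add: field_simps)
    qed
    then have pw: "(1 + d) powr p * s powr (- p) \<le> (2 + \<bar>z\<bar>) powr \<bar>p\<bar>"
      using d s by (simp add: powr_divide powr_minus_divide)
    have "R s z \<le> (C * ((1 + d) powr p * exp (- d))) * exp s * s powr (- p)"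
      unfolding R_def d_def[symmetric] using C(2)[of d] d by (intro mult_right_mono) auto
    also have "\<dots> = C * (((1 + d) powr p * s powr (- p)) * (exp (- d) * exp s))" by (simp add: mult_ac)
    also have "exp (- d) * exp s = exp z" using d by (simp add: exp_add[symmetric])
    also have "C * (((1 + d) powr p * s powr (- p)) * exp z) \<le> C * ((2 + \<bar>z\<bar>) powr \<bar>p\<bar> * exp z)"
      using C(1) pw by (intro mult_left_mono mult_right_mono) auto
    finally show ?thesis .
  next
    case False
    have "1 / s \<le> 1" using s by simp
    then have "1 / s \<le> 2 + \<bar>z\<bar>" "s \<le> 2 + \<bar>z\<bar>" "0 < s" using s False by linarith+
    then have "s powr (- p) \<le> (2 + \<bar>z\<bar>) powr \<bar>p\<bar>"
      using powr_le_powr_abs[of s "2 + \<bar>z\<bar>" "- p"] by simp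
    then have "R s z \<le> (1 * exp z) * (2 + \<bar>z\<bar>) powr \<bar>p\<bar>"
      unfolding R_def using False chi_tail_le_1 chi_tail_nonneg by (intro mult_mono) auto
    also have "\<dots> \<le> C * (exp z * (2 + \<bar>z\<bar>) powr \<bar>p\<bar>)"
      using mult_right_mono[OF C(1), of "exp z * (2 + \<bar>z\<bar>) powr \<bar>p\<bar>"] by simp
    finally show ?thesis by (simp add: mult.commute)
  qed
  have "((\<lambda>s. \<integral>y. R s (Z y) \<partial>sgauss J2) \<longlongrightarrow> (\<integral>y. 1 / Gamma (real m / 2) * exp (Z y) \<partial>sgauss J2)) at_top"
  proof (rule integral_dominated_convergence_at_top[where w=w])
    show "AE y in sgauss J2. ((\<lambda>s. R s (Z y)) \<longlongrightarrow> 1 / Gamma (real m / 2) * exp (Z y)) at_top"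
    proof (rule AE_I2)
      fix y
      define z where "z = Z y"
      have t: "filterlim (\<lambda>s. s - z) at_top at_top" by real_asymp
      have "((\<lambda>s. chi_tail J1 s * exp s * s powr (- p)) \<longlongrightarrow> 1 / Gamma (real m / 2)) at_top"
        using chi_tail_asymp[OF fin(1) J1(1)] by (simp add: J1(2) p_def)
      from filterlim_compose[OF this t]
      have l1: "((\<lambda>s. chi_tail J1 (s - z) * exp (s - z) * (s - z) powr (- p)) \<longlongrightarrow> 1 / Gamma (real m / 2)) at_top" .
      have l2: "((\<lambda>s. (s / (s - z)) powr (- p)) \<longlongrightarrow> 1) at_top" by real_asymp
      have "((\<lambda>s. (chi_tail J1 (s - z) * exp (s - z) * (s - z) powr (- p)) * exp z * (s / (s - z)) powr (- p))
          \<longlongrightarrow> 1 / Gamma (real m / 2) * exp z * 1) at_top" by (intro tendsto_mult l1 l2 tendsto_const)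
      then have "((\<lambda>s. (chi_tail J1 (s - z) * exp (s - z) * (s - z) powr (- p)) * exp z * (s / (s - z)) powr (- p))
          \<longlongrightarrow> 1 / Gamma (real m / 2) * exp z) at_top" by simp
      then have "((\<lambda>s. R s z) \<longlongrightarrow> 1 / Gamma (real m / 2) * exp z) at_top"
      proof (rule Lim_transform_eventually)
        show "\<forall>\<^sub>F s in at_top. (chi_tail J1 (s - z) * exp (s - z) * (s - z) powr (- p)) * exp z * (s / (s - z)) powr (- p) = R s z"
          using eventually_gt_at_top[of "max 0 z"]
        proof eventually_elim
          case (elim s)
          then have "(s - z) powr (- p) * (s / (s - z)) powr (- p) = s powr (- p)" by (simp add: powr_divide)
          moreover have "exp (s - z) * exp z = exp s" by (simp add: exp_add[symmetric])
          ultimately show ?case unfolding R_def by (metis (no_types, opaque_lifting) mult.assoc mult.left_commute)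
        qed
      qed
      then show "((\<lambda>s. R s (Z y)) \<longlongrightarrow> 1 / Gamma (real m / 2) * exp (Z y)) at_top" by (simp add: z_def)
    qed
    show "\<forall>\<^sub>F s in at_top. AE y in sgauss J2. norm (R s (Z y)) \<le> w y"
      using eventually_ge_at_top[of 1]
    proof eventually_elim
      case (elim s)
      show ?case
      proof (rule AE_I2)
        fix y
        have "norm (R s (Z y)) = R s (Z y)" unfolding R_def by (simp add: chi_tail_nonneg)
        also have "\<dots> \<le> C * ((2 + \<bar>Z y\<bar>) powr \<bar>p\<bar> * exp (Z y))" by (rule Rb[OF elim])
        also have "\<dots> \<le> C * ((C' * exp (\<eta> * \<bar>Z y\<bar>)) * exp (Z y))"
          using C(1) C'(2)[of "\<bar>Z y\<bar>"] by (intro mult_left_mono mult_right_mono) auto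
        also have "\<dots> = C * C' * exp (Z y + \<eta> * \<bar>Z y\<bar>)" by (simp add: exp_add mult_ac)
        also have "\<dots> \<le> w y" unfolding w_def using Zb[of y] C C' by (intro mult_left_mono) auto
        finally show "norm (R s (Z y)) \<le> w y" .
      qed
    qed
    have Zm: "Z \<in> borel_measurable (sgauss J2)" unfolding Z_def measurable_sgauss_iff by measurable
    show "(\<lambda>y. 1 / Gamma (real m / 2) * exp (Z y)) \<in> borel_measurable (sgauss J2)" using Zm by measurable
    show "(\<lambda>y. R s (Z y)) \<in> borel_measurable (sgauss J2)" for s
      unfolding R_def using Zm by (intro borel_measurable_times measurable_compose[OF _ measurable_chi_tail]) auto
  qed (rule w)
  also have "(\<integral>y. 1 / Gamma (real m / 2) * exp (Z y) \<partial>sgauss J2) = 1 / (Gamma (real m / 2) * sqrt (\<Prod>j\<in>J2. 1 - b j))"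
  proof -
    have "(\<integral>y. exp (Z y) \<partial>sgauss J2) = (\<Prod>j\<in>J2. 1 / sqrt (1 - b j))"
      unfolding Z_def by (rule sgauss_exp_wsum(2)[OF fin(2) b2])
    also have "\<dots> = 1 / sqrt (\<Prod>j\<in>J2. 1 - b j)"
      by (simp add: prod_dividef) (induction J2 rule: infinite_finite_induct; simp add: real_sqrt_mult)
    finally show ?thesis by simp
  qed
  also have "(\<lambda>s. \<integral>y. R s (Z y) \<partial>sgauss J2) = (\<lambda>s. wtail J b s * exp s * s powr (1 - real m / 2))"
  proof
    fix s
    have "wtail J b s = (\<integral>y. chi_tail J1 (s - Z y) \<partial>sgauss J2)"
      using wtail_split[OF fin(1-3), of b s] fin(4) by (simp add: Z_def J1_def)
    then show "(\<integral>y. R s (Z y) \<partial>sgauss J2) = wtail J b s * exp s * s powr (1 - real m / 2)"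
      by (simp add: R_def p_def)
  qed
  finally show ?thesis unfolding J2_def .
qed

text \<open>A Chernoff bound: with all weights below 1 the exponential moment is finite at some rate
  \<open>1 + \<eta> > 1\<close>, so the tail decays faster than \<open>exp (- s)\<close> by an
  exponential factor.\<close>

lemma wtail_negligible:
  assumes J: "finite J" and b: "\<And>j. j \<in> J \<Longrightarrow> b j < 1"
  shows "((\<lambda>s. wtail J b s * exp s * s powr q) \<longlongrightarrow> 0) at_top"
proof -
  interpret prob_space "sgauss J" by (rule prob_space_sgauss)
  obtain \<eta> where \<eta>: "\<eta> > 0" "\<And>j. j \<in> J \<Longrightarrow> b j + \<eta> * \<bar>b j\<bar> < 1" using ex_slack[of J b] J b by auto
  define b' where "b' j = (1 + \<eta>) * b j" for j
  have b': "b' j < 1" if "j \<in> J" for j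
  proof -
    have "\<eta> * b j \<le> \<eta> * \<bar>b j\<bar>" using \<eta>(1) by (intro mult_left_mono) auto
    then show ?thesis using \<eta>(2)[OF that] by (simp add: b'_def algebra_simps)
  qed
  define E where "E = (\<integral>x. exp (wsum J b' x) \<partial>sgauss J)"
  have ub: "wtail J b s \<le> E * exp (- (1 + \<eta>) * s)" for s
  proof -
    have "wtail J b s \<le> measure (sgauss J) {x \<in> space (sgauss J). exp ((1 + \<eta>) * s) \<le> exp (wsum J b' x)}"
      unfolding wtail_def
    proof (rule finite_measure_mono)
      show "{x \<in> space (leb J). s < wsum J b x} \<subseteq> {x \<in> space (sgauss J). exp ((1 + \<eta>) * s) \<le> exp (wsum J b' x)}"
      proof (rule subsetI)
        fix x assume x: "x \<in> {x \<in> space (leb J). s < wsum J b x}"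
        moreover have "wsum J b' x = (1 + \<eta>) * wsum J b x"
          by (simp add: wsum_def b'_def sum_distrib_left mult_ac)
        ultimately show "x \<in> {x \<in> space (sgauss J). exp ((1 + \<eta>) * s) \<le> exp (wsum J b' x)}"
          using \<eta>(1) by (auto simp: space_sgauss space_PiM)
      qed
      have "(\<lambda>x. exp (wsum J b' x)) \<in> borel_measurable (sgauss J)" unfolding measurable_sgauss_iff by measurable
      then show "{x \<in> space (sgauss J). exp ((1 + \<eta>) * s) \<le> exp (wsum J b' x)} \<in> sets (sgauss J)" by measurable
    qed
    also have "\<dots> \<le> E / exp ((1 + \<eta>) * s)"
      unfolding E_def by (rule integral_Markov_inequality_measure[where A="{}"])
        (auto intro!: sgauss_exp_wsum J b')
    also have "E / exp ((1 + \<eta>) * s) = E * exp (- (1 + \<eta>) * s)"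
      by (metis exp_minus divide_inverse minus_mult_left)
    finally show ?thesis .
  qed
  have "E \<ge> 0" unfolding E_def by simp
  show ?thesis
  proof (rule tendsto_sandwich)
    show "\<forall>\<^sub>F s in at_top. 0 \<le> wtail J b s * exp s * s powr q" by (simp add: wtail_def)
    show "\<forall>\<^sub>F s in at_top. wtail J b s * exp s * s powr q \<le> E * (exp (- (1 + \<eta>) * s) * exp s * s powr q)"
      using mult_right_mono[OF mult_right_mono[OF ub], of "exp _" "_ powr q"] by (simp add: mult.assoc)
    have "((\<lambda>s. exp (- \<eta> * s) * s powr q) \<longlongrightarrow> 0) at_top" using \<eta>(1) by real_asymp
    moreover have "exp (- (1 + \<eta>) * s) * exp s = exp (- \<eta> * s)" for s
      by (simp add: exp_add[symmetric] algebra_simps)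
    ultimately have "((\<lambda>s. exp (- (1 + \<eta>) * s) * exp s * s powr q) \<longlongrightarrow> 0) at_top" by (simp only:)
    from tendsto_mult_left[OF this, of E]
    show "((\<lambda>s. E * (exp (- (1 + \<eta>) * s) * exp s * s powr q)) \<longlongrightarrow> 0) at_top" by simp
  qed simp
qed

section \<open>Gaussian mass of small ellipsoids\<close>

lemma emeasure_leb_scale:
  assumes J: "finite J" and s: "\<And>j. j \<in> J \<Longrightarrow> s j > 0" and A: "A \<in> sets (leb J)"
  shows "(\<Prod>j\<in>J. ennreal (s j)) * emeasure (leb J) {x \<in> space (leb J). (\<lambda>j\<in>J. s j * x j) \<in> A} = emeasure (leb J) A"
proof -
  interpret product_sigma_finite "\<lambda>_. lborel :: real measure" by standard
  let ?T = "\<lambda>x. \<lambda>j\<in>J. s j * x j"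
  have T [measurable]: "?T \<in> measurable (leb J) (leb J)"
    by (intro measurable_restrict) measurable
  have one: "ennreal (s j) * emeasure lborel ((\<lambda>x. s j * x) -` B) = emeasure lborel B" if "j \<in> J" "B \<in> sets borel" for j B
  proof -
    have "emeasure lborel B = emeasure (density (distr lborel borel ((*) (s j))) (\<lambda>_. ennreal \<bar>s j\<bar>)) B"
      using lborel_distr_mult'[of "s j"] s[OF that(1)] by simp
    also have "\<dots> = ennreal (s j) * emeasure (distr lborel borel ((*) (s j))) B"
      using that s[OF that(1)] by (subst emeasure_density) (auto simp: nn_integral_cmult_indicator)
    also have "emeasure (distr lborel borel ((*) (s j))) B = emeasure lborel ((\<lambda>x. s j * x) -` B)"
      using that by (subst emeasure_distr) auto
    finally show ?thesis by simp
  qed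
  have eq: "density (distr (leb J) (leb J) ?T) (\<lambda>_. \<Prod>j\<in>J. ennreal (s j)) = leb J"
  proof (rule PiM_eqI)
    show "finite J" by fact
    fix B :: "'a \<Rightarrow> real set" assume B: "\<And>i. i \<in> J \<Longrightarrow> B i \<in> sets lborel"
    have BB: "Pi\<^sub>E J B \<in> sets (leb J)" using B J by (intro sets_PiM_I_finite) auto
    have "emeasure (density (distr (leb J) (leb J) ?T) (\<lambda>_. \<Prod>j\<in>J. ennreal (s j))) (Pi\<^sub>E J B)
        = (\<Prod>j\<in>J. ennreal (s j)) * emeasure (distr (leb J) (leb J) ?T) (Pi\<^sub>E J B)"
      using BB by (subst emeasure_density) (auto simp: nn_integral_cmult_indicator)
    also have "emeasure (distr (leb J) (leb J) ?T) (Pi\<^sub>E J B) = emeasure (leb J) (?T -` Pi\<^sub>E J B \<inter> space (leb J))"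
      using BB by (intro emeasure_distr) auto
    also have "?T -` Pi\<^sub>E J B \<inter> space (leb J) = (\<Pi>\<^sub>E j\<in>J. (\<lambda>x. s j * x) -` B j)"
      by (auto simp: space_PiM PiE_iff)
    also have "emeasure (leb J) \<dots> = (\<Prod>j\<in>J. emeasure lborel ((\<lambda>x. s j * x) -` B j))"
      using B J measurable_sets[of "\<lambda>x. s _ * x" borel borel] by (intro emeasure_PiM) auto
    also have "(\<Prod>j\<in>J. ennreal (s j)) * \<dots> = (\<Prod>j\<in>J. emeasure lborel (B j))"
      unfolding prod.distrib[symmetric] using B by (intro prod.cong refl one) auto
    finally show "emeasure (density (distr (leb J) (leb J) ?T) (\<lambda>_. \<Prod>j\<in>J. ennreal (s j))) (Pi\<^sub>E J B) = \<dots>" .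
  qed simp
  have "emeasure (leb J) A = emeasure (density (distr (leb J) (leb J) ?T) (\<lambda>_. \<Prod>j\<in>J. ennreal (s j))) A"
    unfolding eq ..
  also have "\<dots> = (\<Prod>j\<in>J. ennreal (s j)) * emeasure (distr (leb J) (leb J) ?T) A"
    using A by (subst emeasure_density) (auto simp: nn_integral_cmult_indicator)
  also have "emeasure (distr (leb J) (leb J) ?T) A = emeasure (leb J) (?T -` A \<inter> space (leb J))"
    using A by (intro emeasure_distr) auto
  also have "?T -` A \<inter> space (leb J) = {x \<in> space (leb J). ?T x \<in> A}" by auto
  finally show ?thesis by simp
qed

definition small_ball :: "'i set \<Rightarrow> ('i \<Rightarrow> real) \<Rightarrow> real \<Rightarrow> real" where
  "small_ball J c u = measure (sgauss J) {x \<in> space (leb J). wsum J c x \<le> u}"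

text \<open>Stretching coordinate \<open>j\<close> by \<open>sqrt (c j)\<close> maps the ellipsoid
  to a ball of known volume. On the ellipsoid \<open>half_norm\<close> is at most
  \<open>u / Min (c\<close> J)\<open>, so the density varies only between its maximum and\<close>exp
  (- u / Min (c \<open>J))\<close> times that.\<close>

lemma small_ball_bounds:
  assumes J: "finite J" "J \<noteq> {}" and c: "\<And>j. j \<in> J \<Longrightarrow> c j > 0" and u: "u > 0"
  defines "V \<equiv> u powr (real (card J) / 2) / (Gamma (real (card J) / 2 + 1) * sqrt (\<Prod>j\<in>J. c j))"
  shows "small_ball J c u \<le> V" "exp (- u / Min (c ` J)) * V \<le> small_ball J c u"
proof -
  interpret prob_space "sgauss J" by (rule prob_space_sgauss)
  let ?m = "real (card J) / 2"
  define G where "G = Gamma (?m + 1)"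
  have G: "G > 0" unfolding G_def by (intro Gamma_real_pos) simp
  define d where "d = (2 * pi) powr (- ?m)"
  have d: "d > 0" "d * (2 * pi) powr ?m = 1" by (simp_all add: d_def powr_minus_divide)
  define P where "P = (\<Prod>j\<in>J. c j)"
  have P: "P > 0" unfolding P_def using c by (intro prod_pos) auto
  define c0 where "c0 = Min (c ` J)"
  have c0: "c0 > 0" "\<And>j. j \<in> J \<Longrightarrow> c0 \<le> c j" using J c by (auto simp: c0_def)
  let ?A = "{x \<in> space (leb J). wsum J c x \<le> u}"
  have A [measurable]: "?A \<in> sets (leb J)" by measurable
  have volA: "emeasure (leb J) ?A = ennreal ((2 * pi) powr ?m * V)"
  proof -
    have "(\<Prod>j\<in>J. ennreal (sqrt (c j))) * emeasure (leb J) {x \<in> space (leb J). (\<lambda>j\<in>J. sqrt (c j) * x j) \<in> {x \<in> space (leb J). half_norm J x \<le> u}}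
        = emeasure (leb J) {x \<in> space (leb J). half_norm J x \<le> u}"
      by (rule emeasure_leb_scale[OF J(1)]) (use c in auto)
    also have "{x \<in> space (leb J). (\<lambda>j\<in>J. sqrt (c j) * x j) \<in> {x \<in> space (leb J). half_norm J x \<le> u}} = ?A"
    proof -
      have "half_norm J (\<lambda>j\<in>J. sqrt (c j) * x j) = wsum J c x" for x
        using c unfolding half_norm_def wsum_def
        by (intro arg_cong2[where f="(/)"] sum.cong refl) (auto simp: power_mult_distrib less_imp_le)
      then show ?thesis by (auto simp: space_PiM)
    qed
    also have "(\<Prod>j\<in>J. ennreal (sqrt (c j))) = ennreal (sqrt P)"
    proof -
      have "(\<Prod>j\<in>J. ennreal (sqrt (c j))) = ennreal (\<Prod>j\<in>J. sqrt (c j))"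
        using c by (intro prod_ennreal) (auto intro: less_imp_le)
      also have "(\<Prod>j\<in>J. sqrt (c j)) = sqrt P"
        unfolding P_def using J(1) by (induction J) (auto simp: real_sqrt_mult)
      finally show ?thesis .
    qed
    finally have e: "ennreal (sqrt P) * emeasure (leb J) ?A = ennreal ((2 * pi) powr ?m / G * u powr ?m)"
      unfolding emeasure_leb_half_norm_le[OF J(1) u] G_def .
    have "emeasure (leb J) ?A = ennreal (1 / sqrt P) * (ennreal (sqrt P) * emeasure (leb J) ?A)"
      using P by (simp add: mult.assoc[symmetric] ennreal_mult'[symmetric])
    also have "\<dots> = ennreal (1 / sqrt P * ((2 * pi) powr ?m / G * u powr ?m))"
      unfolding e using P by (intro ennreal_mult'[symmetric]) auto
    also have "1 / sqrt P * ((2 * pi) powr ?m / G * u powr ?m) = (2 * pi) powr ?m * V"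
      by (simp add: V_def G_def P_def)
    finally show ?thesis .
  qed
  have V: "V \<ge> 0" unfolding V_def using G P by (auto simp: G_def P_def intro!: divide_nonneg_nonneg)
  have em: "emeasure (sgauss J) ?A = (\<integral>\<^sup>+x. ennreal (d * exp (- half_norm J x)) * indicator ?A x \<partial>leb J)"
    unfolding sgauss_density[OF J(1)] d_def by (subst emeasure_density) auto
  have fold: "(\<integral>\<^sup>+x. ennreal (d * r) * indicator ?A x \<partial>leb J) = ennreal (r * V)" if "r \<ge> 0" for r
  proof -
    have "(\<integral>\<^sup>+x. ennreal (d * r) * indicator ?A x \<partial>leb J) = ennreal (d * r) * ennreal ((2 * pi) powr ?m * V)"
      by (subst nn_integral_cmult_indicator) (auto simp: volA)
    also have "\<dots> = ennreal (d * r * ((2 * pi) powr ?m * V))"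
      using d that V by (intro ennreal_mult[symmetric]) auto
    also have "d * r * ((2 * pi) powr ?m * V) = (d * (2 * pi) powr ?m) * (r * V)" by simp
    finally show ?thesis using d by simp
  qed
  have "emeasure (sgauss J) ?A \<le> (\<integral>\<^sup>+x. ennreal (d * 1) * indicator ?A x \<partial>leb J)"
    unfolding em using d
    by (intro nn_integral_mono mult_right_mono ennreal_leI mult_left_mono)
       (auto simp: half_norm_def sum_nonneg)
  also have "\<dots> = ennreal (1 * V)" by (rule fold) simp
  finally show "small_ball J c u \<le> V"
    unfolding small_ball_def using V by (simp add: emeasure_eq_measure)
  have "ennreal (exp (- u / c0) * V) = (\<integral>\<^sup>+x. ennreal (d * exp (- u / c0)) * indicator ?A x \<partial>leb J)"
    by (rule fold[symmetric]) simp
  also have "\<dots> \<le> emeasure (sgauss J) ?A"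
    unfolding em
  proof (intro nn_integral_mono)
    fix x
    show "ennreal (d * exp (- u / c0)) * indicator ?A x \<le> ennreal (d * exp (- half_norm J x)) * indicator ?A x"
    proof (cases "x \<in> ?A")
      case True
      have "c0 * half_norm J x = (\<Sum>j\<in>J. c0 * (x j)\<^sup>2) / 2" by (simp add: half_norm_def sum_distrib_left)
      also have "\<dots> \<le> wsum J c x" unfolding wsum_def using c0
        by (intro divide_right_mono sum_mono mult_right_mono) auto
      also have "\<dots> \<le> u" using True by simp
      finally have "half_norm J x \<le> u / c0" using c0 by (simp add: field_simps)
      then show ?thesis using d by (intro mult_right_mono ennreal_leI mult_left_mono) auto
    qed simp
  qed
  finally show "exp (- u / Min (c ` J)) * V \<le> small_ball J c u"
    unfolding small_ball_def c0_def[symmetric] by (simp add: emeasure_eq_measure)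
qed

section \<open>From the law of one row to the extreme of many independent rows\<close>

lemma power_one_minus_tendsto:
  fixes p :: "nat \<Rightarrow> real"
  assumes lim: "(\<lambda>n. real n * p n) \<longlonglongrightarrow> c"
  shows "(\<lambda>n. (1 - p n) ^ n) \<longlonglongrightarrow> exp (- c)"
proof -
  have p0: "p \<longlonglongrightarrow> 0"
  proof -
    have "(\<lambda>n. real n * p n * (1 / real n)) \<longlonglongrightarrow> c * 0"
      by (intro tendsto_mult lim lim_1_over_n)
    then have "(\<lambda>n. real n * p n * (1 / real n)) \<longlonglongrightarrow> 0" by simp
    then show ?thesis
    proof (rule Lim_transform_eventually)
      show "\<forall>\<^sub>F n in sequentially. real n * p n * (1 / real n) = p n"
        by (rule eventually_mono[OF eventually_gt_at_top[of 0]]) simp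
    qed
  qed
  have ev: "\<forall>\<^sub>F n in sequentially. \<bar>p n\<bar> \<le> 1/2"
  proof -
    have "\<forall>\<^sub>F n in sequentially. \<bar>p n\<bar> < 1/2" using tendsto_rabs[OF p0] by (intro order_tendstoD) auto
    then show ?thesis by (rule eventually_mono) simp
  qed
  have "(\<lambda>n. real n * ln (1 - p n) + real n * p n) \<longlonglongrightarrow> 0"
  proof (rule Lim_null_comparison)
    show "\<forall>\<^sub>F n in sequentially. norm (real n * ln (1 - p n) + real n * p n) \<le> 2 * \<bar>real n * p n * p n\<bar>"
      using ev
    proof eventually_elim
      case (elim n)
      have "\<bar>ln (1 + - p n) - - p n\<bar> \<le> 2 * (- p n)\<^sup>2"
        by (rule abs_ln_one_plus_x_minus_x_bound) (use elim in simp)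
      then have "real n * \<bar>ln (1 - p n) + p n\<bar> \<le> real n * (2 * (p n)\<^sup>2)" by (intro mult_left_mono) auto
      moreover have "norm (real n * ln (1 - p n) + real n * p n) = real n * \<bar>ln (1 - p n) + p n\<bar>"
        by (simp add: distrib_left[symmetric] abs_mult)
      ultimately show ?case by (simp add: power2_eq_square abs_mult mult_ac)
    qed
    have "(\<lambda>n. 2 * \<bar>real n * p n * p n\<bar>) \<longlonglongrightarrow> 2 * \<bar>c * 0\<bar>" by (intro tendsto_intros lim p0)
    then show "(\<lambda>n. 2 * \<bar>real n * p n * p n\<bar>) \<longlonglongrightarrow> 0" by simp
  qed
  from tendsto_diff[OF this lim] have "(\<lambda>n. real n * ln (1 - p n)) \<longlonglongrightarrow> - c" by simp
  then have "(\<lambda>n. exp (real n * ln (1 - p n))) \<longlonglongrightarrow> exp (- c)" by (rule tendsto_exp)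
  then show ?thesis
  proof (rule Lim_transform_eventually)
    show "\<forall>\<^sub>F n in sequentially. exp (real n * ln (1 - p n)) = (1 - p n) ^ n"
      using ev by eventually_elim (simp add: exp_of_nat_mult)
  qed
qed

text \<open>At the level \<open>s = ln n - q * ln (ln n) + y\<close>, \<open>exp (- s)\<close>
  equals \<open>ln n powr q * exp (- y) / n\<close>, and \<open>s\<close> is asymptotic to
  \<open>ln n\<close>, so the powers of \<open>ln n\<close> cancel. Taking \<open>y\<close> as a
  convergent sequence leaves room for small perturbations of the level.\<close>

lemma gumbel_tail_limit:
  fixes T :: "real \<Rightarrow> real" and y :: "nat \<Rightarrow> real"
  assumes T: "((\<lambda>s. T s * exp s * s powr q) \<longlongrightarrow> K) at_top" and y: "y \<longlonglongrightarrow> y0"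
  shows "(\<lambda>n. real n * T (ln (real n) - q * ln (ln (real n)) + y n)) \<longlonglongrightarrow> K * exp (- y0)"
proof -
  define s where "s n = ln (real n) - q * ln (ln (real n)) + y n" for n
  have ln: "filterlim (\<lambda>n. ln (real n)) at_top sequentially" by real_asymp
  have ratio: "(\<lambda>n. s n / ln (real n)) \<longlonglongrightarrow> 1"
  proof -
    have "(\<lambda>n. (ln (real n) - q * ln (ln (real n))) / ln (real n)) \<longlonglongrightarrow> 1" by real_asymp
    moreover have "(\<lambda>n. y n * (1 / ln (real n))) \<longlonglongrightarrow> y0 * 0"
      by (intro tendsto_mult y) real_asymp
    ultimately have "(\<lambda>n. (ln (real n) - q * ln (ln (real n))) / ln (real n) + y n * (1 / ln (real n))) \<longlonglongrightarrow> 1 + y0 * 0"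
      by (rule tendsto_add)
    then show ?thesis by (simp add: s_def add_divide_distrib)
  qed
  have big: "\<forall>\<^sub>F n in sequentially. ln (real n) > 0" using ln by (simp add: filterlim_at_top_dense)
  have s: "filterlim s at_top sequentially"
  proof -
    have "filterlim (\<lambda>n. s n / ln (real n) * ln (real n)) at_top sequentially"
      by (rule filterlim_tendsto_pos_mult_at_top[OF ratio _ ln]) simp
    then show ?thesis
      by (rule filterlim_cong[THEN iffD1, rotated -1, OF _ refl refl]) (use big in \<open>auto elim!: eventually_mono\<close>)
  qed
  have 1: "(\<lambda>n. T (s n) * exp (s n) * s n powr q) \<longlonglongrightarrow> K" by (rule filterlim_compose[OF T s])
  have 2: "(\<lambda>n. (s n / ln (real n)) powr (- q)) \<longlonglongrightarrow> 1 powr (- q)" by (rule tendsto_powr[OF ratio tendsto_const]) simp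
  have 3: "(\<lambda>n. exp (- y n)) \<longlonglongrightarrow> exp (- y0)" by (intro tendsto_intros y)
  have "(\<lambda>n. (T (s n) * exp (s n) * s n powr q) * (s n / ln (real n)) powr (- q) * exp (- y n)) \<longlonglongrightarrow> K * 1 powr (- q) * exp (- y0)"
    by (intro tendsto_mult 1 2 3)
  then have "(\<lambda>n. (T (s n) * exp (s n) * s n powr q) * (s n / ln (real n)) powr (- q) * exp (- y n)) \<longlonglongrightarrow> K * exp (- y0)" by simp
  then show ?thesis unfolding s_def[symmetric]
  proof (rule Lim_transform_eventually)
    have "\<forall>\<^sub>F n in sequentially. s n > 0" using s by (simp add: filterlim_at_top_dense)
    with big eventually_gt_at_top[of 0]
    show "\<forall>\<^sub>F n in sequentially. (T (s n) * exp (s n) * s n powr q) * (s n / ln (real n)) powr (- q) * exp (- y n) = real n * T (s n)"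
    proof eventually_elim
      case (elim n)
      have a: "exp (s n) = real n * ln (real n) powr (- q) * exp (y n)"
        using elim by (simp add: s_def exp_add exp_diff powr_def exp_minus field_simps)
      have b: "(s n / ln (real n)) powr (- q) = s n powr (- q) * ln (real n) powr q"
        using elim by (simp add: powr_divide powr_minus_divide)
      have c: "s n powr q * s n powr (- q) = 1" "ln (real n) powr (- q) * ln (real n) powr q = 1" "exp (y n) * exp (- y n) = 1"
        using elim by (simp_all add: powr_add[symmetric] exp_add[symmetric])
      have "(T (s n) * exp (s n) * s n powr q) * (s n / ln (real n)) powr (- q) * exp (- y n)
         = real n * T (s n) * (s n powr q * s n powr (- q)) * (ln (real n) powr (- q) * ln (real n) powr q) * (exp (y n) * exp (- y n))"
        unfolding a b by (simp only: mult_ac)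
      then show ?case unfolding c by simp
    qed
  qed
qed

lemma small_ball_limit:
  assumes J: "finite J" "J \<noteq> {}" and c: "\<And>j. j \<in> J \<Longrightarrow> c j > 0"
    and u: "u \<longlonglongrightarrow> 0" "\<forall>\<^sub>F n in sequentially. u n > 0"
    and lim: "(\<lambda>n. real n * (u n powr (real (card J) / 2) / (Gamma (real (card J) / 2 + 1) * sqrt (\<Prod>j\<in>J. c j)))) \<longlonglongrightarrow> L"
  shows "(\<lambda>n. real n * small_ball J c (u n)) \<longlonglongrightarrow> L"
proof -
  define V where "V n = u n powr (real (card J) / 2) / (Gamma (real (card J) / 2 + 1) * sqrt (\<Prod>j\<in>J. c j))" for n
  have e: "(\<lambda>n. exp (- u n / Min (c ` J)) * (real n * V n)) \<longlonglongrightarrow> exp (- 0 / Min (c ` J)) * L"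
    unfolding V_def divide_inverse[of "- _" "Min (c ` J)"] by (intro tendsto_mult tendsto_exp tendsto_minus u tendsto_const lim)
  show ?thesis
  proof (rule tendsto_sandwich)
    show "\<forall>\<^sub>F n in sequentially. real n * small_ball J c (u n) \<le> real n * V n"
      using u(2) unfolding V_def
      by eventually_elim (rule mult_left_mono[OF small_ball_bounds(1)[OF J c]], auto)
    show "\<forall>\<^sub>F n in sequentially. exp (- u n / Min (c ` J)) * (real n * V n) \<le> real n * small_ball J c (u n)"
      using u(2)
    proof eventually_elim
      case (elim n)
      have "real n * (exp (- u n / Min (c ` J)) * V n) \<le> real n * small_ball J c (u n)"
        unfolding V_def by (rule mult_left_mono[OF small_ball_bounds(2)[OF J c elim]]) auto
      then show ?case by (simp add: mult_ac)
    qed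
    show "(\<lambda>n. exp (- u n / Min (c ` J)) * (real n * V n)) \<longlonglongrightarrow> L" using e by simp
    show "(\<lambda>n. real n * V n) \<longlonglongrightarrow> L" using lim by (simp add: V_def)
  qed
qed

section \<open>Extreme values\<close>

text \<open>The exponent has to satisfy two requirements: \<open>N * (eps N)\<^sup>2\<close> tends
  to infinity, for Chebyshev's inequality, and \<open>eps N * ln N\<close> tends to 0, for the
  errors in the largest rows.\<close>

definition eps :: "nat \<Rightarrow> real" where
  "eps N = real N powr (- 1/4)"

lemma eps_pos: "N > 0 \<Longrightarrow> eps N > 0"
  by (simp add: eps_def)

lemma eps_tendsto: "eps \<longlonglongrightarrow> 0"
  unfolding eps_def[abs_def] by real_asymp

definition near_event :: "nat \<Rightarrow> nat \<Rightarrow> (nat \<times> nat \<Rightarrow> real) set" where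
  "near_event N k = {w \<in> space (matgauss N k). near_orthonormal N k (eps N) (gauss_column N w)}"

lemma sets_near_event: "near_event N k \<in> sets (matgauss N k)"
  unfolding near_event_def by (rule sets_near)

lemma prob_near_event_tendsto:
  assumes "k > 0"
  shows "(\<lambda>N. measure (matgauss N k) (near_event N k)) \<longlonglongrightarrow> 1"
proof (rule tendsto_sandwich)
  show "\<forall>\<^sub>F N in sequentially. 1 - 2 * (real k)\<^sup>2 * (1 / (real N * (eps N)\<^sup>2)) \<le> measure (matgauss N k) (near_event N k)"
    using eventually_gt_at_top[of 0]
    by eventually_elim (use prob_not_near_orthonormal[OF _ assms eps_pos] in \<open>simp add: near_event_def\<close>)
  show "\<forall>\<^sub>F N in sequentially. measure (matgauss N k) (near_event N k) \<le> 1"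
    using prob_space.prob_le_1[OF prob_space_matgauss] by simp
  have "(\<lambda>N. 1 / (real N * (real N powr (- 1/4))\<^sup>2)) \<longlonglongrightarrow> 0" by real_asymp
  then have "(\<lambda>N. 1 - 2 * (real k)\<^sup>2 * (1 / (real N * (eps N)\<^sup>2))) \<longlonglongrightarrow> 1 - 2 * (real k)\<^sup>2 * 0"
    unfolding eps_def by (intro tendsto_diff tendsto_mult tendsto_const)
  then show "(\<lambda>N. 1 - 2 * (real k)\<^sup>2 * (1 / (real N * (eps N)\<^sup>2))) \<longlonglongrightarrow> 1" by simp
qed simp

text \<open>The product identity expresses the GOE probability exactly as a Gaussian probability
  divided by that of near-orthonormality, and the divisor tends to 1.\<close>

lemma quad_event_limit:
  assumes k: "k > 0"
    and sel: "\<And>N. N \<ge> k \<Longrightarrow> eigenbasis_selection N (u N)"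
    and e: "\<And>N. N \<ge> k \<Longrightarrow> orthosys N {1..k} (e N)"
    and S: "\<And>N. S N \<in> sets borel"
    and lim: "(\<lambda>N. measure (matgauss N k) (gs_event N k (eps N) a (S N))) \<longlonglongrightarrow> L"
  shows "(\<lambda>N. measure (GOE N) (eigenbasis_selection.quad_event N (u N) (S N) {1..k} a (e N))) \<longlonglongrightarrow> L"
proof -
  obtain D \<epsilon>0 where D: "\<epsilon>0 > 0" and approx: "\<And>N x \<epsilon>. 0 \<le> \<epsilon> \<Longrightarrow> \<epsilon> \<le> \<epsilon>0 \<Longrightarrow> near_orthonormal N k \<epsilon> x \<Longrightarrow> orthosys N {1..k} (gram_schmidt N x)"
    using gram_schmidt_quadratic_approx[of k a] by blast
  let ?E = "\<lambda>N. measure (matgauss N k) (near_event N k)"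
  let ?m = "\<lambda>N. measure (GOE N) (eigenbasis_selection.quad_event N (u N) (S N) {1..k} a (e N))"
  have "\<forall>\<^sub>F N in sequentially. eps N < \<epsilon>0" using eps_tendsto D by (rule order_tendstoD)
  moreover have "\<forall>\<^sub>F N in sequentially. ?E N > 0" using prob_near_event_tendsto[OF k] by (rule order_tendstoD) simp
  ultimately have eq: "\<forall>\<^sub>F N in sequentially. measure (matgauss N k) (gs_event N k (eps N) a (S N)) / ?E N = ?m N"
    using eventually_ge_at_top[of k]
  proof eventually_elim
    case (elim N)
    interpret eigenbasis_selection N "u N" using sel elim by blast
    have near: "orthosys N {1..k} (gram_schmidt N x)" if "near_orthonormal N k (eps N) x" for x
      by (rule approx[OF _ _ that]) (use elim(1) in \<open>auto simp: eps_def\<close>)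
    have "?E N * ?m N = measure (matgauss N k) (gs_event N k (eps N) a (S N))"
      unfolding near_event_def
      by (rule prob_quad_event_gram_schmidt[OF e[OF elim(3)] S near])
    then show ?case using elim by (simp add: field_simps)
  qed
  have "(\<lambda>N. measure (matgauss N k) (gs_event N k (eps N) a (S N)) / ?E N) \<longlonglongrightarrow> L / 1"
    by (intro tendsto_divide lim prob_near_event_tendsto k) simp
  then show ?thesis using Lim_transform_eventually[OF _ eq] by simp
qed

definition rowsq :: "nat \<Rightarrow> (nat \<Rightarrow> real) \<Rightarrow> (nat \<Rightarrow> real) \<Rightarrow> real" where
  "rowsq k a x = (\<Sum>j\<in>{1..k}. a j * (x j)\<^sup>2)"

lemma measurable_rowsq: "rowsq k a \<in> borel_measurable (leb {1..k})"
  unfolding rowsq_def[abs_def]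
  by (intro borel_measurable_sum borel_measurable_times borel_measurable_power measurable_leb_component borel_measurable_const) auto

text \<open>The factor \<open>N\<close> undoes the column scaling \<open>1 / sqrt N\<close>, which
  enters squared; a factor 2 in the constant compensates the halving in
  \<open>half_norm\<close>.\<close>

lemma gs_event_row_approx:
  "\<exists>D \<epsilon>0. D \<ge> 0 \<and> \<epsilon>0 > 0 \<and> (\<forall>N w i. N > 0 \<longrightarrow> eps N \<le> \<epsilon>0 \<longrightarrow> near_orthonormal N k (eps N) (gauss_column N w) \<longrightarrow>
     \<bar>real N * (\<Sum>j\<in>{1..k}. a j * (gram_schmidt N (gauss_column N w) j i)\<^sup>2) - rowsq k a (gauss_row k i w)\<bar>
        \<le> D * eps N * half_norm {1..k} (gauss_row k i w))"
proof -
  obtain D \<epsilon>0 where D: "D \<ge> 0" "\<epsilon>0 > 0"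
    and approx: "\<And>N x \<epsilon> i. 0 \<le> \<epsilon> \<Longrightarrow> \<epsilon> \<le> \<epsilon>0 \<Longrightarrow> near_orthonormal N k \<epsilon> x \<Longrightarrow>
      \<bar>(\<Sum>j\<in>{1..k}. a j * (gram_schmidt N x j i)\<^sup>2) - (\<Sum>j\<in>{1..k}. a j * (x j i)\<^sup>2)\<bar> \<le> D * \<epsilon> * (\<Sum>j\<in>{1..k}. (x j i)\<^sup>2)"
    using gram_schmidt_quadratic_approx[of k a] by blast
  have "\<bar>real N * (\<Sum>j\<in>{1..k}. a j * (gram_schmidt N (gauss_column N w) j i)\<^sup>2) - rowsq k a (gauss_row k i w)\<bar>
        \<le> (2 * D) * eps N * half_norm {1..k} (gauss_row k i w)"
    if N: "N > 0" and en: "eps N \<le> \<epsilon>0" and near: "near_orthonormal N k (eps N) (gauss_column N w)" for N w i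
  proof -
    let ?q = "\<Sum>j\<in>{1..k}. a j * (gram_schmidt N (gauss_column N w) j i)\<^sup>2"
    have e0: "eps N \<ge> 0" by (simp add: eps_def)
    have sq: "(gauss_column N w j i)\<^sup>2 = (w (i, j))\<^sup>2 / real N" for j using N by (simp add: gauss_column_def power_divide)
    have 1: "(\<Sum>j\<in>{1..k}. a j * (gauss_column N w j i)\<^sup>2) = rowsq k a (gauss_row k i w) / real N"
      by (simp add: sq rowsq_def gauss_row_def sum_divide_distrib)
    have 2: "(\<Sum>j\<in>{1..k}. (gauss_column N w j i)\<^sup>2) = 2 * half_norm {1..k} (gauss_row k i w) / real N"
      by (simp add: sq half_norm_def gauss_row_def flip: sum_divide_distrib)
    have "\<bar>real N * ?q - rowsq k a (gauss_row k i w)\<bar> = real N * \<bar>?q - rowsq k a (gauss_row k i w) / real N\<bar>"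
    proof -
      have "real N * ?q - rowsq k a (gauss_row k i w) = real N * (?q - rowsq k a (gauss_row k i w) / real N)"
        using N by (simp add: right_diff_distrib)
      then show ?thesis by (simp add: abs_mult)
    qed
    also have "\<dots> \<le> real N * (D * eps N * (2 * half_norm {1..k} (gauss_row k i w) / real N))"
      using approx[OF e0 en near, of i] unfolding 1 2 by (intro mult_left_mono) auto
    also have "\<dots> = (2 * D) * eps N * half_norm {1..k} (gauss_row k i w)" using N by simp
    finally show ?thesis .
  qed
  then show ?thesis using D by (intro exI[of _ "2 * D"] exI[of _ \<epsilon>0]) auto
qed

text \<open>The maximum of \<open>half_norm\<close> over \<open>N\<close> rows is of order
  \<open>ln N\<close>. At twice that level a single row has probability \<open>1 / N\<^sup>2\<close>
  up to powers of \<open>ln N\<close>, so the union bound tends to 0.\<close>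

lemma prob_large_row_tendsto:
  assumes "k > 0"
  shows "(\<lambda>N. measure (matgauss N k) {w \<in> space (matgauss N k). \<exists>p<N. half_norm {1..k} (gauss_row k p w) \<in> {2 * ln (real N)<..}}) \<longlonglongrightarrow> 0"
proof (rule tendsto_sandwich[where f="\<lambda>_. 0" and h="\<lambda>N. real N * chi_tail {1..k} (2 * ln (real N))"])
  define q where "q = 1 - real (card {1..k}) / 2"
  show "\<forall>\<^sub>F N in sequentially. measure (matgauss N k) {w \<in> space (matgauss N k). \<exists>p<N. half_norm {1..k} (gauss_row k p w) \<in> {2 * ln (real N)<..}}
      \<le> real N * chi_tail {1..k} (2 * ln (real N))"
  proof (rule always_eventually, rule allI)
    fix N
    show "measure (matgauss N k) {w \<in> space (matgauss N k). \<exists>p<N. half_norm {1..k} (gauss_row k p w) \<in> {2 * ln (real N)<..}}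
      \<le> real N * chi_tail {1..k} (2 * ln (real N))"
      using prob_ex_row_le[OF measurable_half_norm, of "{2 * ln (real N)<..}" N k]
      by (simp add: chi_tail_def space_sgauss space_PiM)
  qed
  have "filterlim (\<lambda>N. 2 * ln (real N)) at_top sequentially" by real_asymp
  from filterlim_compose[OF chi_tail_asymp[of "{1..k}"] this] assms
  have l: "(\<lambda>N. chi_tail {1..k} (2 * ln (real N)) * exp (2 * ln (real N)) * (2 * ln (real N)) powr q) \<longlonglongrightarrow> 1 / Gamma (real (card {1..k}) / 2)"
    by (simp add: q_def)
  have "(\<lambda>N. 1 / real N * (2 * ln (real N)) powr (- q)) \<longlonglongrightarrow> 0" by real_asymp
  from tendsto_mult[OF l this]
  have "(\<lambda>N. chi_tail {1..k} (2 * ln (real N)) * exp (2 * ln (real N)) * (2 * ln (real N)) powr q * (1 / real N * (2 * ln (real N)) powr (- q))) \<longlonglongrightarrow> 0"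
    by simp
  then show "(\<lambda>N. real N * chi_tail {1..k} (2 * ln (real N))) \<longlonglongrightarrow> 0"
  proof (rule Lim_transform_eventually)
    show "\<forall>\<^sub>F N in sequentially. chi_tail {1..k} (2 * ln (real N)) * exp (2 * ln (real N)) * (2 * ln (real N)) powr q * (1 / real N * (2 * ln (real N)) powr (- q))
        = real N * chi_tail {1..k} (2 * ln (real N))"
      using eventually_gt_at_top[of 1]
    proof eventually_elim
      case (elim N)
      have "exp (2 * ln (real N)) = real N * real N"
        using elim by (simp add: exp_double power2_eq_square)
      moreover have "(2 * ln (real N)) powr q * (2 * ln (real N)) powr (- q) = 1"
        using elim by (simp add: powr_add[symmetric])
      ultimately show ?case using elim by (simp add: mult_ac)
    qed
  qed
qed auto

lemma (in prob_space) prob_inter_ge: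
  assumes "A \<in> events" "B \<in> events"
  shows "prob A - prob (space M - B) \<le> prob (A \<inter> B)"
proof -
  have "prob A \<le> prob ((A \<inter> B) \<union> (space M - B))"
    using assms sets.sets_into_space by (intro finite_measure_mono) auto
  also have "\<dots> \<le> prob (A \<inter> B) + prob (space M - B)" using assms by (intro measure_Un_le) auto
  finally show ?thesis by simp
qed

text \<open>The function \<open>\<phi>\<close> is the identity or the absolute value. Being
  1-Lipschitz, it turns a uniform error \<open>\<delta> N\<close> of the rows into a shift of the
  level by \<open>\<delta> N\<close>. The event is thereby squeezed between events on independent
  rows at levels \<open>s N - \<delta> N\<close> and \<open>s N + \<delta> N\<close>, up to
  exceptional sets of vanishing probability.\<close>

lemma gs_event_gumbel_limit:
  fixes \<phi> :: "real \<Rightarrow> real"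
  assumes k: "k > 0" and A0: "A0 > 0"
    and lip: "\<And>x y. \<phi> x \<le> \<phi> y + \<bar>x - y\<bar>" and \<phi>m: "\<phi> \<in> borel_measurable borel"
    and T: "((\<lambda>s. measure (sgauss {1..k}) {x \<in> space (leb {1..k}). s < \<phi> (rowsq k a x / (2 * A0))} * exp s * s powr q) \<longlongrightarrow> K) at_top"
    and K: "K > 0"
  shows "(\<lambda>N. measure (matgauss N k) (gs_event N k (eps N) a {r. \<phi> (real N * r / (2 * A0)) \<le> ln (real N) - q * ln (ln (real N)) + ln K + x}))
     \<longlonglongrightarrow> exp (- exp (- x))"
proof -
  define F where "F y = \<phi> (rowsq k a y / (2 * A0))" for y
  define T where "T s = measure (sgauss {1..k}) {x \<in> space (leb {1..k}). s < F x}" for s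
  have T': "((\<lambda>s. T s * exp s * s powr q) \<longlongrightarrow> K) at_top"
    using assms(5) by (simp only: T_def F_def)
  have Fm: "F \<in> borel_measurable (leb {1..k})"
    unfolding F_def using measurable_rowsq by (intro measurable_compose[OF _ \<phi>m] borel_measurable_divide) auto
  define s where "s N = ln (real N) - q * ln (ln (real N)) + (ln K + x)" for N
  obtain D \<epsilon>0 where D: "D \<ge> 0" "\<epsilon>0 > 0"
    and approx: "\<And>N w i. N > 0 \<Longrightarrow> eps N \<le> \<epsilon>0 \<Longrightarrow> near_orthonormal N k (eps N) (gauss_column N w) \<Longrightarrow>
     \<bar>real N * (\<Sum>j\<in>{1..k}. a j * (gram_schmidt N (gauss_column N w) j i)\<^sup>2) - rowsq k a (gauss_row k i w)\<bar>
        \<le> D * eps N * half_norm {1..k} (gauss_row k i w)"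
    using gs_event_row_approx[of k a] by blast
  \<comment> \<open>The row error \<open>D * eps N * half_norm\<close> with \<open>half_norm\<close>
    cut off at \<open>2 * ln N\<close>, rescaled like the statistic by
    \<open>2 * A0\<close>.\<close>
  define \<delta> where "\<delta> N = D * eps N * (2 * ln (real N)) / (2 * A0)" for N
  have \<delta>: "\<delta> \<longlonglongrightarrow> 0"
  proof -
    have "(\<lambda>N. real N powr (- 1/4) * ln (real N)) \<longlonglongrightarrow> 0" by real_asymp
    from tendsto_mult[OF tendsto_const[of "D / A0"] this] show ?thesis
      by (simp add: \<delta>_def[abs_def] eps_def mult_ac)
  qed
  define R where "R N t = {w \<in> space (matgauss N k). \<forall>p<N. F (gauss_row k p w) \<in> {..t}}" for N t
  define B where "B N = {w \<in> space (matgauss N k). \<exists>p<N. half_norm {1..k} (gauss_row k p w) \<in> {2 * ln (real N)<..}}" for N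
  define GE where "GE N = gs_event N k (eps N) a {r. \<phi> (real N * r / (2 * A0)) \<le> s N}" for N
  have F_row: "(\<lambda>w. F (gauss_row k p w)) \<in> borel_measurable (matgauss N k)" if "p < N" for p N
    using measurable_compose[OF measurable_gauss_row[OF that, of k], of F borel] Fm by (simp add: measurable_sgauss_iff)
  have Rs: "R N t \<in> sets (matgauss N k)" for N t
    unfolding R_def by (rule sets_Collect_all_in[OF F_row]) auto
  have Bs: "B N \<in> sets (matgauss N k)" for N
  proof -
    have "(\<lambda>w. half_norm {1..k} (gauss_row k p w)) \<in> borel_measurable (matgauss N k)" if "p < N" for p
      using measurable_compose[OF measurable_gauss_row[OF that, of k], of "half_norm {1..k}" borel] measurable_half_norm
      by (simp add: measurable_sgauss_iff)
    then have "{w \<in> space (matgauss N k). \<forall>p<N. half_norm {1..k} (gauss_row k p w) \<in> {..2 * ln (real N)}} \<in> sets (matgauss N k)"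
      by (rule sets_Collect_all_in) auto
    then have "space (matgauss N k) - {w \<in> space (matgauss N k). \<forall>p<N. half_norm {1..k} (gauss_row k p w) \<in> {..2 * ln (real N)}} \<in> sets (matgauss N k)"
      by (rule sets.compl_sets)
    then show ?thesis unfolding B_def
      by (rule back_subst[of "\<lambda>A. A \<in> sets (matgauss N k)"]) (auto simp: not_le)
  qed
  have Sb: "{r. \<phi> (real N * r / (2 * A0)) \<le> s N} \<in> sets borel" for N
  proof -
    have "(\<lambda>r. \<phi> (real N * r / (2 * A0))) \<in> borel_measurable borel"
      by (intro measurable_compose[OF _ \<phi>m]) simp
    then show ?thesis by simp
  qed
  have GEs: "GE N \<in> sets (matgauss N k)" for N unfolding GE_def by (rule sets_gs_event[OF Sb])
  have PR: "measure (matgauss N k) (R N t) = (1 - T t) ^ N" if "N > 0" for N t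
  proof -
    interpret R: prob_space "sgauss {1..k}" by (rule prob_space_sgauss)
    have TS: "{x \<in> space (leb {1..k}). t < F x} \<in> sets (sgauss {1..k})" by (rule sets_sgauss_less[OF Fm])
    have "measure (sgauss {1..k}) {x \<in> space (sgauss {1..k}). F x \<in> {..t}} = measure (sgauss {1..k}) (space (sgauss {1..k}) - {x \<in> space (leb {1..k}). t < F x})"
      by (intro arg_cong[where f="measure (sgauss {1..k})"]) (auto simp: space_sgauss space_PiM)
    also have "\<dots> = 1 - T t" unfolding T_def by (rule R.prob_compl[OF TS])
    finally show ?thesis unfolding R_def by (subst prob_all_rows[OF that k Fm]) auto
  qed
  \<comment> \<open>Any null sequence \<open>d\<close> may be added to the level, so the statement
    serves both sides of the squeeze. The summand \<open>ln K\<close> in the level removes the tail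
    constant \<open>K\<close>.\<close>
  have RL: "(\<lambda>N. measure (matgauss N k) (R N (s N + d N))) \<longlonglongrightarrow> exp (- exp (- x))" if d: "d \<longlonglongrightarrow> 0" for d :: "nat \<Rightarrow> real"
  proof -
    have "(\<lambda>N. (ln K + x) + d N) \<longlonglongrightarrow> (ln K + x) + 0" by (intro tendsto_intros d)
    from gumbel_tail_limit[OF T' this]
    have "(\<lambda>N. real N * T (s N + d N)) \<longlonglongrightarrow> K * exp (- (ln K + x))" by (simp add: s_def add.assoc)
    also have "K * exp (- (ln K + x)) = exp (- x)" using K by (simp add: exp_diff exp_minus field_simps)
    finally have "(\<lambda>N. (1 - T (s N + d N)) ^ N) \<longlonglongrightarrow> exp (- exp (- x))" by (rule power_one_minus_tendsto)
    then show ?thesis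
    proof (rule Lim_transform_eventually)
      show "\<forall>\<^sub>F N in sequentially. (1 - T (s N + d N)) ^ N = measure (matgauss N k) (R N (s N + d N))"
        by (rule eventually_mono[OF eventually_gt_at_top[of 0]]) (simp add: PR)
    qed
  qed
  have diff: "\<bar>real N * (\<Sum>j\<in>{1..k}. a j * (gram_schmidt N (gauss_column N w) j p)\<^sup>2) / (2 * A0) - rowsq k a (gauss_row k p w) / (2 * A0)\<bar> \<le> \<delta> N"
    if N: "N > 0" "eps N \<le> \<epsilon>0" and w: "w \<in> near_event N k" "w \<notin> B N" and p: "p < N" for N w p
  proof -
    have h: "half_norm {1..k} (gauss_row k p w) \<le> 2 * ln (real N)" using w p by (auto simp: B_def near_event_def)
    have "\<bar>real N * (\<Sum>j\<in>{1..k}. a j * (gram_schmidt N (gauss_column N w) j p)\<^sup>2) - rowsq k a (gauss_row k p w)\<bar> \<le> D * eps N * half_norm {1..k} (gauss_row k p w)"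
      using approx[OF N] w by (auto simp: near_event_def)
    also have "\<dots> \<le> D * eps N * (2 * ln (real N))" using h D by (intro mult_left_mono) (auto simp: eps_def)
    finally have "\<bar>real N * (\<Sum>j\<in>{1..k}. a j * (gram_schmidt N (gauss_column N w) j p)\<^sup>2) - rowsq k a (gauss_row k p w)\<bar> / (2 * A0) \<le> \<delta> N"
      unfolding \<delta>_def using A0 by (intro divide_right_mono) auto
    then show ?thesis using A0 by (simp add: diff_divide_distrib[symmetric] abs_divide)
  qed
  have ev: "\<forall>\<^sub>F N in sequentially. N > 0 \<and> eps N \<le> \<epsilon>0"
  proof (rule eventually_conj[OF eventually_gt_at_top])
    have "\<forall>\<^sub>F N in sequentially. eps N < \<epsilon>0" using eps_tendsto D(2) by (rule order_tendstoD)
    then show "\<forall>\<^sub>F N in sequentially. eps N \<le> \<epsilon>0" by (rule eventually_mono) simp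
  qed
  have B0: "(\<lambda>N. measure (matgauss N k) (B N)) \<longlonglongrightarrow> 0" unfolding B_def by (rule prob_large_row_tendsto[OF k])
  have "(\<lambda>N. measure (matgauss N k) (GE N)) \<longlonglongrightarrow> exp (- exp (- x))"
  proof (rule tendsto_sandwich)
    show "\<forall>\<^sub>F N in sequentially. measure (matgauss N k) (R N (s N + - \<delta> N)) - measure (matgauss N k) (B N) - (1 - measure (matgauss N k) (near_event N k))
        \<le> measure (matgauss N k) (GE N)"
      using ev
    proof eventually_elim
      case (elim N)
      interpret M: prob_space "matgauss N k" by (rule prob_space_matgauss)
      let ?R = "R N (s N + - \<delta> N)"
      have "M.prob ?R - M.prob (space (matgauss N k) - (space (matgauss N k) - B N)) \<le> M.prob (?R \<inter> (space (matgauss N k) - B N))"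
        by (rule M.prob_inter_ge[OF Rs sets.compl_sets[OF Bs]])
      moreover have "M.prob (?R \<inter> (space (matgauss N k) - B N)) - M.prob (space (matgauss N k) - near_event N k)
         \<le> M.prob (?R \<inter> (space (matgauss N k) - B N) \<inter> near_event N k)"
        by (rule M.prob_inter_ge[OF sets.Int[OF Rs sets.compl_sets[OF Bs]] sets_near_event])
      moreover have "M.prob (?R \<inter> (space (matgauss N k) - B N) \<inter> near_event N k) \<le> M.prob (GE N)"
      proof (rule M.finite_measure_mono[OF _ GEs], rule subsetI)
        fix w assume w: "w \<in> ?R \<inter> (space (matgauss N k) - B N) \<inter> near_event N k"
        have "\<phi> (real N * (\<Sum>j\<in>{1..k}. a j * (gram_schmidt N (gauss_column N w) j p)\<^sup>2) / (2 * A0)) \<le> s N" if "p < N" for p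
          using lip[of "real N * (\<Sum>j\<in>{1..k}. a j * (gram_schmidt N (gauss_column N w) j p)\<^sup>2) / (2 * A0)" "rowsq k a (gauss_row k p w) / (2 * A0)"]
            diff[of N w p] w elim that by (auto simp: R_def F_def simp del: One_nat_def)
        then show "w \<in> GE N" using w unfolding GE_def gs_event_def near_event_def by blast
      qed
      moreover have "space (matgauss N k) - (space (matgauss N k) - B N) = B N" by (auto simp: B_def)
      ultimately show ?case using M.prob_compl[OF sets_near_event] by simp
    qed
    show "\<forall>\<^sub>F N in sequentially. measure (matgauss N k) (GE N) \<le> measure (matgauss N k) (R N (s N + \<delta> N)) + measure (matgauss N k) (B N)"
      using ev
    proof eventually_elim
      case (elim N)
      interpret M: prob_space "matgauss N k" by (rule prob_space_matgauss)
      have "GE N \<subseteq> R N (s N + \<delta> N) \<union> B N"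
      proof
        fix w assume w: "w \<in> GE N"
        show "w \<in> R N (s N + \<delta> N) \<union> B N"
        proof (rule ccontr)
          assume nb: "w \<notin> R N (s N + \<delta> N) \<union> B N"
          have ne: "w \<in> near_event N k" using w by (auto simp: GE_def gs_event_def near_event_def)
          have "F (gauss_row k p w) \<le> s N + \<delta> N" if "p < N" for p
            using lip[of "rowsq k a (gauss_row k p w) / (2 * A0)" "real N * (\<Sum>j\<in>{1..k}. a j * (gram_schmidt N (gauss_column N w) j p)\<^sup>2) / (2 * A0)"]
              diff[of N w p] nb ne elim w that by (fastforce simp: GE_def gs_event_def F_def abs_minus_commute simp del: One_nat_def)
          then show False using nb w by (auto simp: R_def GE_def gs_event_def)
        qed
      qed
      then have "M.prob (GE N) \<le> M.prob (R N (s N + \<delta> N) \<union> B N)" using Rs Bs by (intro M.finite_measure_mono) auto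
      also have "\<dots> \<le> M.prob (R N (s N + \<delta> N)) + M.prob (B N)" using Rs Bs by (intro measure_Un_le) auto
      finally show ?case .
    qed
    have "(\<lambda>N. measure (matgauss N k) (R N (s N + - \<delta> N)) - measure (matgauss N k) (B N) - (1 - measure (matgauss N k) (near_event N k))) \<longlonglongrightarrow> exp (- exp (- x)) - 0 - (1 - 1)"
      using tendsto_minus[OF \<delta>] by (intro tendsto_diff RL B0 tendsto_const prob_near_event_tendsto k) auto
    then show "(\<lambda>N. measure (matgauss N k) (R N (s N + - \<delta> N)) - measure (matgauss N k) (B N) - (1 - measure (matgauss N k) (near_event N k))) \<longlonglongrightarrow> exp (- exp (- x))" by simp
    have "(\<lambda>N. measure (matgauss N k) (R N (s N + \<delta> N)) + measure (matgauss N k) (B N)) \<longlonglongrightarrow> exp (- exp (- x)) + 0"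
      by (intro tendsto_add RL B0 \<delta>)
    then show "(\<lambda>N. measure (matgauss N k) (R N (s N + \<delta> N)) + measure (matgauss N k) (B N)) \<longlonglongrightarrow> exp (- exp (- x))" by simp
  qed
  then show ?thesis by (simp add: GE_def s_def add.assoc)
qed

text \<open>The level \<open>u N\<close> tends to 0, so an additive error would not suffice. As all
  weights are negative, the form \<open>F\<close> bounds the row norm up to the constant
  \<open>c0\<close>; the error is then at most \<open>\<eta> N * F\<close>, and the level is only
  multiplied by a factor tending to 1.\<close>

lemma gs_event_weibull_limit:
  assumes k: "k > 0" and neg: "\<And>j. j \<in> {1..k} \<Longrightarrow> a j < 0"
    and u: "u \<longlonglongrightarrow> 0" "\<forall>\<^sub>F N in sequentially. u N > 0"
    and lim: "(\<lambda>N. real N * (u N powr (real k / 2) / (Gamma (real k / 2 + 1) * sqrt (\<Prod>j\<in>{1..k}. - a j)))) \<longlonglongrightarrow> L"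
  shows "(\<lambda>N. measure (matgauss N k) (gs_event N k (eps N) a {r. real N * r \<le> - 2 * u N})) \<longlonglongrightarrow> exp (- L)"
proof -
  let ?c = "\<lambda>j. - a j"
  have c: "\<And>j. j \<in> {1..k} \<Longrightarrow> ?c j > 0" using neg by auto
  define c0 where "c0 = Min (?c ` {1..k})"
  have c0: "c0 > 0" "\<And>j. j \<in> {1..k} \<Longrightarrow> c0 \<le> ?c j" using k c by (auto simp: c0_def)
  define F where "F = wsum {1..k} ?c"
  have F_rowsq: "rowsq k a y = - 2 * F y" for y
    by (simp add: rowsq_def F_def wsum_def sum_negf)
  have F0: "F y \<ge> 0" for y unfolding F_def wsum_def using c by (intro divide_nonneg_pos sum_nonneg mult_nonneg_nonneg) (auto intro: less_imp_le)
  have hF: "half_norm {1..k} y \<le> F y / c0" for y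
  proof -
    have "c0 * half_norm {1..k} y = (\<Sum>j\<in>{1..k}. c0 * (y j)\<^sup>2) / 2" by (simp add: half_norm_def sum_distrib_left)
    also have "\<dots> \<le> F y" unfolding F_def wsum_def using c0 by (intro divide_right_mono sum_mono mult_right_mono) auto
    finally show ?thesis using c0 by (simp add: field_simps)
  qed
  have Fm: "F \<in> borel_measurable (leb {1..k})" unfolding F_def by (rule measurable_wsum)
  obtain D \<epsilon>0 where D: "D \<ge> 0" "\<epsilon>0 > 0"
    and approx: "\<And>N w i. N > 0 \<Longrightarrow> eps N \<le> \<epsilon>0 \<Longrightarrow> near_orthonormal N k (eps N) (gauss_column N w) \<Longrightarrow>
     \<bar>real N * (\<Sum>j\<in>{1..k}. a j * (gram_schmidt N (gauss_column N w) j i)\<^sup>2) - rowsq k a (gauss_row k i w)\<bar>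
        \<le> D * eps N * half_norm {1..k} (gauss_row k i w)"
    using gs_event_row_approx[of k a] by blast
  \<comment> \<open>The added 1 makes \<open>\<eta> N\<close> positive even for
    \<open>D = 0\<close>. This turns the non-strict inequality of \<open>gs_event\<close> into the
    strict one of \<open>R\<close>, which is the complement of a closed small ball.\<close>
  define \<eta> where "\<eta> N = (D / c0 + 1) * eps N" for N
  have \<eta>lim: "\<eta> \<longlonglongrightarrow> 0" using tendsto_mult[OF tendsto_const[of "D / c0 + 1"] eps_tendsto] by (simp add: \<eta>_def[abs_def])
  have \<eta>pos: "\<eta> N > 0" if "N > 0" for N
    unfolding \<eta>_def using D c0 eps_pos[OF that] by (intro mult_pos_pos add_nonneg_pos) auto
  define R where "R N t = {w \<in> space (matgauss N k). \<forall>p<N. F (gauss_row k p w) \<in> {t<..}}" for N t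
  define GE where "GE N = gs_event N k (eps N) a {r. real N * r \<le> - 2 * u N}" for N
  have F_row: "(\<lambda>w. F (gauss_row k p w)) \<in> borel_measurable (matgauss N k)" if "p < N" for p N
    using measurable_compose[OF measurable_gauss_row[OF that, of k], of F borel] Fm by (simp add: measurable_sgauss_iff)
  have Rs: "R N t \<in> sets (matgauss N k)" for N t
    unfolding R_def by (rule sets_Collect_all_in[OF F_row]) auto
  have GEs: "GE N \<in> sets (matgauss N k)" for N unfolding GE_def by (rule sets_gs_event) measurable
  have PR: "measure (matgauss N k) (R N t) = (1 - small_ball {1..k} ?c t) ^ N" if "N > 0" for N t
  proof -
    interpret R: prob_space "sgauss {1..k}" by (rule prob_space_sgauss)
    have TS: "{x \<in> space (leb {1..k}). F x \<le> t} \<in> sets (sgauss {1..k})"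
      unfolding sets_sgauss using Fm by measurable
    have "measure (sgauss {1..k}) {x \<in> space (sgauss {1..k}). F x \<in> {t<..}} = measure (sgauss {1..k}) (space (sgauss {1..k}) - {x \<in> space (leb {1..k}). F x \<le> t})"
      by (intro arg_cong[where f="measure (sgauss {1..k})"]) (auto simp: space_sgauss space_PiM)
    also have "\<dots> = 1 - small_ball {1..k} ?c t"
      unfolding small_ball_def F_def[symmetric] by (rule R.prob_compl[OF TS])
    finally show ?thesis unfolding R_def by (subst prob_all_rows[OF that k Fm]) auto
  qed
  \<comment> \<open>Dividing the level by \<open>1 + d N\<close> changes \<open>N\<close> times the
    ellipsoid volume by a factor tending to 1, so the limit is the same for
    \<open>d = \<eta>\<close> and for \<open>d = - \<eta>\<close>.\<close>
  have RL: "(\<lambda>N. measure (matgauss N k) (R N (u N / (1 + d N)))) \<longlonglongrightarrow> exp (- L)" if d: "d \<longlonglongrightarrow> 0" for d :: "nat \<Rightarrow> real"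
  proof -
    have evd: "\<forall>\<^sub>F N in sequentially. 1 + d N > 0"
    proof -
      have "(\<lambda>N. 1 + d N) \<longlonglongrightarrow> 1 + 0" by (intro tendsto_intros d)
      then show ?thesis by (intro order_tendstoD) auto
    qed
    have v0: "(\<lambda>N. u N / (1 + d N)) \<longlonglongrightarrow> 0"
    proof -
      have "(\<lambda>N. u N / (1 + d N)) \<longlonglongrightarrow> 0 / (1 + 0)" by (intro tendsto_intros u d) simp
      then show ?thesis by simp
    qed
    have vpos: "\<forall>\<^sub>F N in sequentially. u N / (1 + d N) > 0"
      using u(2) evd by eventually_elim simp
    let ?G = "Gamma (real k / 2 + 1) * sqrt (\<Prod>j\<in>{1..k}. - a j)"
    have "(\<lambda>N. real N * (u N powr (real k / 2) / ?G) * (1 + d N) powr (- (real k / 2))) \<longlonglongrightarrow> L * (1 + 0) powr (- (real k / 2))"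
      by (intro tendsto_mult lim tendsto_powr tendsto_add tendsto_const d) simp
    then have "(\<lambda>N. real N * (u N powr (real k / 2) / ?G) * (1 + d N) powr (- (real k / 2))) \<longlonglongrightarrow> L" by simp
    then have "(\<lambda>N. real N * ((u N / (1 + d N)) powr (real k / 2) / ?G)) \<longlonglongrightarrow> L"
    proof (rule Lim_transform_eventually)
      show "\<forall>\<^sub>F N in sequentially. real N * (u N powr (real k / 2) / ?G) * (1 + d N) powr (- (real k / 2))
          = real N * ((u N / (1 + d N)) powr (real k / 2) / ?G)"
        using u(2) evd by eventually_elim (simp add: powr_divide powr_minus_divide)
    qed
    then have "(\<lambda>N. real N * small_ball {1..k} ?c (u N / (1 + d N))) \<longlonglongrightarrow> L"
      using k by (intro small_ball_limit c v0 vpos) auto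
    then have "(\<lambda>N. (1 - small_ball {1..k} ?c (u N / (1 + d N))) ^ N) \<longlonglongrightarrow> exp (- L)" by (rule power_one_minus_tendsto)
    then show ?thesis
    proof (rule Lim_transform_eventually)
      show "\<forall>\<^sub>F N in sequentially. (1 - small_ball {1..k} ?c (u N / (1 + d N))) ^ N = measure (matgauss N k) (R N (u N / (1 + d N)))"
        by (rule eventually_mono[OF eventually_gt_at_top[of 0]]) (simp add: PR)
    qed
  qed
  have diff: "\<bar>real N * (\<Sum>j\<in>{1..k}. a j * (gram_schmidt N (gauss_column N w) j p)\<^sup>2) + 2 * F (gauss_row k p w)\<bar> \<le> \<eta> N * F (gauss_row k p w)"
    if N: "N > 0" "eps N \<le> \<epsilon>0" and w: "w \<in> near_event N k" for N w p
  proof -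
    have e0: "eps N \<ge> 0" by (simp add: eps_def)
    have "\<bar>real N * (\<Sum>j\<in>{1..k}. a j * (gram_schmidt N (gauss_column N w) j p)\<^sup>2) - rowsq k a (gauss_row k p w)\<bar> \<le> D * eps N * half_norm {1..k} (gauss_row k p w)"
      using approx[OF N] w by (auto simp: near_event_def)
    also have "\<dots> \<le> D * eps N * (F (gauss_row k p w) / c0)" using hF D e0 by (intro mult_left_mono) auto
    also have "\<dots> = (D / c0 * eps N) * F (gauss_row k p w)" by simp
    also have "\<dots> \<le> \<eta> N * F (gauss_row k p w)" unfolding \<eta>_def using F0 e0 by (intro mult_right_mono) auto
    finally show ?thesis by (simp add: F_rowsq)
  qed
  have ev: "\<forall>\<^sub>F N in sequentially. (N > 0 \<and> eps N \<le> \<epsilon>0) \<and> (\<eta> N < 1 \<and> u N > 0)"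
  proof (intro eventually_conj eventually_gt_at_top u(2))
    have "\<forall>\<^sub>F N in sequentially. eps N < \<epsilon>0" using eps_tendsto D(2) by (rule order_tendstoD)
    then show "\<forall>\<^sub>F N in sequentially. eps N \<le> \<epsilon>0" by (rule eventually_mono) simp
    show "\<forall>\<^sub>F N in sequentially. \<eta> N < 1" using \<eta>lim by (rule order_tendstoD) simp
  qed
  have "(\<lambda>N. measure (matgauss N k) (GE N)) \<longlonglongrightarrow> exp (- L)"
  proof (rule tendsto_sandwich)
    show "\<forall>\<^sub>F N in sequentially. measure (matgauss N k) (R N (u N / (1 + - \<eta> N))) - (1 - measure (matgauss N k) (near_event N k))
        \<le> measure (matgauss N k) (GE N)"
      using ev
    proof eventually_elim
      case (elim N)
      interpret M: prob_space "matgauss N k" by (rule prob_space_matgauss)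
      let ?R = "R N (u N / (1 + - \<eta> N))"
      have "M.prob ?R - M.prob (space (matgauss N k) - near_event N k) \<le> M.prob (?R \<inter> near_event N k)"
        by (rule M.prob_inter_ge) (use Rs sets_near_event in auto)
      moreover have "M.prob (?R \<inter> near_event N k) \<le> M.prob (GE N)"
      proof (rule M.finite_measure_mono[OF _ GEs], rule subsetI)
        fix w assume w: "w \<in> ?R \<inter> near_event N k"
        have "real N * (\<Sum>j\<in>{1..k}. a j * (gram_schmidt N (gauss_column N w) j p)\<^sup>2) \<le> - 2 * u N" if "p < N" for p
        proof -
          have "u N / (1 + - \<eta> N) < F (gauss_row k p w)" using w that by (auto simp: R_def)
          then have 1: "u N < (1 - \<eta> N) * F (gauss_row k p w)" using elim by (simp add: field_simps)
          have "\<eta> N * F (gauss_row k p w) \<le> 2 * \<eta> N * F (gauss_row k p w)" using F0[of "gauss_row k p w"] \<eta>pos[of N] elim by simp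
          then show ?thesis using diff[of N w p] w elim 1 by (auto simp: algebra_simps abs_le_iff simp del: One_nat_def)
        qed
        then show "w \<in> GE N" using w unfolding GE_def gs_event_def near_event_def by blast
      qed
      ultimately show ?case using M.prob_compl[OF sets_near_event] by simp
    qed
    show "\<forall>\<^sub>F N in sequentially. measure (matgauss N k) (GE N) \<le> measure (matgauss N k) (R N (u N / (1 + \<eta> N)))"
      using ev
    proof eventually_elim
      case (elim N)
      interpret M: prob_space "matgauss N k" by (rule prob_space_matgauss)
      have "GE N \<subseteq> R N (u N / (1 + \<eta> N))"
      proof
        fix w assume w: "w \<in> GE N"
        have ne: "w \<in> near_event N k" using w by (auto simp: GE_def gs_event_def near_event_def)
        have "u N / (1 + \<eta> N) < F (gauss_row k p w)" if "p < N" for p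
        proof -
          have "real N * (\<Sum>j\<in>{1..k}. a j * (gram_schmidt N (gauss_column N w) j p)\<^sup>2) \<le> - 2 * u N"
            using w that unfolding GE_def gs_event_def by blast
          then have 1: "2 * u N \<le> (2 + \<eta> N) * F (gauss_row k p w)"
            using diff[of N w p] ne elim by (simp add: algebra_simps abs_le_iff del: One_nat_def)
          have "F (gauss_row k p w) > 0"
          proof (rule ccontr)
            assume "\<not> ?thesis"
            then have "F (gauss_row k p w) = 0" using F0[of "gauss_row k p w"] by simp
            then show False using 1 elim by simp
          qed
          then have "\<eta> N * F (gauss_row k p w) > 0" using \<eta>pos[of N] elim by simp
          then have "u N < (1 + \<eta> N) * F (gauss_row k p w)" using 1 by (simp add: algebra_simps)
          then show ?thesis using \<eta>pos[of N] elim by (simp add: field_simps)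
        qed
        then show "w \<in> R N (u N / (1 + \<eta> N))" using w by (auto simp: R_def GE_def gs_event_def)
      qed
      then show ?case using Rs by (intro M.finite_measure_mono) auto
    qed
    have "(\<lambda>N. measure (matgauss N k) (R N (u N / (1 + - \<eta> N))) - (1 - measure (matgauss N k) (near_event N k))) \<longlonglongrightarrow> exp (- L) - (1 - 1)"
      using tendsto_minus[OF \<eta>lim] by (intro tendsto_diff RL tendsto_const prob_near_event_tendsto k) auto
    then show "(\<lambda>N. measure (matgauss N k) (R N (u N / (1 + - \<eta> N))) - (1 - measure (matgauss N k) (near_event N k))) \<longlonglongrightarrow> exp (- L)" by simp
    show "(\<lambda>N. measure (matgauss N k) (R N (u N / (1 + \<eta> N)))) \<longlonglongrightarrow> exp (- L)" by (rule RL[OF \<eta>lim])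
  qed
  then show ?thesis by (simp add: GE_def)
qed

section \<open>Distribution functions of the maxima and the explicit constants\<close>

lemma eigenbasis_selection_vec_index:
  assumes "\<forall>g\<in>space (GOE N). orthonormal_eigenbasis N (goe_mat N g) (U g)"
    and "\<forall>i<N. \<forall>p<N. (\<lambda>g. vec_index (U g i) p) \<in> borel_measurable (GOE N)"
  shows "eigenbasis_selection N (\<lambda>g i. vec_index (U g i))"
proof
  fix g assume g: "g \<in> space (GOE N)"
  then have W: "orthonormal_eigenbasis N (goe_mat N g) (U g)" using assms(1) by blast
  have dim: "dim_vec (U g i) = N" if "i < N" for i
    using W that unfolding orthonormal_eigenbasis_def by auto
  show "orthosys N {..<N} (\<lambda>i. vec_index (U g i))"
    using W dim by (auto simp: orthonormal_eigenbasis_def orthosys_def ip_def scalar_prod_def atLeast0LessThan)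
  fix i assume i: "i < N"
  obtain \<mu> where \<mu>: "goe_mat N g *\<^sub>v U g i = \<mu> \<cdot>\<^sub>v U g i"
    using W i unfolding orthonormal_eigenbasis_def by blast
  have "eigvec N (symm g) \<mu> (vec_index (U g i))"
    unfolding eigvec_def
  proof (intro allI impI)
    fix p assume p: "p < N"
    have "(\<Sum>q<N. symm g p q * vec_index (U g i) q) = vec_index (goe_mat N g *\<^sub>v U g i) p"
      using p dim[OF i] by (simp add: goe_mat_def scalar_prod_def atLeast0LessThan symm_def)
    then show "(\<Sum>q<N. symm g p q * vec_index (U g i) q) = \<mu> * vec_index (U g i) p"
      using p dim[OF i] by (simp add: \<mu>)
  qed
  then show "\<exists>\<mu>. eigvec N (symm g) \<mu> (vec_index (U g i))" by blast
qed (use assms(2) in auto)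

text \<open>Every symmetric matrix is a sample of the ensemble, so the selection \<open>U\<close> also diagonalises it.\<close>

lemma symmetric_mat_is_goe_mat:
  assumes "A \<in> carrier_mat N N" "transpose_mat A = A"
  shows "\<exists>g\<in>space (GOE N). goe_mat N g = A"
proof (rule bexI[of _ "\<lambda>i\<in>goe_index N. A $$ i"])
  have "A $$ (p, q) = A $$ (q, p)" if "p < N" "q < N" for p q
    using assms that by (metis carrier_matD index_transpose_mat(1))
  then show "goe_mat N (\<lambda>i\<in>goe_index N. A $$ i) = A"
    using assms(1) by (intro eq_matI) (auto simp: goe_mat_def min_def max_def goe_index_def)
qed (simp add: space_GOE)

lemma Max_le_iff_all:
  fixes f :: "nat \<Rightarrow> real"
  assumes "N > 0"
  shows "Max {f i | i. i < N} \<le> t \<longleftrightarrow> (\<forall>i<N. f i \<le> t)"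
proof -
  have e: "{f i | i. i < N} = f ` {..<N}" by auto
  show ?thesis unfolding e using assms by (subst Max_le_iff) auto
qed

lemma cdf_distr_affine:
  assumes "prob_space M" and m: "\<And>t. {g \<in> space M. m g \<le> t} \<in> sets M" and \<alpha>: "\<alpha> > 0"
  shows "cdf (distr M borel (\<lambda>g. \<alpha> * m g + \<beta>)) x = measure M {g \<in> space M. m g \<le> (x - \<beta>) / \<alpha>}"
proof -
  have "m \<in> borel_measurable M" using m by (subst borel_measurable_iff_le) auto
  then have "(\<lambda>g. \<alpha> * m g + \<beta>) \<in> borel_measurable M" by measurable
  then have "cdf (distr M borel (\<lambda>g. \<alpha> * m g + \<beta>)) x = measure M ((\<lambda>g. \<alpha> * m g + \<beta>) -` {..x} \<inter> space M)"
    unfolding cdf_def by (subst measure_distr) auto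
  also have "(\<lambda>g. \<alpha> * m g + \<beta>) -` {..x} \<inter> space M = {g \<in> space M. m g \<le> (x - \<beta>) / \<alpha>}"
    using \<alpha> by (auto simp: field_simps)
  finally show ?thesis .
qed

text \<open>Intended for two families of weights, those of the form and of its negative, normalised
  by one common power of \<open>s\<close>. The family whose multiplicity stays below
  \<open>M\<close> has the thinner tail and contributes 0.\<close>

lemma wtail_limit_multiplicity:
  assumes J: "finite J" and b1: "\<And>j. j \<in> J \<Longrightarrow> b j \<le> 1" and M: "card {j \<in> J. b j = 1} \<le> M"
  shows "((\<lambda>s. wtail J b s * exp s * s powr (1 - real M / 2)) \<longlongrightarrow>
     (if card {j \<in> J. b j = 1} = M \<and> M > 0 then 1 / (Gamma (real M / 2) * sqrt (\<Prod>j\<in>{j\<in>J. b j \<noteq> 1}. 1 - b j)) else 0)) at_top"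
proof (cases "{j \<in> J. b j = 1} = {}")
  case True
  then have "b j < 1" if "j \<in> J" for j using b1[OF that] that by (cases "b j = 1") auto
  then have "((\<lambda>s. wtail J b s * exp s * s powr (1 - real M / 2)) \<longlongrightarrow> 0) at_top" by (rule wtail_negligible[OF J])
  then show ?thesis using True by (simp only: card.empty) auto
next
  case False
  let ?m = "card {j \<in> J. b j = 1}"
  let ?K = "1 / (Gamma (real ?m / 2) * sqrt (\<Prod>j\<in>{j\<in>J. b j \<noteq> 1}. 1 - b j))"
  note l = wtail_asymp[OF J b1 False]
  have m: "?m > 0" using False J by (simp add: card_gt_0_iff)
  show ?thesis
  proof (cases "?m = M")
    case True
    then show ?thesis using l m by simp
  next
    case ne: False
    then have lt: "real ?m < real M" using M by simp
    have "((\<lambda>s::real. s powr ((real ?m - real M) / 2)) \<longlongrightarrow> 0) at_top"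
      using lt by (intro tendsto_neg_powr filterlim_ident) simp
    from tendsto_mult[OF l this]
    have "((\<lambda>s. wtail J b s * exp s * s powr (1 - real ?m / 2) * s powr ((real ?m - real M) / 2)) \<longlongrightarrow> 0) at_top" by simp
    also have "(\<lambda>s. wtail J b s * exp s * s powr (1 - real ?m / 2) * s powr ((real ?m - real M) / 2))
        = (\<lambda>s. wtail J b s * exp s * s powr (1 - real M / 2))"
      by (simp add: mult.assoc powr_add[symmetric] diff_divide_distrib)
    finally show ?thesis using ne by simp
  qed
qed

lemma wsum_eq_rowsq: "wsum {1..k} (\<lambda>j. a j / c) x = rowsq k a x / (2 * c)"
  by (simp add: wsum_def rowsq_def sum_divide_distrib mult.commute)

text \<open>Dividing by the maximum yields weights at most 1, with value 1 exactly
  \<open>mult_max k a\<close> times; this is the situation of \<open>wtail_asymp\<close>, and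
  \<open>c_m\<close> is minus the logarithm of the limit found there.\<close>

lemma amax_tail:
  assumes k: "k \<ge> 1" and pos: "amax k a > 0"
  shows "\<exists>K>0. c_m k a = - ln K \<and>
    ((\<lambda>s. measure (sgauss {1..k}) {x \<in> space (leb {1..k}). s < rowsq k a x / (2 * amax k a)} * exp s * s powr (1 - real (mult_max k a) / 2)) \<longlongrightarrow> K) at_top"
proof -
  let ?A = "amax k a"
  define b where "b j = a j / ?A" for j
  have le: "a j \<le> ?A" if "j \<in> {1..k}" for j unfolding amax_def using that by (intro Max_ge) auto
  have "?A \<in> a ` {1..k}" unfolding amax_def using k by (intro Max_in) auto
  then have ne: "{j \<in> {1..k}. b j = 1} \<noteq> {}" using pos by (auto simp: b_def)
  have b1: "b j \<le> 1" if "j \<in> {1..k}" for j using le[OF that] pos by (simp add: b_def)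
  have eq: "{j \<in> {1..k}. b j = 1} = {j \<in> {1..k}. a j = ?A}" "{j \<in> {1..k}. b j \<noteq> 1} = {j \<in> {1..k}. a j \<noteq> ?A}"
    using pos by (auto simp: b_def)
  define P where "P = (\<Prod>j\<in>{j\<in>{1..k}. a j \<noteq> ?A}. 1 - a j / ?A)"
  have "P > 0" unfolding P_def
  proof (rule prod_pos)
    fix j assume j: "j \<in> {j\<in>{1..k}. a j \<noteq> ?A}"
    then have "a j < ?A" using le[of j] by auto
    then show "0 < 1 - a j / ?A" using pos by simp
  qed
  have m: "mult_max k a > 0" unfolding mult_max_def eq(1)[symmetric] using ne by (auto simp: card_gt_0_iff)
  define G where "G = Gamma (real (mult_max k a) / 2)"
  have G: "G > 0" unfolding G_def using m by (intro Gamma_real_pos) simp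
  have cm: "c_m k a = - ln (1 / (G * sqrt P))"
    using G \<open>P > 0\<close> by (simp add: c_m_def G_def P_def ln_div)
  have "((\<lambda>s. wtail {1..k} b s * exp s * s powr (1 - real (card {j \<in> {1..k}. b j = 1}) / 2)) \<longlongrightarrow>
     1 / (Gamma (real (card {j \<in> {1..k}. b j = 1}) / 2) * sqrt (\<Prod>j\<in>{j\<in>{1..k}. b j \<noteq> 1}. 1 - b j))) at_top"
    by (rule wtail_asymp[OF _ b1 ne]) auto
  then have "((\<lambda>s. wtail {1..k} b s * exp s * s powr (1 - real (mult_max k a) / 2)) \<longlongrightarrow> 1 / (G * sqrt P)) at_top"
    unfolding eq mult_max_def[symmetric] G_def[symmetric] by (simp add: P_def b_def)
  then show ?thesis
    unfolding wtail_def b_def wsum_eq_rowsq using cm G \<open>P > 0\<close> by (intro exI[of _ "1 / (G * sqrt P)"]) simp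
qed

text \<open>For \<open>s \<ge> 0\<close> the event that the absolute value exceeds \<open>s\<close>
  is the disjoint union of one event for each sign, so the tail constants add. The three cases of
  \<open>c_star\<close> record which of \<open>Kp\<close> and \<open>Km\<close> is nonzero; with
  equal multiplicities both are, whence the sum of inverses.\<close>

lemma astar_tail:
  assumes k: "k \<ge> 1" and nz: "\<forall>i\<in>{1..k}. a i \<noteq> 0"
  defines "M \<equiv> max (mult_plus k a) (mult_minus k a)"
  shows "\<exists>K>0. astar k a > 0 \<and> c_star k a = - ln K \<and>
    ((\<lambda>s. measure (sgauss {1..k}) {x \<in> space (leb {1..k}). s < \<bar>rowsq k a x / (2 * astar k a)\<bar>} * exp s * s powr (1 - real M / 2)) \<longlongrightarrow> K) at_top"
proof -
  let ?A = "astar k a" and ?J = "{1..k}"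
  have le: "\<bar>a j\<bar> \<le> ?A" if "j \<in> ?J" for j unfolding astar_def using that by (intro Max_ge) auto
  have "?A \<in> (\<lambda>i. \<bar>a i\<bar>) ` ?J" unfolding astar_def using k by (intro Max_in) auto
  then obtain j0 where j0: "j0 \<in> ?J" "?A = \<bar>a j0\<bar>" by auto
  have A: "?A > 0" using j0 nz by auto
  define b where "b j = a j / ?A" for j
  define b' where "b' j = - a j / ?A" for j
  have b1: "b j \<le> 1" "b' j \<le> 1" if "j \<in> ?J" for j using le[OF that] A by (auto simp: b_def b'_def field_simps)
  have eq: "{j \<in> ?J. b j = 1} = {j \<in> ?J. a j = ?A}" "{j \<in> ?J. b j \<noteq> 1} = {j \<in> ?J. a j \<noteq> ?A}"
    "{j \<in> ?J. b' j = 1} = {j \<in> ?J. a j = - ?A}" "{j \<in> ?J. b' j \<noteq> 1} = {j \<in> ?J. a j \<noteq> - ?A}"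
    using A by (auto simp: b_def b'_def field_simps)
  have P: "P_plus k a > 0" "P_minus k a > 0"
    unfolding P_plus_def P_minus_def
  proof (safe intro!: prod_pos)
    fix j assume j: "j \<in> ?J" "a j \<noteq> ?A"
    then have "a j < ?A" using le[of j] by auto
    then show "0 < 1 - a j / ?A" using A by simp
  next
    fix j assume j: "j \<in> ?J" "a j \<noteq> - ?A"
    then have "- ?A < a j" using le[of j] by auto
    then show "0 < 1 + a j / ?A" using A by (simp add: field_simps)
  qed
  have M: "M > 0"
  proof -
    have "a j0 = ?A \<or> a j0 = - ?A" using j0 by auto
    then have "{i \<in> ?J. a i = ?A} \<noteq> {} \<or> {i \<in> ?J. a i = - ?A} \<noteq> {}" using j0 by blast
    then show ?thesis unfolding M_def mult_plus_def mult_minus_def by (auto simp: card_gt_0_iff less_max_iff_disj)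
  qed
  define G where "G = Gamma (real M / 2)"
  have G: "G > 0" unfolding G_def using M by (intro Gamma_real_pos) simp
  define Kp where "Kp = (if mult_plus k a = M then 1 / (G * sqrt (P_plus k a)) else 0)"
  define Km where "Km = (if mult_minus k a = M then 1 / (G * sqrt (P_minus k a)) else 0)"
  have Kn: "Kp \<ge> 0" "Km \<ge> 0" using G P by (auto simp: Kp_def Km_def)
  have K: "Kp + Km > 0"
  proof -
    have "mult_plus k a = M \<or> mult_minus k a = M" by (auto simp: M_def max_def)
    then have "Kp > 0 \<or> Km > 0" using G P by (auto simp: Kp_def Km_def)
    then show ?thesis using Kn by linarith
  qed
  have c: "c_star k a = - ln (Kp + Km)"
  proof -
    consider "mult_plus k a > mult_minus k a" | "mult_plus k a < mult_minus k a" | "mult_plus k a = mult_minus k a" by linarith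
    then show ?thesis
    proof cases
      case 1
      then have "Kp + Km = 1 / (G * sqrt (P_plus k a))" "M = mult_plus k a" by (auto simp: Kp_def Km_def M_def)
      then show ?thesis using 1 G P by (simp add: c_star_def G_def ln_div)
    next
      case 2
      then have "Kp + Km = 1 / (G * sqrt (P_minus k a))" "M = mult_minus k a" by (auto simp: Kp_def Km_def M_def)
      then show ?thesis using 2 G P by (simp add: c_star_def G_def ln_div)
    next
      case 3
      then have M': "M = mult_plus k a" by (simp add: M_def)
      define S where "S = inverse (sqrt (P_plus k a)) + inverse (sqrt (P_minus k a))"
      have S: "S > 0" unfolding S_def using P by (intro add_pos_pos) auto
      have "Kp + Km = S / G" using 3 M' by (simp add: S_def Kp_def Km_def divide_inverse algebra_simps)
      moreover have "c_star k a = ln (G * inverse S)" using 3 M' by (simp add: c_star_def G_def S_def)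
      moreover have "ln (G * inverse S) = - ln (S / G)"
        using G S by (simp add: ln_mult ln_div ln_inverse)
      ultimately show ?thesis by simp
    qed
  qed
  have lp: "((\<lambda>s. wtail ?J b s * exp s * s powr (1 - real M / 2)) \<longlongrightarrow> Kp) at_top"
  proof -
    have cM: "card {j \<in> ?J. b j = 1} \<le> M" unfolding eq mult_plus_def[symmetric] by (simp add: M_def)
    have Pe: "(\<Prod>j\<in>{j \<in> ?J. a j \<noteq> ?A}. 1 - b j) = P_plus k a" by (simp add: P_plus_def b_def)
    have Ke: "(if mult_plus k a = M \<and> M > 0 then 1 / (Gamma (real M / 2) * sqrt (P_plus k a)) else 0) = Kp"
      using M by (simp add: Kp_def G_def)
    from wtail_limit_multiplicity[OF finite_atLeastAtMost b1(1) cM]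
    show ?thesis unfolding eq mult_plus_def[symmetric] Pe Ke .
  qed
  have lm: "((\<lambda>s. wtail ?J b' s * exp s * s powr (1 - real M / 2)) \<longlongrightarrow> Km) at_top"
  proof -
    have cM: "card {j \<in> ?J. b' j = 1} \<le> M" unfolding eq mult_minus_def[symmetric] by (simp add: M_def)
    have Pe: "(\<Prod>j\<in>{j \<in> ?J. a j \<noteq> - ?A}. 1 - b' j) = P_minus k a" by (simp add: P_minus_def b'_def)
    have Ke: "(if mult_minus k a = M \<and> M > 0 then 1 / (Gamma (real M / 2) * sqrt (P_minus k a)) else 0) = Km"
      using M by (simp add: Km_def G_def)
    from wtail_limit_multiplicity[OF finite_atLeastAtMost b1(2) cM]
    show ?thesis unfolding eq mult_minus_def[symmetric] Pe Ke .
  qed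
  have "((\<lambda>s. wtail ?J b s * exp s * s powr (1 - real M / 2) + wtail ?J b' s * exp s * s powr (1 - real M / 2)) \<longlongrightarrow> Kp + Km) at_top"
    by (rule tendsto_add[OF lp lm])
  then have "((\<lambda>s. measure (sgauss ?J) {x \<in> space (leb ?J). s < \<bar>rowsq k a x / (2 * ?A)\<bar>} * exp s * s powr (1 - real M / 2)) \<longlongrightarrow> Kp + Km) at_top"
  proof (rule Lim_transform_eventually)
    show "\<forall>\<^sub>F s in at_top. wtail ?J b s * exp s * s powr (1 - real M / 2) + wtail ?J b' s * exp s * s powr (1 - real M / 2)
       = measure (sgauss ?J) {x \<in> space (leb ?J). s < \<bar>rowsq k a x / (2 * ?A)\<bar>} * exp s * s powr (1 - real M / 2)"
      using eventually_ge_at_top[of 0]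
    proof eventually_elim
      case (elim s)
      interpret prob_space "sgauss ?J" by (rule prob_space_sgauss)
      define X where "X x = rowsq k a x / (2 * ?A)" for x
      have w: "wsum ?J b x = X x" "wsum ?J b' x = - X x" for x
        unfolding b_def b'_def wsum_eq_rowsq X_def by (auto simp: rowsq_def sum_negf)
      have "prob {x \<in> space (leb ?J). s < \<bar>X x\<bar>} = prob ({x \<in> space (leb ?J). s < wsum ?J b x} \<union> {x \<in> space (leb ?J). s < wsum ?J b' x})"
        using elim unfolding w by (intro arg_cong[where f=prob]) auto
      also have "\<dots> = wtail ?J b s + wtail ?J b' s"
        unfolding wtail_def using elim
        by (intro finite_measure_Union sets_sgauss_less measurable_wsum) (auto simp: w simp del: One_nat_def)
      finally have "prob {x \<in> space (leb ?J). s < \<bar>X x\<bar>} = wtail ?J b s + wtail ?J b' s" .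
      then show ?case unfolding X_def by (simp only: distrib_right)
    qed
  qed
  then show ?thesis using A K c by blast
qed

text \<open>The origin of \<open>gamma_k\<close>: this normalisation cancels the factor
  \<open>Gamma (k / 2 + 1)\<close> in the ellipsoid volume.\<close>

lemma gamma_k_powr:
  assumes "k \<ge> 1"
  shows "gamma_k k > 0" "(2 * gamma_k k) powr (real k / 2) = 1 / Gamma (real k / 2 + 1)"
proof -
  have G: "Gamma (real k / 2) > 0" using assms by (intro Gamma_real_pos) simp
  have "Gamma (real k / 2 + 1) = real k / 2 * Gamma (real k / 2)"
    using assms by (intro Gamma_plus1) (auto simp: nonpos_Ints_def)
  then have "real k * Gamma (real k / 2) = 2 * Gamma (real k / 2 + 1)" by simp
  then have e: "2 / (real k * Gamma (real k / 2)) = 1 / Gamma (real k / 2 + 1)" by simp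
  have b: "2 / (real k * Gamma (real k / 2)) > 0"
    using assms by (intro divide_pos_pos mult_pos_pos G) auto
  then have "(2 / (real k * Gamma (real k / 2))) powr (2 / real k) > 0" by (metis powr_gt_zero less_irrefl)
  then show "gamma_k k > 0" unfolding gamma_k_def by linarith
  have "(2 * gamma_k k) powr (real k / 2) = ((2 / (real k * Gamma (real k / 2))) powr (2 / real k)) powr (real k / 2)"
    by (simp add: gamma_k_def)
  also have "\<dots> = (2 / (real k * Gamma (real k / 2))) powr 1"
    using assms by (simp only: powr_powr) simp
  also have "\<dots> = 2 / (real k * Gamma (real k / 2))" using b by (rule powr_one[OF less_imp_le])
  finally show "(2 * gamma_k k) powr (real k / 2) = 1 / Gamma (real k / 2 + 1)" using e by simp
qed

theorem theorem2p6:
  fixes k :: nat and a :: "nat \<Rightarrow> real"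
    and A :: "nat \<Rightarrow> real mat"
    and U :: "nat \<Rightarrow> ((nat \<times> nat) \<Rightarrow> real) \<Rightarrow> nat \<Rightarrow> real vec"
  assumes k_pos: "k \<ge> 1"
    and a_nz: "\<forall>i\<in>{1..k}. a i \<noteq> 0"
    and A_sym: "\<forall>N\<ge>k. A N \<in> carrier_mat N N \<and> transpose_mat (A N) = A N"
    and A_spec: "\<forall>N\<ge>k. char_poly (A N) = (\<Prod>j\<in>{1..k}. [:- a j, 1:]) * monom 1 (N - k)"
    and U_eig: "\<forall>N. \<forall>g\<in>space (GOE N). orthonormal_eigenbasis N (goe_mat N g) (U N g)"
    and U_meas: "\<forall>N. \<forall>i<N. \<forall>p<N. (\<lambda>g. U N g i $ p) \<in> borel_measurable (GOE N)"
  shows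
    "(amax k a > 0 \<longrightarrow>
        weak_conv
          (\<lambda>N. cdf (distr (GOE N) borel
             (\<lambda>g. real N / (2 * amax k a) * max_quad N (A N) (U N g) - ln (real N)
                  + (1 - real (mult_max k a) / 2) * ln (ln (real N)) + c_m k a)))
          gumbel_cdf
      \<and> weak_conv
          (\<lambda>N. cdf (distr (GOE N) borel
             (\<lambda>g. real N / (2 * astar k a) * max_abs_quad N (A N) (U N g) - ln (real N)
                  + (1 - real (max (mult_plus k a) (mult_minus k a)) / 2) * ln (ln (real N))
                  + c_star k a)))
          gumbel_cdf)
     \<and> (amax k a < 0 \<longrightarrow>
        weak_conv
          (\<lambda>N. cdf (distr (GOE N) borel
             (\<lambda>g. gamma_k k * real N powr (1 + 2 / real k)
                  / (\<Prod>j\<in>{1..k}. \<bar>a j\<bar>) powr (1 / real k)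
                  * max_quad N (A N) (U N g))))
          (weibull_cdf (real k / 2)))"
proof -
  define u where "u N g i = vec_index (U N g i)" for N g i
  have k: "k > 0" using k_pos by simp
  have sel: "eigenbasis_selection N (u N)" for N
    unfolding u_def by (rule eigenbasis_selection_vec_index) (use U_eig U_meas in auto)
  have Uc: "U N g i \<in> carrier_vec N" if "g \<in> space (GOE N)" "i < N" for N g i
    using U_eig that unfolding orthonormal_eigenbasis_def by blast
  have "\<exists>e. orthosys N {1..k} e \<and> (\<forall>x\<in>carrier_vec N.
      scalar_prod x (A N *\<^sub>v x) = (\<Sum>j\<in>{1..k}. a j * (ip N (e j) (vec_index x))\<^sup>2))" if "N \<ge> k" for N
  proof -
    have AN: "A N \<in> carrier_mat N N" "transpose_mat (A N) = A N"
      "char_poly (A N) = (\<Prod>j\<in>{1..k}. [:- a j, 1:]) * monom 1 (N - k)"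
      using A_sym A_spec that by blast+
    obtain g where g: "g \<in> space (GOE N)" "goe_mat N g = A N"
      using symmetric_mat_is_goe_mat[OF AN(1,2)] by blast
    have "orthonormal_eigenbasis N (A N) (U N g)" using U_eig g(1) unfolding g(2)[symmetric] by blast
    from symmetric_mat_eigenbasis_form[OF AN(1,2) that AN(3) this] show ?thesis .
  qed
  then obtain e where e: "\<And>N. N \<ge> k \<Longrightarrow> orthosys N {1..k} (e N)"
    and Ae: "\<And>N x. N \<ge> k \<Longrightarrow> x \<in> carrier_vec N \<Longrightarrow>
      scalar_prod x (A N *\<^sub>v x) = (\<Sum>j\<in>{1..k}. a j * (ip N (e N j) (vec_index x))\<^sup>2)"
    by metis
  \<comment> \<open>One argument covers both maxima: \<open>\<psi>\<close> will be the identity or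
    the absolute value.\<close>
  define mq where "mq \<psi> N g = Max {\<psi> (scalar_prod (U N g i) (A N *\<^sub>v U N g i)) | i. i < N}" for \<psi> :: "real \<Rightarrow> real" and N g
  have ev: "{g \<in> space (GOE N). mq \<psi> N g \<le> t} = eigenbasis_selection.quad_event N (u N) {r. \<psi> r \<le> t} {1..k} a (e N)"
    if N: "N \<ge> k" for \<psi> N t
  proof -
    interpret eigenbasis_selection N "u N" by (rule sel)
    have "N > 0" using N k by simp
    show ?thesis
      unfolding quad_event_def mq_def Max_le_iff_all[OF \<open>N > 0\<close>]
      using Ae[OF N Uc] by (auto simp: u_def)
  qed
  \<comment> \<open>The set \<open>S N\<close> is prescribed only for \<open>N \<ge> k\<close>,
    where the scale \<open>\<alpha> N\<close> is positive and can be divided out; limits ignore the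
    remaining \<open>N\<close>.\<close>
  have cdf_limit: "(\<lambda>N. cdf (distr (GOE N) borel (\<lambda>g. \<alpha> N * mq \<psi> N g + \<beta> N)) x) \<longlonglongrightarrow> L"
    if \<psi>: "\<psi> \<in> borel_measurable borel" and \<alpha>: "\<And>N. N \<ge> k \<Longrightarrow> \<alpha> N > 0"
      and S: "\<And>N. S N \<in> sets borel" and SE: "\<And>N. N \<ge> k \<Longrightarrow> S N = {r. \<psi> r \<le> (x - \<beta> N) / \<alpha> N}"
      and lim: "(\<lambda>N. measure (matgauss N k) (gs_event N k (eps N) a (S N))) \<longlonglongrightarrow> L"
    for \<psi> \<alpha> \<beta> S x L
  proof (rule Lim_transform_eventually[OF quad_event_limit[OF k sel e S lim]])
    show "\<forall>\<^sub>F N in sequentially. measure (GOE N) (eigenbasis_selection.quad_event N (u N) (S N) {1..k} a (e N))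
        = cdf (distr (GOE N) borel (\<lambda>g. \<alpha> N * mq \<psi> N g + \<beta> N)) x"
      using eventually_ge_at_top[of k]
    proof eventually_elim
      case (elim N)
      interpret eigenbasis_selection N "u N" by (rule sel)
      have "{g \<in> space (GOE N). mq \<psi> N g \<le> t} \<in> sets (GOE N)" for t
        unfolding ev[OF elim] using \<psi> by (intro sets_quad_event) measurable
      from cdf_distr_affine[OF prob_space_GOE this \<alpha>[OF elim]]
      show ?case by (simp only: ev[OF elim] SE[OF elim])
    qed
  qed
  \<comment> \<open>Positive homogeneity of \<open>\<psi>\<close> moves the factor
    \<open>N / (2 * A0)\<close> inside, which matches the sublevel set with the one in
    \<open>gs_event_gumbel_limit\<close>. Convergence is shown at every \<open>x\<close>, more than
    weak convergence asks for.\<close>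
  have gumbel: "weak_conv (\<lambda>N. cdf (distr (GOE N) borel (\<lambda>g. real N / (2 * A0) * mq \<psi> N g - ln (real N) + q * ln (ln (real N)) + c))) gumbel_cdf"
    if A0: "A0 > 0" and lip: "\<And>x y. \<psi> x \<le> \<psi> y + \<bar>x - y\<bar>" and scale: "\<And>x c. c > 0 \<Longrightarrow> \<psi> (c * x) = c * \<psi> x"
      and \<psi>m: "\<psi> \<in> borel_measurable borel" and K: "K > 0" "c = - ln K"
      and T: "((\<lambda>s. measure (sgauss {1..k}) {x \<in> space (leb {1..k}). s < \<psi> (rowsq k a x / (2 * A0))} * exp s * s powr q) \<longlongrightarrow> K) at_top"
    for A0 \<psi> q c K
    unfolding weak_conv_def
  proof (intro allI impI)
    fix x
    define S where "S N = {r. \<psi> (real N * r / (2 * A0)) \<le> ln (real N) - q * ln (ln (real N)) + ln K + x}" for N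
    have "(\<lambda>N. cdf (distr (GOE N) borel (\<lambda>g. real N / (2 * A0) * mq \<psi> N g + (- ln (real N) + q * ln (ln (real N)) + c))) x) \<longlonglongrightarrow> gumbel_cdf x"
    proof (rule cdf_limit[OF \<psi>m, of _ S])
      show "real N / (2 * A0) > 0" if "N \<ge> k" for N using that k A0 by simp
      show "S N \<in> sets borel" for N
      proof -
        have "(\<lambda>r. \<psi> (real N * r / (2 * A0))) \<in> borel_measurable borel" by (intro measurable_compose[OF _ \<psi>m]) simp
        then show ?thesis by (simp add: S_def)
      qed
      show "S N = {r. \<psi> r \<le> (x - (- ln (real N) + q * ln (ln (real N)) + c)) / (real N / (2 * A0))}" if "N \<ge> k" for N
      proof -
        have p: "real N / (2 * A0) > 0" using that k A0 by simp
        have sc: "\<psi> (real N * r / (2 * A0)) = \<psi> r * (real N / (2 * A0))" for r using scale[OF p, of r] by simp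
        have y: "x - (- ln (real N) + q * ln (ln (real N)) + c) = ln (real N) - q * ln (ln (real N)) + ln K + x"
          by (simp add: K(2))
        show ?thesis unfolding S_def y pos_le_divide_eq[OF p] sc ..
      qed
      show "(\<lambda>N. measure (matgauss N k) (gs_event N k (eps N) a (S N))) \<longlonglongrightarrow> gumbel_cdf x"
        unfolding S_def gumbel_cdf_def by (rule gs_event_gumbel_limit[OF k A0 lip \<psi>m T K(1)])
    qed
    moreover have "(\<lambda>g. real N / (2 * A0) * mq \<psi> N g + (- ln (real N) + q * ln (ln (real N)) + c))
        = (\<lambda>g. real N / (2 * A0) * mq \<psi> N g - ln (real N) + q * ln (ln (real N)) + c)" for N
      by (simp add: fun_eq_iff)
    ultimately show "(\<lambda>N. cdf (distr (GOE N) borel (\<lambda>g. real N / (2 * A0) * mq \<psi> N g - ln (real N) + q * ln (ln (real N)) + c)) x) \<longlonglongrightarrow> gumbel_cdf x"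
      by (simp only:)
  qed
  have mq_id: "mq (\<lambda>r. r) N g = max_quad N (A N) (U N g)" and mq_abs: "mq abs N g = max_abs_quad N (A N) (U N g)" for N g
    by (simp_all add: mq_def max_quad_def max_abs_quad_def)
  show ?thesis
  proof (intro conjI impI)
    assume pos: "amax k a > 0"
    obtain K where K: "K > 0" "c_m k a = - ln K"
      "((\<lambda>s. measure (sgauss {1..k}) {x \<in> space (leb {1..k}). s < rowsq k a x / (2 * amax k a)} * exp s * s powr (1 - real (mult_max k a) / 2)) \<longlongrightarrow> K) at_top"
      using amax_tail[OF k_pos pos] by blast
    show "weak_conv (\<lambda>N. cdf (distr (GOE N) borel
             (\<lambda>g. real N / (2 * amax k a) * max_quad N (A N) (U N g) - ln (real N)
                  + (1 - real (mult_max k a) / 2) * ln (ln (real N)) + c_m k a))) gumbel_cdf"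
      unfolding mq_id[symmetric] by (rule gumbel[OF pos _ _ _ K(1,2)]) (use K(3) in auto)
    obtain K' where K': "K' > 0" "astar k a > 0" "c_star k a = - ln K'"
      "((\<lambda>s. measure (sgauss {1..k}) {x \<in> space (leb {1..k}). s < \<bar>rowsq k a x / (2 * astar k a)\<bar>} * exp s * s powr (1 - real (max (mult_plus k a) (mult_minus k a)) / 2)) \<longlongrightarrow> K') at_top"
      using astar_tail[OF k_pos a_nz] by blast
    show "weak_conv (\<lambda>N. cdf (distr (GOE N) borel
             (\<lambda>g. real N / (2 * astar k a) * max_abs_quad N (A N) (U N g) - ln (real N)
                  + (1 - real (max (mult_plus k a) (mult_minus k a)) / 2) * ln (ln (real N))
                  + c_star k a))) gumbel_cdf"
      unfolding mq_abs[symmetric]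
      by (rule gumbel[OF K'(2) _ _ _ K'(1,3,4)]) (auto simp: abs_mult)
  next
    assume neg0: "amax k a < 0"
    have neg: "a j < 0" if "j \<in> {1..k}" for j
    proof -
      have "a j \<le> amax k a" unfolding amax_def using that by (intro Max_ge) auto
      then show ?thesis using neg0 by simp
    qed
    define P where "P = (\<Prod>j\<in>{1..k}. \<bar>a j\<bar>)"
    have P: "P > 0" unfolding P_def using a_nz by (intro prod_pos) auto
    have Pneg: "(\<Prod>j\<in>{1..k}. - a j) = P" unfolding P_def using neg by (intro prod.cong) (auto simp: abs_of_neg)
    note gam = gamma_k_powr[OF k_pos]
    define \<alpha> where "\<alpha> N = gamma_k k * real N powr (1 + 2 / real k) / P powr (1 / real k)" for N :: nat
    have \<alpha>: "\<alpha> N > 0" if "N \<ge> k" for N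
      unfolding \<alpha>_def using gam(1) P that k by (intro divide_pos_pos mult_pos_pos) auto
    have main: "(\<lambda>N. cdf (distr (GOE N) borel (\<lambda>g. \<alpha> N * mq (\<lambda>r. r) N g + 0)) x) \<longlonglongrightarrow> weibull_cdf (real k / 2) x" for x
    proof (cases "x < 0")
      case True
      \<comment> \<open>Chosen so that \<open>- 2 * v N = N * (x / \<alpha> N)\<close>: the level
        \<open>x\<close> of the rescaled maximum, expressed as a small-ball level of the positive
        form with weights \<open>- a j\<close>.\<close>
      define v where "v N = (- x) * P powr (1 / real k) / (2 * gamma_k k) * real N powr (- 2 / real k)" for N :: nat
      define S where "S N = {r. real N * r \<le> - 2 * v N}" for N :: nat
      have vpos: "v N > 0" if "N > 0" for N
        unfolding v_def using True P gam(1) that by (intro mult_pos_pos divide_pos_pos) auto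
      have v0: "v \<longlonglongrightarrow> 0"
      proof -
        have "(\<lambda>N. real N powr (- 2 / real k)) \<longlonglongrightarrow> 0" using k by real_asymp
        from tendsto_mult_left[OF this, of "(- x) * P powr (1 / real k) / (2 * gamma_k k)"]
        show ?thesis unfolding v_def[abs_def] by (simp only: mult_zero_right)
      qed
      \<comment> \<open>The expected number of rows in the ellipsoid, to leading order, is constant
        in \<open>N\<close>: the powers of \<open>N\<close> cancel, \<open>sqrt P\<close> cancels
        the Jacobian, and \<open>gamma_k\<close> cancels the Gamma factor.\<close>
      have vk: "real N * (v N powr (real k / 2) / (Gamma (real k / 2 + 1) * sqrt (\<Prod>j\<in>{1..k}. - a j))) = (- x) powr (real k / 2)" if N: "N > 0" for N
      proof -
        define G where "G = Gamma (real k / 2 + 1)"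
        have G: "G > 0" unfolding G_def by (intro Gamma_real_pos) simp
        have "v N powr (real k / 2) = (- x) powr (real k / 2) * (P powr (1 / real k)) powr (real k / 2)
            / (2 * gamma_k k) powr (real k / 2) * (real N powr (- 2 / real k)) powr (real k / 2)"
        proof -
          have pw: "(y * p / g * n) powr r = y powr r * p powr r / g powr r * n powr r"
            if "y > 0" "p > 0" "g > 0" "n > 0" for y p g n r :: real
            using that by (simp add: powr_mult powr_divide)
          show ?thesis unfolding v_def by (rule pw) (use True P gam(1) N in auto)
        qed
        also have "(P powr (1 / real k)) powr (real k / 2) = sqrt P"
          using k P by (simp add: powr_powr powr_half_sqrt)
        also have "(real N powr (- 2 / real k)) powr (real k / 2) = 1 / real N"
        proof -
          have "(- 2 / real k) * (real k / 2) = - 1" using k by simp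
          then show ?thesis unfolding powr_powr using N by (simp add: powr_minus_divide)
        qed
        finally have "v N powr (real k / 2) = (- x) powr (real k / 2) * sqrt P * Gamma (real k / 2 + 1) / real N"
          unfolding gam(2) by simp
        then show ?thesis unfolding Pneg G_def[symmetric] using N P G by simp
      qed
      have "(\<lambda>N. cdf (distr (GOE N) borel (\<lambda>g. \<alpha> N * mq (\<lambda>r. r) N g + 0)) x) \<longlonglongrightarrow> exp (- ((- x) powr (real k / 2)))"
      proof (rule cdf_limit[where S=S])
        show "(\<lambda>r::real. r) \<in> borel_measurable borel" by simp
        show "\<alpha> N > 0" if "N \<ge> k" for N using that by (rule \<alpha>)
        show "S N \<in> sets borel" for N unfolding S_def by measurable
        show "S N = {r. r \<le> (x - 0) / \<alpha> N}" if "N \<ge> k" for N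
        proof -
          have N: "N > 0" using that k by simp
          have "- 2 * v N = real N * (x / \<alpha> N)"
          proof -
            define R where "R = real N powr (2 / real k)"
            define Q where "Q = P powr (1 / real k)"
            have pos: "R > 0" "Q > 0" "gamma_k k > 0" "real N > 0" using N P gam(1) by (auto simp: R_def Q_def)
            have \<alpha>e: "\<alpha> N = gamma_k k * (real N * R) / Q" using N by (simp add: \<alpha>_def R_def Q_def powr_add)
            have ve: "v N = (- x) * Q / (2 * gamma_k k) * (1 / R)"
              using N by (simp add: v_def R_def Q_def powr_minus_divide)
            show ?thesis unfolding \<alpha>e ve using pos by (simp add: field_simps)
          qed
          then have "real N * r \<le> - 2 * v N \<longleftrightarrow> r \<le> x / \<alpha> N" for r
            using N by (simp only: mult_le_cancel_left_pos of_nat_0_less_iff)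
          then show ?thesis by (simp add: S_def)
        qed
        have "(\<lambda>N. real N * (v N powr (real k / 2) / (Gamma (real k / 2 + 1) * sqrt (\<Prod>j\<in>{1..k}. - a j)))) \<longlonglongrightarrow> (- x) powr (real k / 2)"
        proof (rule Lim_transform_eventually[OF tendsto_const])
          show "\<forall>\<^sub>F N in sequentially. (- x) powr (real k / 2) = real N * (v N powr (real k / 2) / (Gamma (real k / 2 + 1) * sqrt (\<Prod>j\<in>{1..k}. - a j)))"
            by (rule eventually_mono[OF eventually_gt_at_top[of 0]]) (simp only: vk)
        qed
        then show "(\<lambda>N. measure (matgauss N k) (gs_event N k (eps N) a (S N))) \<longlonglongrightarrow> exp (- ((- x) powr (real k / 2)))"
          unfolding S_def
          by (intro gs_event_weibull_limit k neg v0 eventually_mono[OF eventually_gt_at_top[of 0] vpos])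
      qed
      then show ?thesis using True by (simp add: weibull_cdf_def)
    next
      \<comment> \<open>For \<open>x \<ge> 0\<close> there is no limit to take: a form with negative
        weights is at most 0, so the distribution function equals 1 for every
        \<open>N \<ge> k\<close>.\<close>
      case False
      show ?thesis
      proof (rule Lim_transform_eventually[OF tendsto_const])
        show "\<forall>\<^sub>F N in sequentially. weibull_cdf (real k / 2) x = cdf (distr (GOE N) borel (\<lambda>g. \<alpha> N * mq (\<lambda>r. r) N g + 0)) x"
          using eventually_ge_at_top[of k]
        proof eventually_elim
          case (elim N)
          interpret eigenbasis_selection N "u N" by (rule sel)
          interpret G: prob_space "GOE N" by (rule prob_space_GOE)
          have "{g \<in> space (GOE N). mq (\<lambda>r. r) N g \<le> t} \<in> sets (GOE N)" for t
            unfolding ev[OF elim] by (intro sets_quad_event) measurable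
          from cdf_distr_affine[OF prob_space_GOE this \<alpha>[OF elim], of 0 x]
          have "cdf (distr (GOE N) borel (\<lambda>g. \<alpha> N * mq (\<lambda>r. r) N g + 0)) x = measure (GOE N) (quad_event {r. r \<le> (x - 0) / \<alpha> N} {1..k} a (e N))"
            unfolding ev[OF elim] .
          also have "quad_event {r. r \<le> (x - 0) / \<alpha> N} {1..k} a (e N) = space (GOE N)"
          proof -
            have "(\<Sum>j\<in>{1..k}. a j * (ip N (e N j) (u N g i))\<^sup>2) \<le> x / \<alpha> N" for g i
            proof -
              have "(\<Sum>j\<in>{1..k}. a j * (ip N (e N j) (u N g i))\<^sup>2) \<le> 0"
                using neg by (intro sum_nonpos mult_nonpos_nonneg) (auto intro: less_imp_le)
              also have "0 \<le> x / \<alpha> N" using False \<alpha>[OF elim] by simp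
              finally show ?thesis .
            qed
            then show ?thesis by (simp add: quad_event_def del: One_nat_def)
          qed
          finally show ?case using False G.prob_space by (simp add: weibull_cdf_def)
        qed
      qed
    qed
    show "weak_conv (\<lambda>N. cdf (distr (GOE N) borel
             (\<lambda>g. gamma_k k * real N powr (1 + 2 / real k)
                  / (\<Prod>j\<in>{1..k}. \<bar>a j\<bar>) powr (1 / real k)
                  * max_quad N (A N) (U N g)))) (weibull_cdf (real k / 2))"
      unfolding weak_conv_def using main by (simp add: \<alpha>_def P_def mq_id)
  qed
qed

end
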